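(* Let $N$ be a positive integer, let $1<p<2$ with $p<N$, and let $p^*=\frac{pN}{N-p}$. Let $\Omega\subset\mathbb{R}^N$ be a bounded open connected set with smooth boundary. Let $M:[0,+\infty)\to[0,+\infty)$ be a continuous function and let $\widehat M(t)=\int_0^t M(s)\,\mathrm{d}s$ for $t\ge 0$. Assume that i) $\widehat M(t+s)\ge \widehat M(t)+\widehat M(s)$ for every $t,s\in[0,+\infty)$; ii) $\displaystyle\inf_{t>0}\frac{\widehat M(t)}{t^{p^*/p}}\ge c_p$, where $c_p=2^{2p^*-1-\frac{p^*}{p}}\,\frac{p}{p^*}\,S_N^{-\frac{p^*}{p}}$. Then the functional $\mathcal E:W^{1,p}_0(\Omega)\to\mathbb{R}$ defined by $$\mathcal E(u)=\frac1p\widehat M(\|u\|^p)-\frac{1}{p^*}\|u\|_{p^*}^{p^*}$$ is sequentially weakly lower semicontinuous on $W^{1,p}_0(\Omega)$.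
   Context: The space $W^{1,p}_0(\Omega)$ is endowed with the norm $\|u\|=\left(\int_\Omega|\nabla u|^p\,\mathrm{d}x\right)^{1/p}$, and $\|u\|_q=\left(\int_\Omega|u|^q\,\mathrm{d}x\right)^{1/q}$ denotes the norm of $L^q(\Omega)$. $S_N>0$ denotes the (best) embedding constant of $W^{1,p}_0(\Omega)\hookrightarrow L^{p^*}(\Omega)$, i.e. the largest constant such that $\|u\|_{p^*}^p\le S_N^{-1}\|u\|^p$ for every $u\in W^{1,p}_0(\Omega)$. *)

theory Defs
  imports "HOL-Analysis.Analysis"
begin

text \<open>Intended for open \<open>S\<close>: all directional derivatives (equivalently, all partial derivatives)
  of order at most \<open>k\<close> exist and are continuous on \<open>S\<close>.\<close>

primrec Ck_on :: "nat \<Rightarrow> 'a set \<Rightarrow> ('a::euclidean_space \<Rightarrow> real) \<Rightarrow> bool" where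
  "Ck_on 0 S f \<longleftrightarrow> continuous_on S f"
| "Ck_on (Suc k) S f \<longleftrightarrow>
     (\<forall>x\<in>S. f differentiable (at x)) \<and> (\<forall>v. Ck_on k S (\<lambda>x. frechet_derivative f (at x) v))"

definition smooth_on :: "'a set \<Rightarrow> ('a::euclidean_space \<Rightarrow> real) \<Rightarrow> bool" where
  "smooth_on S f \<longleftrightarrow> (\<forall>k. Ck_on k S f)"

text \<open>Locally, and up to the choice of a vertical direction \<open>e\<close>, the set is the part of a ball
  above the graph of a smooth function of the \<open>N - 1\<close> remaining variables.  Instead of a
  Euclidean space of dimension \<open>N - 1\<close> we use the hyperplane orthogonal to \<open>e\<close>: \<open>\<gamma>\<close> is only
  evaluated at orthogonal projections onto it.\<close>

definition smooth_boundary :: "(real^'n) set \<Rightarrow> bool" where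
  "smooth_boundary \<Omega> \<longleftrightarrow>
     (\<forall>x0\<in>frontier \<Omega>. \<exists>r>0. \<exists>e. \<exists>\<gamma>. norm e = 1 \<and> smooth_on UNIV \<gamma> \<and>
        \<Omega> \<inter> ball x0 r = {x \<in> ball x0 r. x \<bullet> e > \<gamma> (x - (x \<bullet> e) *\<^sub>R e)})"

definition test_functions :: "(real^'n) set \<Rightarrow> (real^'n \<Rightarrow> real) set" where
  "test_functions \<Omega> =
     {\<phi>. smooth_on UNIV \<phi> \<and> compact (closure {x. \<phi> x \<noteq> 0}) \<and> closure {x. \<phi> x \<noteq> 0} \<subseteq> \<Omega>}"

text \<open>Elements are represented by functions on the whole space of which only the values on
  \<open>\<Omega>\<close> matter; functions that agree almost everywhere on \<open>\<Omega>\<close> are not identified, so the norms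
  below are seminorms on representatives.\<close>

definition Lp_space :: "real \<Rightarrow> (real^'n) set \<Rightarrow> (real^'n \<Rightarrow> 'b::euclidean_space) set" where
  "Lp_space q \<Omega> = {f \<in> borel_measurable (lebesgue_on \<Omega>).
     integrable (lebesgue_on \<Omega>) (\<lambda>x. norm (f x) powr q)}"

definition Lp_norm :: "real \<Rightarrow> (real^'n) set \<Rightarrow> (real^'n \<Rightarrow> 'b::euclidean_space) \<Rightarrow> real" where
  "Lp_norm q \<Omega> f = (\<integral>x. norm (f x) powr q \<partial>lebesgue_on \<Omega>) powr (1 / q)"

definition locally_integrable :: "(real^'n) set \<Rightarrow> (real^'n \<Rightarrow> 'b::euclidean_space) \<Rightarrow> bool" where
  "locally_integrable \<Omega> f \<longleftrightarrow> (\<forall>K. compact K \<and> K \<subseteq> \<Omega> \<longrightarrow> integrable (lebesgue_on K) f)"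

definition has_weak_gradient :: "(real^'n) set \<Rightarrow> (real^'n \<Rightarrow> real) \<Rightarrow> (real^'n \<Rightarrow> real^'n) \<Rightarrow> bool" where
  "has_weak_gradient \<Omega> u G \<longleftrightarrow> locally_integrable \<Omega> u \<and> locally_integrable \<Omega> G \<and>
     (\<forall>\<phi>\<in>test_functions \<Omega>. \<forall>i.
        (\<integral>x. u x * frechet_derivative \<phi> (at x) (axis i 1) \<partial>lebesgue_on \<Omega>) =
        - (\<integral>x. G x $ i * \<phi> x \<partial>lebesgue_on \<Omega>))"

text \<open>The weak gradient is unique almost everywhere on \<open>\<Omega>\<close>, so integrals of it do not depend
  on the choice made here.\<close>

definition weak_gradient :: "(real^'n) set \<Rightarrow> (real^'n \<Rightarrow> real) \<Rightarrow> real^'n \<Rightarrow> real^'n" where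
  "weak_gradient \<Omega> u = (SOME G. has_weak_gradient \<Omega> u G)"

definition W1p :: "real \<Rightarrow> (real^'n) set \<Rightarrow> (real^'n \<Rightarrow> real) set" where
  "W1p p \<Omega> = {u \<in> Lp_space p \<Omega>. \<exists>G\<in>Lp_space p \<Omega>. has_weak_gradient \<Omega> u G}"

definition W1p_norm :: "real \<Rightarrow> (real^'n) set \<Rightarrow> (real^'n \<Rightarrow> real) \<Rightarrow> real" where
  "W1p_norm p \<Omega> u = (Lp_norm p \<Omega> u powr p + Lp_norm p \<Omega> (weak_gradient \<Omega> u) powr p) powr (1 / p)"

text \<open>The closure of the test functions in the full Sobolev norm.\<close>

definition W1p0 :: "real \<Rightarrow> (real^'n) set \<Rightarrow> (real^'n \<Rightarrow> real) set" where
  "W1p0 p \<Omega> = {u \<in> W1p p \<Omega>. \<exists>\<phi>. (\<forall>k::nat. \<phi> k \<in> test_functions \<Omega>) \<and>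
     (\<lambda>k. W1p_norm p \<Omega> (\<lambda>x. u x - \<phi> k x)) \<longlonglongrightarrow> 0}"

definition W1p0_norm :: "real \<Rightarrow> (real^'n) set \<Rightarrow> (real^'n \<Rightarrow> real) \<Rightarrow> real" where
  "W1p0_norm p \<Omega> u = Lp_norm p \<Omega> (weak_gradient \<Omega> u)"

text \<open>The boundedness condition forces a functional to respect equality almost everywhere.\<close>

definition W1p0_dual :: "real \<Rightarrow> (real^'n) set \<Rightarrow> ((real^'n \<Rightarrow> real) \<Rightarrow> real) set" where
  "W1p0_dual p \<Omega> = {l.
     (\<forall>u\<in>W1p0 p \<Omega>. \<forall>v\<in>W1p0 p \<Omega>. l (\<lambda>x. u x + v x) = l u + l v) \<and>
     (\<forall>c. \<forall>u\<in>W1p0 p \<Omega>. l (\<lambda>x. c * u x) = c * l u) \<and>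
     (\<exists>C. \<forall>u\<in>W1p0 p \<Omega>. \<bar>l u\<bar> \<le> C * W1p0_norm p \<Omega> u)}"

definition W1p0_weakly_converges ::
  "real \<Rightarrow> (real^'n) set \<Rightarrow> (nat \<Rightarrow> real^'n \<Rightarrow> real) \<Rightarrow> (real^'n \<Rightarrow> real) \<Rightarrow> bool" where
  "W1p0_weakly_converges p \<Omega> v u \<longleftrightarrow> (\<forall>l\<in>W1p0_dual p \<Omega>. (\<lambda>n. l (v n)) \<longlonglongrightarrow> l u)"

definition seq_weakly_lsc_W1p0 ::
  "real \<Rightarrow> (real^'n) set \<Rightarrow> ((real^'n \<Rightarrow> real) \<Rightarrow> real) \<Rightarrow> bool" where
  "seq_weakly_lsc_W1p0 p \<Omega> F \<longleftrightarrow>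
     (\<forall>v u. (\<forall>n. v n \<in> W1p0 p \<Omega>) \<and> u \<in> W1p0 p \<Omega> \<and> W1p0_weakly_converges p \<Omega> v u
        \<longrightarrow> ereal (F u) \<le> liminf (\<lambda>n. ereal (F (v n))))"

definition critical_exponent :: "nat \<Rightarrow> real \<Rightarrow> real" where
  "critical_exponent N p = p * real N / (real N - p)"

text \<open>The best embedding constant.  Membership in the target space is required explicitly because
  \<^const>\<open>Lp_norm\<close> is 0 for functions that are not integrable to the given power.  The greatest
  constant exists whenever \<open>1 < p < N\<close> and \<open>\<Omega>\<close> is open and nonempty.\<close>

definition sobolev_constant :: "real \<Rightarrow> (real^'n) set \<Rightarrow> real" where
  "sobolev_constant p \<Omega> =
     (let ps = critical_exponent CARD('n) p in
      GREATEST S. 0 < S \<and> (\<forall>u\<in>W1p0 p \<Omega>.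
        u \<in> Lp_space ps \<Omega> \<and> Lp_norm ps \<Omega> u powr p \<le> inverse S * W1p0_norm p \<Omega> u powr p))"

definition primitive0 :: "(real \<Rightarrow> real) \<Rightarrow> real \<Rightarrow> real" where
  "primitive0 M t = integral {0..t} M"

definition kirchhoff_energy ::
  "real \<Rightarrow> (real^'n) set \<Rightarrow> (real \<Rightarrow> real) \<Rightarrow> (real^'n \<Rightarrow> real) \<Rightarrow> real" where
  "kirchhoff_energy p \<Omega> M u =
     (let ps = critical_exponent CARD('n) p in
      1 / p * primitive0 M (W1p0_norm p \<Omega> u powr p) - 1 / ps * Lp_norm ps \<Omega> u powr ps)"

end

theory Submission
  imports Defs
begin

text \<open>
  Let \<open>u\<close> be a weak limit of functions of energy less than \<open>a\<close>; the claim is \<open>\<E>(u) \<le> a\<close>.  By density one may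
  take test functions \<open>\<phi>\<^sub>j\<close> converging weakly to \<open>u\<close> with \<open>\<E>(\<phi>\<^sub>j) < a\<close>; as the constant in
  (ii) exceeds the optimal one, \<open>\<E>\<close> is coercive and the \<open>\<phi>\<^sub>j\<close> are bounded, so that a subsequence
  converges almost everywhere (compare \<open>\<phi>\<^sub>j\<close> with its averages over small balls, which are bounded functionals).

  Split \<open>\<phi> = T\<phi> + R\<phi>\<close> with \<open>T s = k arctan (s / k)\<close>.  Since \<open>0 \<le> T' \<le> 1\<close>, the energies satisfy
  \<open>\<parallel>T\<phi>\<parallel>\<^sup>p + \<parallel>R\<phi>\<parallel>\<^sup>p \<le> \<parallel>\<phi>\<parallel>\<^sup>p\<close>, and (i) bounds the primitive at \<open>\<parallel>\<phi>\<parallel>\<^sup>p\<close> below by its values at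
  \<open>\<parallel>T\<phi>\<parallel>\<^sup>p\<close> and \<open>\<parallel>R\<phi>\<parallel>\<^sup>p\<close>.  By (ii) and the Sobolev inequality the latter value dominates the part of
  \<open>\<parallel>\<phi>\<parallel>\<close> in \<open>L\<^bsup>p*\<^esup>\<close> carried by large values of \<open>\<phi>\<close>, with room to spare; the part carried by bounded values
  converges by dominated convergence.  The gradient term of \<open>T\<phi>\<^sub>j\<close> is lower semicontinuous by convexity,
  and finally \<open>k \<rightarrow> \<infinity>\<close>.
\<close>

subsection \<open>Smooth functions\<close>

text \<open>The obstacle is that the embedding into the critical Lebesgue space is not compact:
  along a weakly convergent sequence part of the critical norm may concentrate at large values and
  disappear in the limit, so the negative term of the energy is not lower semicontinuous by itself.
  Only the gradient spent on large values can pay for them; this is why (i) is used to split the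
  primitive and (ii) to compare the split-off part with the Sobolev inequality. The surplus over the
  optimal constant allows the cut to be made at a finite multiple of \<open>k\<close>: beyond it the
  remainder \<open>\<phi> - T\<phi>\<close> carries enough of \<open>\<phi>\<close>.

  Two things have to be secured beforehand. The best constant is introduced by
  \<open>GREATEST\<close> and means nothing until some Sobolev inequality is known, with whatever
  constant; and gradients are chosen by \<open>SOME\<close>, so uniqueness almost everywhere has to
  precede any computation with norms. The limits are taken in a fixed order: \<open>j\<close> first
  with \<open>k\<close> held fixed, so that the truncated integrands stay bounded, and only then
  \<open>k\<close>.\<close>

lemma Ck_on_SucD: "Ck_on (Suc k) UNIV f \<Longrightarrow> Ck_on k UNIV f"
proof (induction k arbitrary: f)
  case 0
  then show ?case
    by (simp add: continuous_on_eq_continuous_within differentiable_imp_continuous_within)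
next
  case (Suc k)
  then show ?case by auto
qed

lemma Ck_on_SucI:
  assumes "\<And>x. (f has_derivative D x) (at x)" "\<And>v. Ck_on k UNIV (\<lambda>x. D x v)"
  shows "Ck_on (Suc k) UNIV f"
proof -
  have "frechet_derivative f (at x) = D x" for x
    using frechet_derivative_at[OF assms(1)] by metis
  then show ?thesis using assms by (auto simp: differentiable_def)
qed

lemma Ck_on_frechet:
  assumes "Ck_on (Suc k) UNIV f"
  shows "(f has_derivative frechet_derivative f (at x)) (at x)"
    and "Ck_on k UNIV (\<lambda>x. frechet_derivative f (at x) v)"
  using assms frechet_derivative_works by auto

lemma Ck_on_const: "Ck_on k UNIV (\<lambda>x. c)"
proof (induction k arbitrary: c)
  case (Suc k)
  show ?case by (rule Ck_on_SucI[where D = "\<lambda>_ _. 0"]) (auto intro: Suc)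
qed simp

lemma Ck_on_add:
  "Ck_on k UNIV f \<Longrightarrow> Ck_on k UNIV g \<Longrightarrow> Ck_on k UNIV (\<lambda>x. f x + g x)"
proof (induction k arbitrary: f g)
  case 0
  then show ?case by (simp add: continuous_on_add)
next
  case (Suc k)
  show ?case
    by (rule Ck_on_SucI[OF has_derivative_add[OF Ck_on_frechet(1)[OF Suc.prems(1)] Ck_on_frechet(1)[OF Suc.prems(2)]]])
      (intro Suc.IH Ck_on_frechet(2) Suc.prems)
qed

lemma Ck_on_mult:
  "Ck_on k UNIV f \<Longrightarrow> Ck_on k UNIV g \<Longrightarrow> Ck_on k UNIV (\<lambda>x. f x * g x)"
proof (induction k arbitrary: f g)
  case 0
  then show ?case by (simp add: continuous_on_mult)
next
  case (Suc k)
  show ?case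
    by (rule Ck_on_SucI[OF has_derivative_mult[OF Ck_on_frechet(1)[OF Suc.prems(1)] Ck_on_frechet(1)[OF Suc.prems(2)]]])
      (intro Ck_on_add Suc.IH Ck_on_frechet(2) Suc.prems Ck_on_SucD[OF Suc.prems(1)] Ck_on_SucD[OF Suc.prems(2)])
qed

lemma Ck_on_linear: 
  assumes "bounded_linear f" shows "Ck_on k UNIV f"
proof (cases k)
  case 0
  then show ?thesis using assms by (simp add: linear_continuous_on)
next
  case (Suc n)
  show ?thesis unfolding Suc
    by (rule Ck_on_SucI[OF bounded_linear_imp_has_derivative[OF assms]]) (rule Ck_on_const)
qed

lemma Ck_on_prod:
  "(\<And>i. i \<in> I \<Longrightarrow> Ck_on k UNIV (f i)) \<Longrightarrow> Ck_on k UNIV (\<lambda>x. \<Prod>i\<in>I. f i x)"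
  by (induction I rule: infinite_finite_induct) (auto intro: Ck_on_mult Ck_on_const)

lemma Ck_on_real_SucI:
  fixes f :: "real \<Rightarrow> real"
  assumes "\<And>x. (f has_real_derivative f' x) (at x)" "Ck_on k UNIV f'"
  shows "Ck_on (Suc k) UNIV f"
  using assms by (intro Ck_on_SucI[where D = "\<lambda>x h. f' x * h"] Ck_on_mult Ck_on_const) (auto simp: has_field_derivative_def)

text \<open>In one variable the derivative of \<open>F\<close> is multiplication by a number, so the
  derivative of the composition is a product with a factor of the same shape
  \<open>F' (f x)\<close>. The induction hypothesis applies to it after lowering the order of
  \<open>f\<close> by one.\<close>

lemma Ck_on_compose:
  fixes F :: "real \<Rightarrow> real"
  shows "Ck_on k UNIV F \<Longrightarrow> Ck_on k UNIV f \<Longrightarrow> Ck_on k UNIV (\<lambda>x. F (f x))"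
proof (induction k arbitrary: F f)
  case 0
  then show ?case using continuous_on_compose2[of UNIV F UNIV f] by simp
next
  case (Suc k)
  let ?F' = "\<lambda>y. frechet_derivative F (at y) 1"
  have F': "frechet_derivative F (at y) h = h * ?F' y" for y h
    using linear_cmul[OF has_derivative_linear[OF Ck_on_frechet(1)[OF Suc.prems(1)]], of y h 1] by simp
  have "((\<lambda>x. F (f x)) has_derivative (\<lambda>v. frechet_derivative f (at x) v * ?F' (f x))) (at x)" for x
    using has_derivative_compose[OF Ck_on_frechet(1)[OF Suc.prems(2)] Ck_on_frechet(1)[OF Suc.prems(1)], of x]
    by (subst (asm) F') simp
  moreover have "Ck_on k UNIV (\<lambda>x. frechet_derivative f (at x) v * ?F' (f x))" for v
    by (rule Ck_on_mult[OF Ck_on_frechet(2)[OF Suc.prems(2)]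
      Suc.IH[OF Ck_on_frechet(2)[OF Suc.prems(1)] Ck_on_SucD[OF Suc.prems(2)]]])
  ultimately show ?case by (rule Ck_on_SucI)
qed

text \<open>The derivative is \<open>- 2 * x * g * g\<close> with \<open>g\<close> the function
  itself, so differentiation never leaves the polynomials in \<open>x\<close> and \<open>g\<close>.
  As the derivative of \<open>arctan\<close> it is the source of a smooth truncation.\<close>

lemma Ck_on_inverse_1_plus_square: "Ck_on k UNIV (\<lambda>x::real. inverse (1 + x\<^sup>2))"
proof (induction k)
  case 0
  have "1 + x\<^sup>2 \<noteq> 0" for x :: real
    by (smt (verit) zero_le_power2)
  then show ?case by (auto intro!: continuous_intros)
next
  case (Suc k)
  have nz: "1 + x\<^sup>2 \<noteq> 0" for x :: real
    by (smt (verit) zero_le_power2)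
  show ?case
  proof (rule Ck_on_real_SucI)
    show "((\<lambda>x. inverse (1 + x\<^sup>2)) has_real_derivative
       (- 2) * (x * (inverse (1 + x\<^sup>2) * inverse (1 + x\<^sup>2)))) (at x)" for x :: real
      by (rule derivative_eq_intros refl nz | simp add: nz)+
    show "Ck_on k UNIV (\<lambda>x::real. (- 2) * (x * (inverse (1 + x\<^sup>2) * inverse (1 + x\<^sup>2))))"
      by (intro Ck_on_mult Ck_on_const Suc Ck_on_linear bounded_linear_ident)
  qed
qed

lemma Ck_on_arctan: "Ck_on k UNIV arctan"
  by (rule Ck_on_SucD, rule Ck_on_real_SucI[OF DERIV_arctan Ck_on_inverse_1_plus_square])

section \<open>A smooth function that is flat at the origin\<close>

definition flat_exp :: "nat \<Rightarrow> real \<Rightarrow> real" where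
  "flat_exp m x = (if 0 < x then exp (- inverse x) * inverse x ^ m else 0)"

text \<open>A single term of the exponential series at \<open>inverse x\<close> beats the power
  \<open>inverse x ^ m\<close> with two orders to spare. The square left over makes the difference
  quotient at 0 tend to 0.\<close>

lemma flat_exp_bound: "0 < x \<Longrightarrow> \<bar>flat_exp m x\<bar> \<le> fact (m + 2) * x\<^sup>2"
proof -
  assume x: "0 < x"
  define y where "y = inverse x"
  have y: "0 < y" using x by (simp add: y_def)
  have "y ^ (m + 2) / fact (m + 2) \<le> exp y"
  proof -
    have "(\<Sum>n\<in>{m+2}. y ^ n /\<^sub>R fact n) \<le> (\<Sum>n. y ^ n /\<^sub>R fact n)"
      using y by (intro sum_le_suminf summable_exp_generic) auto
    then show ?thesis by (simp add: exp_def field_simps)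
  qed
  then have "y ^ m * y\<^sup>2 \<le> fact (m + 2) * exp y"
    by (simp add: field_simps power_add power2_eq_square del: fact_Suc)
  then have "exp (- y) * y ^ m \<le> fact (m + 2) * inverse (y\<^sup>2)"
    using y by (simp add: field_simps exp_minus del: fact_Suc)
  then show ?thesis using x by (simp add: flat_exp_def y_def power_inverse abs_mult del: fact_Suc)
qed

text \<open>The powers of \<open>inverse x\<close> are built into the family so that it spans a
  space closed under differentiation; smoothness then follows by induction on the order for all
  \<open>m\<close> at once.\<close>

lemma DERIV_flat_exp:
  "(flat_exp m has_real_derivative flat_exp (m + 2) x - real m * flat_exp (m + 1) x) (at x)"
proof -
  consider "x > 0" | "x < 0" | "x = 0" by linarith
  then show ?thesis
  proof cases
    case 1
    define y where "y = inverse x"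
    have "((\<lambda>x. exp (- inverse x) * inverse x ^ m) has_real_derivative
        exp (- y) * (y * y) * y ^ m + exp (- y) * (real m * y ^ (m - 1) * (- (y * y)))) (at x)"
      unfolding y_def using 1 by (auto intro!: derivative_eq_intros)
    also have "exp (- y) * (y * y) * y ^ m + exp (- y) * (real m * y ^ (m - 1) * (- (y * y)))
        = flat_exp (m + 2) x - real m * flat_exp (m + 1) x"
      using 1 by (cases m) (simp_all add: flat_exp_def y_def[symmetric] algebra_simps)
    finally have d: "((\<lambda>x. exp (- inverse x) * inverse x ^ m) has_real_derivative
        flat_exp (m + 2) x - real m * flat_exp (m + 1) x) (at x)" .
    have ev: "eventually (\<lambda>y. exp (- inverse y) * inverse y ^ m = flat_exp m y) (nhds x)"
      using 1 by (intro eventually_mono[OF eventually_nhds_in_open[of "{0<..}" x]]) (auto simp: flat_exp_def)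
    show ?thesis by (rule DERIV_cong_ev[OF refl ev refl, THEN iffD1, OF d])
  next
    case 2
    have ev: "eventually (\<lambda>y. 0 = flat_exp m y) (nhds x)"
      using 2 by (intro eventually_mono[OF eventually_nhds_in_open[of "{..<0}" x]]) (auto simp: flat_exp_def)
    have d: "((\<lambda>y. 0) has_real_derivative flat_exp (m + 2) x - real m * flat_exp (m + 1) x) (at x)"
      using 2 by (simp add: flat_exp_def)
    show ?thesis by (rule DERIV_cong_ev[OF refl ev refl, THEN iffD1, OF d])
  next
    case 3
    have "((\<lambda>h. (flat_exp m (0 + h) - flat_exp m 0) / h) \<longlongrightarrow> 0) (at 0)"
    proof (rule Lim_null_comparison)
      have "norm ((flat_exp m (0 + h) - flat_exp m 0) / h) \<le> fact (m + 2) * \<bar>h\<bar>" if "h \<noteq> 0" for h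
      proof (cases "h > 0")
        case True
        then have "\<bar>flat_exp m h\<bar> \<le> (fact (m + 2) * h) * h"
          using flat_exp_bound[of h m] by (simp add: power2_eq_square mult.assoc)
        with True show ?thesis
          by (simp add: flat_exp_def[of m 0] pos_divide_le_eq del: fact_Suc)
      qed (simp add: flat_exp_def mult_nonneg_nonpos not_less del: fact_Suc)
      then show "\<forall>\<^sub>F h in at 0. norm ((flat_exp m (0 + h) - flat_exp m 0) / h) \<le> fact (m + 2) * \<bar>h\<bar>"
        unfolding eventually_at_filter by (intro always_eventually) blast
      show "((\<lambda>h. fact (m + 2) * \<bar>h\<bar>) \<longlongrightarrow> (0::real)) (at 0)"
        by (intro tendsto_mult_right_zero tendsto_rabs_zero tendsto_ident_at)
    qed
    moreover have "flat_exp (m + 2) 0 - real m * flat_exp (m + 1) 0 = 0"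
      by (simp add: flat_exp_def)
    ultimately show ?thesis unfolding 3 DERIV_def by simp
  qed
qed

lemma Ck_on_flat_exp: "Ck_on k UNIV (flat_exp m)"
proof (induction k arbitrary: m)
  case 0
  show ?case by (simp add: DERIV_continuous_on[OF DERIV_flat_exp])
next
  case (Suc k)
  have "Ck_on k UNIV (\<lambda>x. flat_exp (m + 2) x - real m * flat_exp (m + 1) x)"
    using Ck_on_add[OF Suc Ck_on_mult[OF Ck_on_const[of k "- real m"] Suc], of "m + 2" "m + 1"] by simp
  then show ?case by (rule Ck_on_real_SucI[OF DERIV_flat_exp])
qed

subsection \<open>Integral inequalities\<close>

text \<open>Young's inequality for \<open>x\<close> and \<open>y powr (p - 1)\<close> with conjugate
  exponents. Rearranged, it says that the power lies above its tangent at \<open>y\<close>, in a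
  form that also covers \<open>y = 0\<close>.\<close>

lemma powr_tangent:
  fixes p x y :: real
  assumes p: "1 < p" and "0 \<le> x" "0 \<le> y"
  shows "p * (x * y powr (p - 1)) \<le> x powr p + (p - 1) * y powr p"
proof -
  define q where "q = p / (p - 1)"
  have "x * y powr (p - 1) \<le> x powr p / p + (y powr (p - 1)) powr q / q"
    using assms by (intro Youngs_inequality) (auto simp: q_def field_simps)
  also have "(y powr (p - 1)) powr q = y powr p"
    using p by (simp add: powr_powr q_def)
  finally show ?thesis using p by (simp add: q_def field_simps)
qed

text \<open>First-order convexity of the \<open>p\<close>-th power of the norm:
  \<open>norm a powr (p - 2) *\<^sub>R a\<close> is its gradient at \<open>a\<close> up to the
  factor \<open>p\<close>. Cauchy-Schwarz reduces the claim to the scalar inequality. For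
  \<open>p < 2\<close> the scalar factor is singular at the origin, where
  \<open>0 powr (p - 2) = 0\<close> gives the correct zero gradient.\<close>

lemma norm_powr_tangent:
  fixes a b :: "'a::real_inner"
  assumes p: "1 < p"
  shows "norm a powr p + p * ((norm a powr (p - 2) *\<^sub>R a) \<bullet> (b - a)) \<le> norm b powr p"
proof (cases "a = 0")
  case False
  then have a: "norm a > 0" by simp
  have 1: "norm a powr (p - 2) * (a \<bullet> a) = norm a powr p"
    using a by (simp add: powr_diff power2_norm_eq_inner[symmetric])
  have 2: "norm a powr (p - 2) * norm a = norm a powr (p - 1)"
    using a by (simp add: powr_diff power2_eq_square)
  have "(norm a powr (p - 2) *\<^sub>R a) \<bullet> b \<le> norm a powr (p - 2) * (norm a * norm b)"
    by (simp add: mult_left_mono norm_cauchy_schwarz)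
  also have "\<dots> = norm b * norm a powr (p - 1)" by (simp add: 2[symmetric])
  finally have "p * ((norm a powr (p - 2) *\<^sub>R a) \<bullet> b) \<le> p * (norm b * norm a powr (p - 1))"
    using p by simp
  also have "\<dots> \<le> norm b powr p + (p - 1) * norm a powr p"
    using p by (intro powr_tangent) auto
  finally show ?thesis
    by (simp add: inner_diff_right right_diff_distrib left_diff_distrib 1)
qed (use p in simp)

lemma norm_add_powr_le:
  fixes a b :: "'a::real_normed_vector"
  assumes "0 < r"
  shows "norm (a + b) powr r \<le> 2 powr r * (norm a powr r + norm b powr r)"
proof -
  have "norm (a + b) powr r \<le> (2 * max (norm a) (norm b)) powr r"
    using assms norm_triangle_ineq[of a b] by (intro powr_mono2) auto
  also have "\<dots> = 2 powr r * max (norm a) (norm b) powr r" by (simp add: powr_mult)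
  also have "\<dots> \<le> 2 powr r * (norm a powr r + norm b powr r)"
    by (intro mult_left_mono) (auto simp: max_def)
  finally show ?thesis .
qed

lemma integrable_powr_add:
  fixes f g :: "'a \<Rightarrow> 'b::euclidean_space"
  assumes "0 < r" and [measurable]: "f \<in> borel_measurable M" "g \<in> borel_measurable M"
    and "integrable M (\<lambda>x. norm (f x) powr r)" "integrable M (\<lambda>x. norm (g x) powr r)"
  shows "integrable M (\<lambda>x. norm (f x + g x) powr r)"
  by (rule Bochner_Integration.integrable_bound[where f = "\<lambda>x. 2 powr r * (norm (f x) powr r + norm (g x) powr r)"])
    (use assms norm_add_powr_le[OF assms(1)] in auto)

lemma Holder_inequality:
  fixes f g :: "'a \<Rightarrow> real"
  assumes pq: "1 < p" "1 < q" "1 / p + 1 / q = 1"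
    and [measurable]: "f \<in> borel_measurable M" "g \<in> borel_measurable M"
    and f: "integrable M (\<lambda>x. \<bar>f x\<bar> powr p)" and g: "integrable M (\<lambda>x. \<bar>g x\<bar> powr q)"
  shows "integrable M (\<lambda>x. f x * g x)"
    and "(LINT x|M. \<bar>f x * g x\<bar>) \<le> (LINT x|M. \<bar>f x\<bar> powr p) powr (1 / p) * (LINT x|M. \<bar>g x\<bar> powr q) powr (1 / q)"
proof -
  have young: "\<bar>a * b\<bar> \<le> \<bar>a\<bar> powr p / p + \<bar>b\<bar> powr q / q" for a b
    using Youngs_inequality[of p q "\<bar>a\<bar>" "\<bar>b\<bar>"] pq by (simp add: abs_mult)
  show int: "integrable M (\<lambda>x. f x * g x)"
    by (rule Bochner_Integration.integrable_bound[where f = "\<lambda>x. \<bar>f x\<bar> powr p / p + \<bar>g x\<bar> powr q / q"])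
      (use f g young pq in \<open>auto simp: abs_of_nonneg\<close>)
  define A where "A = (LINT x|M. \<bar>f x\<bar> powr p)"
  define B where "B = (LINT x|M. \<bar>g x\<bar> powr q)"
  have AB: "0 \<le> A" "0 \<le> B" by (simp_all add: A_def B_def)
  show "(LINT x|M. \<bar>f x * g x\<bar>) \<le> A powr (1 / p) * B powr (1 / q)"
  proof (cases "A = 0 \<or> B = 0")
    case True
    have "AE x in M. f x * g x = 0"
      using True
    proof
      assume "A = 0"
      then have "AE x in M. \<bar>f x\<bar> powr p = 0"
        using integral_nonneg_eq_0_iff_AE[OF f] by (simp add: A_def)
      then show ?thesis by eventually_elim simp
    next
      assume "B = 0"
      then have "AE x in M. \<bar>g x\<bar> powr q = 0"
        using integral_nonneg_eq_0_iff_AE[OF g] by (simp add: B_def)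
      then show ?thesis by eventually_elim simp
    qed
    then have "(LINT x|M. \<bar>f x * g x\<bar>) = (LINT x|M. 0)"
      by (intro integral_cong_AE) auto
    then show ?thesis by simp
  next
    case False
    with AB have AB: "0 < A" "0 < B" by auto
    \<comment> \<open>\<open>a\<close> and \<open>b\<close> are the two norms. After normalisation
      by them Young's inequality integrates to \<open>1 / p + 1 / q = 1\<close>.\<close>
    define a where "a = A powr (1 / p)"
    define b where "b = B powr (1 / q)"
    have ab: "0 < a" "0 < b" "a powr p = A" "b powr q = B"
      using AB pq by (auto simp: a_def b_def powr_powr)
    have "(LINT x|M. \<bar>f x * g x\<bar> / (a * b)) \<le> (LINT x|M. \<bar>f x\<bar> powr p / (p * A) + \<bar>g x\<bar> powr q / (q * B))"
    proof (rule integral_mono)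
      show "\<bar>f x * g x\<bar> / (a * b) \<le> \<bar>f x\<bar> powr p / (p * A) + \<bar>g x\<bar> powr q / (q * B)" for x
        using young[of "f x / a" "g x / b"] ab
        by (simp add: powr_divide abs_mult mult.commute)
    qed (use int f g in auto)
    also have "\<dots> = 1 / p + 1 / q"
      using f g AB by (simp add: A_def[symmetric] B_def[symmetric])
    finally show ?thesis
      using ab pq by (simp add: a_def[symmetric] b_def[symmetric] field_simps)
  qed
qed

lemma Minkowski_inequality:
  fixes f g :: "'a \<Rightarrow> 'b::euclidean_space"
  assumes p: "1 < p" and [measurable]: "f \<in> borel_measurable M" "g \<in> borel_measurable M"
    and f: "integrable M (\<lambda>x. norm (f x) powr p)" and g: "integrable M (\<lambda>x. norm (g x) powr p)"
  shows "(LINT x|M. norm (f x + g x) powr p) powr (1 / p)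
    \<le> (LINT x|M. norm (f x) powr p) powr (1 / p) + (LINT x|M. norm (g x) powr p) powr (1 / p)"
proof -
  define I where "I = (LINT x|M. norm (f x + g x) powr p)"
  define q where "q = p / (p - 1)"
  have q: "1 < q" "1 / p + 1 / q = 1" "(p - 1) * q = p" using p by (auto simp: q_def field_simps)
  define h where "h x = norm (f x + g x) powr (p - 1)" for x
  have [measurable]: "h \<in> borel_measurable M" unfolding h_def by measurable
  have I: "integrable M (\<lambda>x. norm (f x + g x) powr p)"
    using p f g by (intro integrable_powr_add) auto
  have hq: "\<bar>h x\<bar> powr q = norm (f x + g x) powr p" for x
    using q by (simp add: h_def powr_powr)
  have H1: "integrable M (\<lambda>x. norm (f x) * h x)"
    and H2: "(LINT x|M. \<bar>norm (f x) * h x\<bar>) \<le> (LINT x|M. norm (f x) powr p) powr (1 / p) * I powr (1 / q)"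
    using Holder_inequality[of p q "\<lambda>x. norm (f x)" M h] p q f I by (auto simp: hq I_def)
  have H3: "integrable M (\<lambda>x. norm (g x) * h x)"
    and H4: "(LINT x|M. \<bar>norm (g x) * h x\<bar>) \<le> (LINT x|M. norm (g x) powr p) powr (1 / p) * I powr (1 / q)"
    using Holder_inequality[of p q "\<lambda>x. norm (g x)" M h] p q g I by (auto simp: hq I_def)
  have "I \<le> (LINT x|M. \<bar>norm (f x) * h x\<bar> + \<bar>norm (g x) * h x\<bar>)"
    unfolding I_def
  proof (rule integral_mono)
    show "norm (f x + g x) powr p \<le> \<bar>norm (f x) * h x\<bar> + \<bar>norm (g x) * h x\<bar>" for x
    proof -
      have "norm (f x + g x) powr p = norm (f x + g x) * h x"
        using p by (cases "f x + g x = 0") (auto simp: h_def powr_diff)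
      also have "\<dots> \<le> (norm (f x) + norm (g x)) * h x"
        by (intro mult_right_mono norm_triangle_ineq) (simp add: h_def)
      finally show ?thesis by (simp add: algebra_simps h_def)
    qed
  qed (use I H1 H3 in auto)
  also have "\<dots> \<le> ((LINT x|M. norm (f x) powr p) powr (1 / p) + (LINT x|M. norm (g x) powr p) powr (1 / p)) * I powr (1 / q)"
    using H1 H2 H3 H4 by (simp add: ring_distribs)
  finally have *: "I \<le> \<dots>" .
  show ?thesis
  proof (cases "I = 0")
    case False
    then have "I > 0" by (simp add: I_def order_less_le)
    \<comment> \<open>One factor \<open>I powr (1 / q)\<close> cancels against the Hoelder bound;
      this is why \<open>I = 0\<close> is set apart.\<close>
    moreover have "I = I powr (1 / p) * I powr (1 / q)"
      using \<open>I > 0\<close> q by (simp add: powr_add[symmetric])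
    ultimately show ?thesis using * unfolding I_def[symmetric]
      by (metis mult_le_cancel_right_pos powr_gt_zero less_irrefl)
  qed (simp add: I_def[symmetric])
qed

subsection \<open>The Sobolev inequality\<close>

lemma nn_integral_lborel_translate:
  fixes g :: "'a::euclidean_space \<Rightarrow> ennreal"
  assumes [measurable]: "g \<in> borel_measurable borel"
  shows "(\<integral>\<^sup>+x. g (x + c) \<partial>lborel) = (\<integral>\<^sup>+x. g x \<partial>lborel)"
proof -
  have "(\<integral>\<^sup>+x. g x \<partial>lborel) = (\<integral>\<^sup>+x. g x \<partial>distr lborel borel ((+) c))"
    by (simp add: lborel_distr_plus)
  also have "\<dots> = (\<integral>\<^sup>+x. g (c + x) \<partial>lborel)"
    by (subst nn_integral_distr) auto
  finally show ?thesis by (simp add: add.commute)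
qed

lemma integrable_continuous_compact_support:
  fixes f :: "'a::euclidean_space \<Rightarrow> 'b::{banach, second_countable_topology}"
  assumes "continuous_on UNIV f" "compact K" "\<And>x. x \<notin> K \<Longrightarrow> f x = 0"
  shows "integrable lborel f"
proof -
  have "integrable lborel (\<lambda>x. indicator K x *\<^sub>R f x)"
    using assms continuous_on_subset by (intro borel_integrable_compact) blast+
  moreover have "(\<lambda>x. indicator K x *\<^sub>R f x) = f"
    using assms(3) by (auto simp: fun_eq_iff indicator_def)
  ultimately show ?thesis by simp
qed

text \<open>Replaces Jensen's inequality below: taking \<open>e\<close> proportional to the left-hand side and absorbing it
  only costs a constant factor.\<close>

lemma le_add_powr:
  fixes a e r :: real
  assumes "0 < e" "0 \<le> a" "1 \<le> r"
  shows "a \<le> e + e powr (1 - r) * a powr r"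
proof (cases "a \<le> e")
  case True
  then show ?thesis by (smt (verit) mult_nonneg_nonneg powr_ge_zero)
next
  case False
  have "a = a powr (1 - r) * a powr r" using False assms by (simp add: powr_add[symmetric])
  also have "\<dots> \<le> e powr (1 - r) * a powr r"
    using False assms by (intro mult_right_mono powr_mono2') auto
  finally show ?thesis using assms by simp
qed

text \<open>The fundamental theorem of calculus on the segment from \<open>x\<close> to
  \<open>x + h\<close>. The power is brought inside the integral with \<open>le_add_powr\<close>,
  and the factor \<open>2 powr p\<close> is its price.\<close>

lemma norm_diff_powr_le_line_integral:
  fixes f :: "'a::euclidean_space \<Rightarrow> real" and G :: "'a \<Rightarrow> 'a"
  assumes d: "\<And>x. (f has_derivative (\<lambda>h. G x \<bullet> h)) (at x)" and G: "continuous_on UNIV G"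
    and p: "1 \<le> p"
  shows "ennreal (\<bar>f (x + h) - f x\<bar> powr p)
    \<le> ennreal (2 powr p * norm h powr p) * (\<integral>\<^sup>+s. indicator {0..1} s * ennreal (norm (G (x + s *\<^sub>R h)) powr p) \<partial>lborel)"
proof -
  define D where "D = \<bar>f (x + h) - f x\<bar>"
  define J where "J = integral {0..1} (\<lambda>s. norm (G (x + s *\<^sub>R h)) powr p)"
  have cG: "continuous_on {0..1} (\<lambda>s. G (x + s *\<^sub>R h))"
    by (intro continuous_on_compose2[OF G] continuous_intros) auto
  have c1: "continuous_on {0..1} (\<lambda>s. norm (G (x + s *\<^sub>R h)))"
    by (intro continuous_intros cG)
  have c2: "continuous_on {0..1} (\<lambda>s. norm (G (x + s *\<^sub>R h)) powr p)"
    using p by (intro continuous_on_powr' continuous_on_const c1) auto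
  have J: "((\<lambda>s. norm (G (x + s *\<^sub>R h)) powr p) has_integral J) {0..1}"
    unfolding J_def using c2 by (intro integrable_integral integrable_continuous_real)
  have J0: "0 \<le> J" using has_integral_nonneg[OF J] by simp
  have nnJ: "(\<integral>\<^sup>+s. indicator {0..1} s * ennreal (norm (G (x + s *\<^sub>R h)) powr p) \<partial>lborel) = ennreal J"
    using nn_integral_has_integral_lebesgue'[OF _ J] by (simp add: mult.commute)
  have "((\<lambda>s. G (x + s *\<^sub>R h) \<bullet> h) has_integral (f (x + 1 *\<^sub>R h) - f (x + 0 *\<^sub>R h))) {0..1}"
  proof (rule fundamental_theorem_of_calculus)
    show "((\<lambda>s. f (x + s *\<^sub>R h)) has_vector_derivative G (x + s *\<^sub>R h) \<bullet> h) (at s within {0..1})" for s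
    proof -
      have "((\<lambda>s. f (x + s *\<^sub>R h)) has_derivative (\<lambda>v. G (x + s *\<^sub>R h) \<bullet> (v *\<^sub>R h))) (at s within {0..1})"
        by (rule has_derivative_compose[OF _ d]) (auto intro!: derivative_eq_intros)
      then show ?thesis by (simp add: has_vector_derivative_def)
    qed
  qed simp
  then have F: "((\<lambda>s. G (x + s *\<^sub>R h) \<bullet> h) has_integral (f (x + h) - f x)) {0..1}" by simp
  have "D powr p \<le> 2 powr p * norm h powr p * J"
  proof (cases "D = 0")
    case False
    then have D: "D > 0" by (simp add: D_def)
    \<comment> \<open>Half of \<open>D\<close> absorbs the additive term \<open>e\<close>; the other
      half is bounded by the integral.\<close>
    define e where "e = D / 2"
    have e: "e > 0" using D by (simp add: e_def)
    have R: "((\<lambda>s. e + e powr (1 - p) * norm h powr p * norm (G (x + s *\<^sub>R h)) powr p) has_integral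
        (e * 1 + e powr (1 - p) * norm h powr p * J)) {0..1}"
      using has_integral_add[OF has_integral_const_real[of e 0 1] has_integral_mult_right[OF J]] by simp
    have "norm (f (x + h) - f x) \<le> integral {0..1} (\<lambda>s. e + e powr (1 - p) * norm h powr p * norm (G (x + s *\<^sub>R h)) powr p)"
      unfolding integral_unique[OF F, symmetric]
    proof (rule integral_norm_bound_integral)
      fix s :: real
      have "norm (G (x + s *\<^sub>R h) \<bullet> h) \<le> norm h * norm (G (x + s *\<^sub>R h))"
        by (metis Cauchy_Schwarz_ineq2 mult.commute real_norm_def)
      also have "\<dots> \<le> e + e powr (1 - p) * (norm h * norm (G (x + s *\<^sub>R h))) powr p"
        using e p by (intro le_add_powr) auto
      finally show "norm (G (x + s *\<^sub>R h) \<bullet> h) \<le> e + e powr (1 - p) * norm h powr p * norm (G (x + s *\<^sub>R h)) powr p"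
        by (simp add: powr_mult mult.assoc)
    qed (use F R in \<open>auto simp: has_integral_integrable\<close>)
    then have "D \<le> e + e powr (1 - p) * norm h powr p * J"
      by (simp add: integral_unique[OF R] D_def)
    then have "e \<le> e powr (1 - p) * (norm h powr p * J)" by (simp add: e_def mult.assoc)
    then have "e powr (p - 1) * e \<le> e powr (p - 1) * (e powr (1 - p) * (norm h powr p * J))"
      by (intro mult_left_mono) auto
    moreover have "e powr (p - 1) * e = e powr p" using e by (simp add: powr_diff)
    moreover have "e powr (p - 1) * e powr (1 - p) = 1" using e by (simp add: powr_add[symmetric])
    ultimately have "e powr p \<le> norm h powr p * J" by (simp add: mult.assoc[symmetric])
    moreover have "D powr p = 2 powr p * e powr p" using e by (simp add: e_def powr_mult[symmetric])
    ultimately show ?thesis by (simp add: mult.assoc)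
  qed (use p J0 in simp)
  then show ?thesis unfolding nnJ D_def[symmetric] using J0 by (simp add: ennreal_mult[symmetric])
qed

text \<open>Tonelli in \<open>x\<close> and \<open>s\<close>: by translation invariance each point
  \<open>s\<close> of the segment contributes the same integral, so the step enters only through
  \<open>norm h\<close>.\<close>

lemma nn_integral_diff_powr_le:
  fixes f :: "'a::euclidean_space \<Rightarrow> real" and G :: "'a \<Rightarrow> 'a"
  assumes d: "\<And>x. (f has_derivative (\<lambda>h. G x \<bullet> h)) (at x)" and G: "continuous_on UNIV G"
    and p: "1 \<le> p"
  shows "(\<integral>\<^sup>+x. ennreal (\<bar>f (x + h) - f x\<bar> powr p) \<partial>lborel)
    \<le> ennreal (2 powr p * norm h powr p) * (\<integral>\<^sup>+x. ennreal (norm (G x) powr p) \<partial>lborel)"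
proof -
  let ?N = "(\<integral>\<^sup>+x. ennreal (norm (G x) powr p) \<partial>lborel)"
  have [measurable]: "G \<in> borel_measurable borel"
    using G by (rule borel_measurable_continuous_onI)
  let ?g = "\<lambda>x s. indicator {0..1::real} s * ennreal (norm (G (x + s *\<^sub>R h)) powr p)"
  have "(\<integral>\<^sup>+x. ennreal (\<bar>f (x + h) - f x\<bar> powr p) \<partial>lborel)
      \<le> (\<integral>\<^sup>+x. ennreal (2 powr p * norm h powr p) * (\<integral>\<^sup>+s. ?g x s \<partial>lborel) \<partial>lborel)"
    by (intro nn_integral_mono norm_diff_powr_le_line_integral assms)
  also have "\<dots> = ennreal (2 powr p * norm h powr p) * (\<integral>\<^sup>+x. (\<integral>\<^sup>+s. ?g x s \<partial>lborel) \<partial>lborel)"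
    by (intro nn_integral_cmult) measurable
  also have "(\<integral>\<^sup>+x. (\<integral>\<^sup>+s. ?g x s \<partial>lborel) \<partial>lborel) = (\<integral>\<^sup>+s. (\<integral>\<^sup>+x. ?g x s \<partial>lborel) \<partial>lborel)"
    by (rule lborel_pair.Fubini'[symmetric]) measurable
  also have "\<dots> = (\<integral>\<^sup>+s. indicator {0..1::real} s * ?N \<partial>lborel)"
    by (intro nn_integral_cong)
      (simp add: nn_integral_cmult nn_integral_lborel_translate[where g = "\<lambda>x. ennreal (norm (G x) powr p)"])
  also have "\<dots> = ?N"
    by (simp add: nn_integral_multc)
  finally show ?thesis .
qed

text \<open>Compare \<open>w x\<close> with its mean over the ball of radius \<open>r\<close> about \<open>x\<close>, where \<open>r\<close> is so large that the
  bound on the \<open>L\<^sup>q\<close> norm makes the mean small against \<open>\<alpha>\<close>.\<close>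

lemma weak_type_estimate:
  fixes w :: "'a::euclidean_space \<Rightarrow> real" and G :: "'a \<Rightarrow> 'a"
  assumes d: "\<And>x. (w has_derivative (\<lambda>h. G x \<bullet> h)) (at x)" and G: "continuous_on UNIV G"
    and p: "1 \<le> p" and q: "1 \<le> q" and \<alpha>: "0 < \<alpha>" and r: "0 < r"
    and J: "(\<integral>\<^sup>+x. ennreal (\<bar>w x\<bar> powr q) \<partial>lborel) \<le> ennreal J"
    and Jr: "J * (\<alpha> / 4) powr (- q) \<le> measure lborel (ball (0::'a) r)"
  shows "emeasure lborel {x. \<alpha> \<le> \<bar>w x\<bar>}
    \<le> ennreal ((8 * r / \<alpha>) powr p) * (\<integral>\<^sup>+x. ennreal (norm (G x) powr p) \<partial>lborel)"
proof -
  let ?N = "(\<integral>\<^sup>+x. ennreal (norm (G x) powr p) \<partial>lborel)"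
  have [measurable]: "G \<in> borel_measurable borel"
    using G by (rule borel_measurable_continuous_onI)
  have "continuous_on UNIV w"
    using d by (metis continuous_at_imp_continuous_on has_derivative_continuous)
  then have [measurable]: "w \<in> borel_measurable borel"
    by (rule borel_measurable_continuous_onI)
  define B where "B = ball (0::'a) r"
  have [measurable]: "B \<in> sets borel" by (simp add: B_def)
  define V where "V = measure lborel B"
  have V: "V > 0" using r by (simp add: V_def B_def content_ball_pos)
  have eV: "emeasure lborel B = ennreal V"
    using emeasure_lborel_ball_finite[of "0::'a" r] by (simp add: B_def V_def emeasure_eq_ennreal_measure)
  \<comment> \<open>The level \<open>\<alpha>\<close> is at most the difference plus the value at
    \<open>x + h\<close>, and \<open>le_add_powr\<close> costs \<open>e\<close> for each of the two:
    \<open>2 * e\<close> remains. Over the ball, the \<open>q\<close>-integral uses up one more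
    \<open>e\<close>, and the last \<open>e\<close> is left for the oscillation
    \<open>X\<close>.\<close>
  define e where "e = \<alpha> / 4"
  have e: "e > 0" using \<alpha> by (simp add: e_def)
  define X where "X x = (\<integral>\<^sup>+h. indicator B h * ennreal (\<bar>w (x + h) - w x\<bar> powr p) \<partial>lborel)" for x
  have [measurable]: "X \<in> borel_measurable borel" unfolding X_def by measurable
  have pt: "ennreal (e * V) \<le> ennreal (e powr (1 - p)) * X x" if x: "\<alpha> \<le> \<bar>w x\<bar>" for x
  proof -
    have "ennreal (2 * e * V) = (\<integral>\<^sup>+h. indicator B h * ennreal (2 * e) \<partial>lborel)"
      using e V by (simp add: nn_integral_multc eV ennreal_mult[symmetric] mult_ac)
    also have "\<dots> \<le> (\<integral>\<^sup>+h. ennreal (e powr (1 - p)) * (indicator B h * ennreal (\<bar>w (x + h) - w x\<bar> powr p))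
         + ennreal (e powr (1 - q)) * ennreal (\<bar>w (h + x)\<bar> powr q) \<partial>lborel)"
    proof (intro nn_integral_mono)
      fix h
      have "\<alpha> \<le> \<bar>w (x + h) - w x\<bar> + \<bar>w (h + x)\<bar>" using x by (simp add: add.commute)
      also have "\<dots> \<le> (e + e powr (1 - p) * \<bar>w (x + h) - w x\<bar> powr p) + (e + e powr (1 - q) * \<bar>w (h + x)\<bar> powr q)"
        using e p q by (intro add_mono le_add_powr) auto
      finally have "2 * e \<le> e powr (1 - p) * \<bar>w (x + h) - w x\<bar> powr p + e powr (1 - q) * \<bar>w (h + x)\<bar> powr q"
        by (simp add: e_def)
      then have "ennreal (2 * e) \<le> ennreal (e powr (1 - p)) * ennreal (\<bar>w (x + h) - w x\<bar> powr p)
         + ennreal (e powr (1 - q)) * ennreal (\<bar>w (h + x)\<bar> powr q)"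
        by (simp add: ennreal_mult'[symmetric] ennreal_plus[symmetric] ennreal_leI del: ennreal_plus)
      then show "indicator B h * ennreal (2 * e) \<le> ennreal (e powr (1 - p)) * (indicator B h * ennreal (\<bar>w (x + h) - w x\<bar> powr p))
         + ennreal (e powr (1 - q)) * ennreal (\<bar>w (h + x)\<bar> powr q)"
        by (cases "h \<in> B") auto
    qed
    also have "\<dots> = ennreal (e powr (1 - p)) * X x + ennreal (e powr (1 - q)) * (\<integral>\<^sup>+h. ennreal (\<bar>w (h + x)\<bar> powr q) \<partial>lborel)"
      by (simp add: nn_integral_add nn_integral_cmult X_def)
    also have "(\<integral>\<^sup>+h. ennreal (\<bar>w (h + x)\<bar> powr q) \<partial>lborel) = (\<integral>\<^sup>+h. ennreal (\<bar>w h\<bar> powr q) \<partial>lborel)"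
      by (rule nn_integral_lborel_translate) measurable
    also have "ennreal (e powr (1 - q)) * \<dots> \<le> ennreal (e powr (1 - q)) * ennreal J"
      using J by (rule mult_left_mono) simp
    also have "\<dots> = ennreal (e powr (1 - q) * J)" by (rule ennreal_mult'[symmetric]) simp
    also have "\<dots> \<le> ennreal (e * V)"
    proof (rule ennreal_leI)
      have "e powr (1 - q) * J = e * (J * e powr (- q))"
        using e by (simp add: powr_diff powr_minus field_simps)
      also have "\<dots> \<le> e * V"
        using Jr e by (intro mult_left_mono) (auto simp: V_def B_def e_def)
      finally show "e powr (1 - q) * J \<le> e * V" .
    qed
    finally have "ennreal (e * V) + ennreal (e * V) \<le> ennreal (e * V) + ennreal (e powr (1 - p)) * X x"
      using e V by (simp add: ennreal_plus[symmetric] add_left_mono mult_ac add.commute del: ennreal_plus)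
    then show ?thesis by (simp add: ennreal_add_left_cancel_le)
  qed
  have iX: "(\<integral>\<^sup>+x. X x \<partial>lborel) \<le> ennreal (V * (2 powr p * r powr p)) * ?N"
  proof -
    have "(\<integral>\<^sup>+x. X x \<partial>lborel) = (\<integral>\<^sup>+h. (\<integral>\<^sup>+x. indicator B h * ennreal (\<bar>w (x + h) - w x\<bar> powr p) \<partial>lborel) \<partial>lborel)"
      unfolding X_def by (rule lborel_pair.Fubini'[symmetric]) measurable
    also have "\<dots> \<le> (\<integral>\<^sup>+h. indicator B h * (ennreal (2 powr p * r powr p) * ?N) \<partial>lborel)"
    proof (intro nn_integral_mono)
      fix h :: 'a
      have "(\<integral>\<^sup>+x. ennreal (\<bar>w (x + h) - w x\<bar> powr p) \<partial>lborel) \<le> ennreal (2 powr p * r powr p) * ?N" if "h \<in> B"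
      proof -
        have "2 powr p * norm h powr p \<le> 2 powr p * r powr p"
          using that p by (intro mult_left_mono powr_mono2) (auto simp: B_def)
        then show ?thesis
          by (intro order_trans[OF nn_integral_diff_powr_le[OF d G p]] mult_right_mono ennreal_leI) auto
      qed
      then show "(\<integral>\<^sup>+x. indicator B h * ennreal (\<bar>w (x + h) - w x\<bar> powr p) \<partial>lborel) \<le> indicator B h * (ennreal (2 powr p * r powr p) * ?N)"
        by (cases "h \<in> B") auto
    qed
    also have "\<dots> = ennreal V * (ennreal (2 powr p * r powr p) * ?N)"
      by (simp add: nn_integral_multc eV)
    finally show ?thesis using V by (simp add: ennreal_mult mult.assoc)
  qed
  define E where "E = {x. \<alpha> \<le> \<bar>w x\<bar>}"
  have [measurable]: "E \<in> sets borel" unfolding E_def by measurable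
  have "ennreal (e * V) * emeasure lborel E = (\<integral>\<^sup>+x. ennreal (e * V) * indicator E x \<partial>lborel)"
    by (simp add: nn_integral_cmult)
  also have "\<dots> \<le> (\<integral>\<^sup>+x. ennreal (e powr (1 - p)) * X x \<partial>lborel)"
    using pt by (intro nn_integral_mono) (auto simp: E_def indicator_def)
  also have "\<dots> = ennreal (e powr (1 - p)) * (\<integral>\<^sup>+x. X x \<partial>lborel)"
    by (simp add: nn_integral_cmult)
  also have "\<dots> \<le> ennreal (e powr (1 - p)) * (ennreal (V * (2 powr p * r powr p)) * ?N)"
    by (intro mult_left_mono iX) auto
  also have "\<dots> = ennreal (e * V) * (ennreal ((8 * r / \<alpha>) powr p) * ?N)"
  proof -
    have "(8 * r / \<alpha>) = 2 * r / e" by (simp add: e_def)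
    then have "(8 * r / \<alpha>) powr p = (2 * r / e) powr p" by (simp only:)
    also have "\<dots> = 2 powr p * r powr p * e powr (- p)"
      using r e by (simp add: powr_mult powr_divide powr_minus_divide)
    finally have "(8 * r / \<alpha>) powr p = 2 powr p * r powr p * e powr (- p)" .
    then have *: "e powr (1 - p) * (V * (2 powr p * r powr p)) = (e * V) * (8 * r / \<alpha>) powr p"
      using e by (simp add: powr_diff powr_minus field_simps)
    have assoc: "ennreal a * (ennreal b * N) = ennreal (a * b) * N" if "0 \<le> a" for a b N
      using that by (simp add: ennreal_mult' mult.assoc)
    have "0 \<le> e powr (1 - p)" "0 \<le> e * V" using e V by auto
    then show ?thesis by (simp only: assoc *)
  qed
  finally show ?thesis
    using e V by (subst (asm) ennreal_mult_le_mult_iff) (auto simp: E_def)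
qed

text \<open>The layer-cake representation of a power. The levels are restricted to
  \<open>t > 0\<close> because the estimate of level sets in the Sobolev inequality holds only
  there.\<close>

lemma nn_integral_layer_powr:
  fixes b :: real assumes "0 < q" "0 \<le> b"
  shows "(\<integral>\<^sup>+t. indicator {0<..} t * (ennreal (t powr (q - 1)) * indicator {..b} t) \<partial>lborel) = ennreal (b powr q / q)"
proof -
  have "(\<integral>\<^sup>+t. indicator {0<..} t * (ennreal (t powr (q - 1)) * indicator {..b} t) \<partial>lborel)
    = (\<integral>\<^sup>+t. ennreal (t powr (q - 1)) * indicator {0..b} t \<partial>lborel)"
    by (rule nn_integral_cong) (auto simp: indicator_def)
  also have "\<dots> = ennreal (b powr q / q)"
    using nn_integral_has_integral_lebesgue'[OF _ has_integral_powr_from_0[of "q - 1" b]] assms by simp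
  finally show ?thesis .
qed

text \<open>The integrand is the derivative of \<open>2 * arctan (t / b)\<close>, so the bound is
  independent of \<open>b\<close>. With \<open>b = \<bar>f x\<bar>\<close> it removes the weight
  that remains on the gradient after integration over all levels \<open>t\<close>.\<close>

lemma nn_integral_poisson_kernel:
  fixes b :: real assumes "0 < b"
  shows "(\<integral>\<^sup>+t. indicator {0<..} t * ennreal (2 * b / (t\<^sup>2 + b\<^sup>2)) \<partial>lborel) \<le> ennreal pi"
proof -
  have pos: "t\<^sup>2 + b\<^sup>2 > 0" for t using assms by (simp add: add_nonneg_pos)
  have "(\<integral>\<^sup>+t. indicator {0<..} t * ennreal (2 * b / (t\<^sup>2 + b\<^sup>2)) \<partial>lborel)
    \<le> (\<integral>\<^sup>+t. ennreal (2 * b / (t\<^sup>2 + b\<^sup>2)) * indicator {0..} t \<partial>lborel)"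
    by (rule nn_integral_mono) (auto simp: indicator_def)
  also have "\<dots> = ennreal (2 * (pi / 2) - 2 * arctan (0 / b))"
  proof (rule nn_integral_FTC_atLeast)
    show "((\<lambda>t. 2 * arctan (t / b)) has_real_derivative 2 * b / (t\<^sup>2 + b\<^sup>2)) (at t)" for t
      using assms pos[of t] by (auto intro!: derivative_eq_intros simp: field_simps power2_eq_square)
    have "filterlim (\<lambda>t. t / b) at_top at_top"
      using assms filterlim_tendsto_pos_mult_at_top[OF tendsto_const[of "inverse b"] _ filterlim_ident]
      by (simp add: field_simps)
    then show "((\<lambda>t. 2 * arctan (t / b)) \<longlongrightarrow> 2 * (pi / 2)) at_top"
      by (intro tendsto_mult tendsto_const filterlim_compose[OF tendsto_arctan_at_top])
  qed (use assms pos in \<open>auto simp: less_imp_le\<close>)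
  finally show ?thesis by simp
qed

lemma derivative_zero_outside_support:
  fixes f :: "'a::euclidean_space \<Rightarrow> real" and G :: "'a \<Rightarrow> 'a"
  assumes d: "\<And>x. (f has_derivative (\<lambda>h. G x \<bullet> h)) (at x)"
    and K: "closed K" "\<And>x. x \<notin> K \<Longrightarrow> f x = 0" and x: "x \<notin> K"
  shows "G x = 0"
proof -
  have "(f has_derivative (\<lambda>h. 0)) (at x)"
  proof (rule has_derivative_transform_within_open[where f = "\<lambda>_. 0"])
    show "open (- K)" using K by auto
  qed (use x K in auto)
  from has_derivative_unique[OF this d[of x]] have "G x \<bullet> G x = 0" by metis
  then show ?thesis by simp
qed

text \<open>The weak type estimate is applied to \<open>w = t f\<^sup>2 / (t\<^sup>2 + f\<^sup>2)\<close>, whose gradient lives essentially on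
  \<open>{|f| ~ t}\<close>, with radius \<open>r ~ (I t\<^bsup>-q\<^esup>)\<^bsup>1/n\<^esup>\<close>, \<open>I = \<integral>|f|\<^sup>q\<close>.  Integrating over \<open>t\<close> gives
  \<open>I \<le> C I\<^bsup>p/n\<^esup> \<integral>|G|\<^sup>p\<close>, which is the claim because \<open>1 - p/n = p/q\<close>.\<close>

theorem Sobolev_inequality:
  fixes p q :: real
  assumes p: "1 < p" "p < real DIM('a::euclidean_space)"
    and q: "q = p * real DIM('a) / (real DIM('a) - p)"
  obtains C :: real where "0 \<le> C"
    "\<And>(f :: 'a \<Rightarrow> real) G K. \<lbrakk>\<And>x. (f has_derivative (\<lambda>h. G x \<bullet> h)) (at x); continuous_on UNIV G;
       compact K; \<And>x. x \<notin> K \<Longrightarrow> f x = 0\<rbrakk>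
       \<Longrightarrow> (LINT x|lborel. \<bar>f x\<bar> powr q) \<le> C * (LINT x|lborel. norm (G x) powr p) powr (q / p)"
proof -
  define n where "n = real DIM('a)"
  have n: "p < n" "n > 1" using p by (auto simp: n_def)
  have "n < p * n" using n p by simp
  then have "n - p < p * n" using p by linarith
  then have q1: "q > 1"
    using n unfolding q n_def[symmetric] by (subst less_divide_eq) simp
  have qn: "q * (p / n) + p = q" and pq: "p / q = 1 - p / n"
    using p n unfolding q n_def[symmetric] by (auto simp: field_simps)
  define \<omega> where "\<omega> = measure lborel (ball (0::'a) 1)"
  have \<omega>: "\<omega> > 0" by (simp add: \<omega>_def content_ball_pos)
  \<comment> \<open>What remains of the \<open>p\<close>-th power of \<open>8 * r / \<alpha>\<close>
    for \<open>\<alpha> = t / 2\<close>: \<open>16 powr p\<close> comes from the quotient, the rest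
    from the radius, whose formula contains \<open>8 powr q / \<omega>\<close>.\<close>
  define K0 where "K0 = 16 powr p * (8 powr q / \<omega>) powr (p / n)"
  have K0: "K0 > 0" using \<omega> by (simp add: K0_def)
  show ?thesis
  proof (rule that[of "(q * K0 * pi) powr (q / p)"])
    fix f :: "'a \<Rightarrow> real" and G K
    assume d: "\<And>x. (f has_derivative (\<lambda>h. G x \<bullet> h)) (at x)" and G: "continuous_on UNIV G"
      and K: "compact K" and f0: "\<And>x. x \<notin> K \<Longrightarrow> f x = 0"
    have G0: "G x = 0" if "x \<notin> K" for x
      using derivative_zero_outside_support[OF d compact_imp_closed[OF K] f0 that] .
    have cf: "continuous_on UNIV f"
      using d by (metis continuous_at_imp_continuous_on has_derivative_continuous)
    have [measurable]: "f \<in> borel_measurable borel" "G \<in> borel_measurable borel"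
      using G cf by (auto intro: borel_measurable_continuous_onI)
    define I where "I = (LINT x|lborel. \<bar>f x\<bar> powr q)"
    define A where "A = (LINT x|lborel. norm (G x) powr p)"
    have "integrable lborel (\<lambda>x. \<bar>f x\<bar> powr q)"
      using q1 f0 by (intro integrable_continuous_compact_support[OF _ K] continuous_on_powr' continuous_intros cf) auto
    then have nI: "(\<integral>\<^sup>+x. ennreal (\<bar>f x\<bar> powr q) \<partial>lborel) = ennreal I"
      unfolding I_def by (rule nn_integral_eq_integral) simp
    have "integrable lborel (\<lambda>x. norm (G x) powr p)"
      using p G0 by (intro integrable_continuous_compact_support[OF _ K] continuous_on_powr' continuous_intros G) auto
    then have nA: "(\<integral>\<^sup>+x. ennreal (norm (G x) powr p) \<partial>lborel) = ennreal A"
      unfolding A_def by (rule nn_integral_eq_integral) simp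
    have A0: "0 \<le> A" by (simp add: A_def)
    show "I \<le> (q * K0 * pi) powr (q / p) * A powr (q / p)"
    proof (cases "I = 0")
      case True
      then show ?thesis by simp
    next
      case False
      then have I: "I > 0" by (simp add: I_def order_less_le)
      define c where "c = K0 * I powr (p / n)"
      have c: "c > 0" using K0 I by (simp add: c_def)
      define k where "k t x = 2 * \<bar>f x\<bar> / (t\<^sup>2 + \<bar>f x\<bar>\<^sup>2)" for t x
      have [measurable]: "(\<lambda>(t, x). k t x) \<in> borel_measurable (borel \<Otimes>\<^sub>M borel)"
        unfolding k_def by measurable
      have level: "ennreal (t powr (q - 1)) * emeasure lborel {x. t \<le> \<bar>f x\<bar>}
          \<le> ennreal c * (\<integral>\<^sup>+x. ennreal (k t x) * ennreal (norm (G x) powr p) \<partial>lborel)" if t: "t > 0" for t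
      proof -
        have pos: "t\<^sup>2 + s\<^sup>2 > 0" for s using t by (simp add: add_pos_nonneg)
        define w where "w x = t * (f x)\<^sup>2 / (t\<^sup>2 + (f x)\<^sup>2)" for x
        define g where "g x = 2 * t ^ 3 * f x / (t\<^sup>2 + (f x)\<^sup>2)\<^sup>2" for x
        have dw: "(w has_derivative (\<lambda>h. (g x *\<^sub>R G x) \<bullet> h)) (at x)" for x
        proof -
          have "((\<lambda>s. t * s\<^sup>2 / (t\<^sup>2 + s\<^sup>2)) has_real_derivative 2 * t ^ 3 * s / (t\<^sup>2 + s\<^sup>2)\<^sup>2) (at s)" for s
            using pos[of s] by (auto intro!: derivative_eq_intros simp: field_simps power2_eq_square power3_eq_cube)
          then have "((\<lambda>s. t * s\<^sup>2 / (t\<^sup>2 + s\<^sup>2)) has_derivative (*) (g x)) (at (f x))"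
            by (simp add: has_field_derivative_def g_def)
          from has_derivative_compose[OF d this] show ?thesis by (simp add: w_def[abs_def])
        qed
        have cg: "continuous_on UNIV (\<lambda>x. g x *\<^sub>R G x)"
          unfolding g_def using pos by (intro continuous_intros cf G) (auto simp: less_imp_neq[symmetric])
        have am: "2 * t * \<bar>s\<bar> \<le> t\<^sup>2 + s\<^sup>2" for s
          using sum_squares_bound[of t "\<bar>s\<bar>"] by simp
        have wf: "\<bar>w x\<bar> \<le> \<bar>f x\<bar>" for x
        proof -
          have "t * \<bar>f x\<bar> \<le> t\<^sup>2 + (f x)\<^sup>2"
            using am[of "f x"] mult_nonneg_nonneg[of t "\<bar>f x\<bar>"] t by linarith
          then have "t * (f x)\<^sup>2 \<le> \<bar>f x\<bar> * (t\<^sup>2 + (f x)\<^sup>2)"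
            using mult_left_mono[of "t * \<bar>f x\<bar>" "t\<^sup>2 + (f x)\<^sup>2" "\<bar>f x\<bar>"] by (simp add: power2_eq_square mult.left_commute)
          then show ?thesis using t pos[of "f x"] by (simp add: w_def abs_mult abs_of_pos pos_divide_le_eq)
        qed
        \<comment> \<open>The smallest admissible radius: the ball has volume exactly
          \<open>I * (t / 8) powr (- q)\<close>, where \<open>t / 8\<close> is a quarter of the
          level \<open>t / 2\<close>.\<close>
        define r where "r = (I * (t / 8) powr (- q) / \<omega>) powr (1 / n)"
        have r: "r > 0" using I t \<omega> by (simp add: r_def)
        have "r ^ DIM('a) = r powr n" using r by (simp add: n_def powr_realpow)
        then have rn: "r ^ DIM('a) * \<omega> = I * (t / 8) powr (- q)"
          using I t \<omega> n by (simp add: r_def powr_powr)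
        have "{x. t \<le> \<bar>f x\<bar>} \<subseteq> {x. t / 2 \<le> \<bar>w x\<bar>}"
        proof safe
          fix x assume "t \<le> \<bar>f x\<bar>"
          then have "t\<^sup>2 \<le> (f x)\<^sup>2" using t by (metis abs_le_square_iff abs_of_pos)
          then have "t / 2 \<le> w x" using t pos[of "f x"] by (simp add: w_def field_simps)
          then show "t / 2 \<le> \<bar>w x\<bar>" by simp
        qed
        moreover have "{x. t / 2 \<le> \<bar>w x\<bar>} \<in> sets lborel"
          unfolding w_def by measurable
        ultimately have "emeasure lborel {x. t \<le> \<bar>f x\<bar>} \<le> emeasure lborel {x. t / 2 \<le> \<bar>w x\<bar>}"
          by (rule emeasure_mono)
        also have "\<dots> \<le> ennreal ((8 * r / (t / 2)) powr p) * (\<integral>\<^sup>+x. ennreal (norm (g x *\<^sub>R G x) powr p) \<partial>lborel)"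
        proof (rule weak_type_estimate[OF dw cg, of p q "t / 2" r I])
          have "(\<integral>\<^sup>+x. ennreal (\<bar>w x\<bar> powr q) \<partial>lborel) \<le> (\<integral>\<^sup>+x. ennreal (\<bar>f x\<bar> powr q) \<partial>lborel)"
            using q1 wf by (intro nn_integral_mono ennreal_leI powr_mono2) auto
          then show "(\<integral>\<^sup>+x. ennreal (\<bar>w x\<bar> powr q) \<partial>lborel) \<le> ennreal I" by (simp add: nI)
          show "I * (t / 2 / 4) powr - q \<le> measure lborel (ball (0::'a) r)"
            using rn content_ball_conv_unit_ball[of r "0::'a"] r by (simp add: \<omega>_def)
        qed (use p q1 t r in auto)
        also have "(8 * r / (t / 2)) powr p = c * t powr (- q)"
        proof -
          have "r powr p = (I * (8 powr q / \<omega>) * t powr (- q)) powr (p / n)"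
            using t by (simp add: r_def powr_powr powr_divide powr_minus field_simps)
          also have "\<dots> = I powr (p / n) * (8 powr q / \<omega>) powr (p / n) * t powr (- (q * (p / n)))"
            using I \<omega> t by (simp add: powr_mult powr_divide powr_powr)
          finally have rp: "r powr p = I powr (p / n) * (8 powr q / \<omega>) powr (p / n) * t powr (- (q * (p / n)))" .
          have "(8 * r / (t / 2)) powr p = 16 powr p * r powr p * t powr (- p)"
            using r t by (simp add: powr_mult powr_divide powr_minus_divide)
          also have "\<dots> = c * (t powr (- (q * (p / n))) * t powr (- p))"
            unfolding rp c_def K0_def by (simp add: mult_ac)
          also have "t powr (- (q * (p / n))) * t powr (- p) = t powr (- (q * (p / n) + p))"
            by (simp add: powr_add[symmetric])
          also have "q * (p / n) + p = q" by (rule qn)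
          finally show ?thesis .
        qed
        also have "ennreal (c * t powr - q) * (\<integral>\<^sup>+x. ennreal (norm (g x *\<^sub>R G x) powr p) \<partial>lborel)
            \<le> ennreal (c * t powr - q) * (\<integral>\<^sup>+x. ennreal t * (ennreal (k t x) * ennreal (norm (G x) powr p)) \<partial>lborel)"
        proof (intro mult_left_mono nn_integral_mono)
          fix x
          have gk: "\<bar>g x\<bar> \<le> t * k t x"
          proof -
            have "\<bar>g x\<bar> = t * k t x * (t\<^sup>2 / (t\<^sup>2 + (f x)\<^sup>2))"
              using t pos[of "f x"] by (simp add: g_def k_def abs_mult power2_eq_square power3_eq_cube)
            also have "\<dots> \<le> t * k t x * 1"
              using t pos[of "f x"] by (intro mult_left_mono) (auto simp: k_def)
            finally show ?thesis by simp
          qed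
          moreover have "t * k t x \<le> 1"
            using pos[of "f x"] am[of "f x"] by (simp add: k_def divide_le_eq mult_ac)
          \<comment> \<open>Since the factor \<open>g\<close> is at most 1 in modulus, its power
            \<open>p > 1\<close> may be dropped. Only the first power of the kernel \<open>k\<close>
            is left, whose integral over \<open>t\<close> is bounded by \<open>pi\<close>.\<close>
          ultimately have "\<bar>g x\<bar> \<le> 1" by simp
          then have "\<bar>g x\<bar> powr p \<le> \<bar>g x\<bar>"
            using p by (cases "g x = 0") (auto intro: powr_le_one_le)
          with gk have "\<bar>g x\<bar> powr p \<le> t * k t x" by simp
          then have "norm (g x *\<^sub>R G x) powr p \<le> t * k t x * norm (G x) powr p"
            by (simp add: powr_mult mult_right_mono)
          moreover have "0 \<le> k t x" using pos[of "f x"] by (simp add: k_def)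
          ultimately show "ennreal (norm (g x *\<^sub>R G x) powr p) \<le> ennreal t * (ennreal (k t x) * ennreal (norm (G x) powr p))"
            using t by (simp add: ennreal_mult[symmetric] mult.assoc ennreal_leI)
        qed simp
        also have "(\<integral>\<^sup>+x. ennreal t * (ennreal (k t x) * ennreal (norm (G x) powr p)) \<partial>lborel)
            = ennreal t * (\<integral>\<^sup>+x. ennreal (k t x) * ennreal (norm (G x) powr p) \<partial>lborel)"
          by (rule nn_integral_cmult) measurable
        finally have "emeasure lborel {x. t \<le> \<bar>f x\<bar>} \<le>
            ennreal (c * t powr - q * t) * (\<integral>\<^sup>+x. ennreal (k t x) * ennreal (norm (G x) powr p) \<partial>lborel)"
          using c t by (simp add: ennreal_mult[symmetric] mult.assoc[symmetric])
        then have "ennreal (t powr (q - 1)) * emeasure lborel {x. t \<le> \<bar>f x\<bar>}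
          \<le> ennreal (t powr (q - 1)) * (ennreal (c * t powr - q * t) * (\<integral>\<^sup>+x. ennreal (k t x) * ennreal (norm (G x) powr p) \<partial>lborel))"
          by (rule mult_left_mono) simp
        also have "\<dots> = ennreal (t powr (q - 1) * (c * t powr - q * t)) * (\<integral>\<^sup>+x. ennreal (k t x) * ennreal (norm (G x) powr p) \<partial>lborel)"
          using c t by (simp add: ennreal_mult mult.assoc)
        also have "t powr (q - 1) * (c * t powr - q * t) = c"
          using t by (simp add: powr_diff powr_minus field_simps)
        finally show ?thesis .
      qed
      \<comment> \<open>Layer cake, level estimate and a second exchange of integrals, after which
        the kernel is integrated over \<open>t\<close> at fixed \<open>x\<close>.\<close>
      have "ennreal (I / q) = (\<integral>\<^sup>+x. ennreal (\<bar>f x\<bar> powr q / q) \<partial>lborel)"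
        using q1 nI I by (simp add: divide_ennreal[symmetric] nn_integral_divide)
      also have "\<dots> = (\<integral>\<^sup>+x. (\<integral>\<^sup>+t. indicator {0<..} t * (ennreal (t powr (q - 1)) * indicator {..\<bar>f x\<bar>} t) \<partial>lborel) \<partial>lborel)"
        using q1 by (simp add: nn_integral_layer_powr)
      also have "\<dots> = (\<integral>\<^sup>+t. (\<integral>\<^sup>+x. indicator {0<..} t * (ennreal (t powr (q - 1)) * indicator {..\<bar>f x\<bar>} t) \<partial>lborel) \<partial>lborel)"
      proof (rule lborel_pair.Fubini'[symmetric])
        have "{z \<in> space (borel \<Otimes>\<^sub>M borel). snd z \<le> \<bar>f (fst z)\<bar>} \<in> sets (borel \<Otimes>\<^sub>M borel)"
          by measurable
        then have [measurable]: "{z :: 'a \<times> real. snd z \<le> \<bar>f (fst z)\<bar>} \<in> sets (borel \<Otimes>\<^sub>M borel)"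
          by (simp add: space_pair_measure)
        have "indicator {..\<bar>f x\<bar>} t = (indicator {z. snd z \<le> \<bar>f (fst z)\<bar>} (x, t) :: ennreal)" for t x
          by (simp add: indicator_def)
        then show "(\<lambda>(x, t). indicator {0<..} t * (ennreal (t powr (q - 1)) * indicator {..\<bar>f x\<bar>} t)) \<in> borel_measurable (lborel \<Otimes>\<^sub>M lborel)"
          by simp
      qed
      also have "\<dots> = (\<integral>\<^sup>+t. indicator {0<..} t * (ennreal (t powr (q - 1)) * emeasure lborel {x. t \<le> \<bar>f x\<bar>}) \<partial>lborel)"
      proof (rule nn_integral_cong)
        fix t :: real
        have "indicator {..\<bar>f x\<bar>} t = (indicator {x. t \<le> \<bar>f x\<bar>} x :: ennreal)" for x
          by (simp add: indicator_def)
        moreover have "{x. t \<le> \<bar>f x\<bar>} \<in> sets lborel" by measurable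
        ultimately show "(\<integral>\<^sup>+x. indicator {0<..} t * (ennreal (t powr (q - 1)) * indicator {..\<bar>f x\<bar>} t) \<partial>lborel) = indicator {0<..} t * (ennreal (t powr (q - 1)) * emeasure lborel {x. t \<le> \<bar>f x\<bar>})"
          by (simp add: nn_integral_cmult)
      qed
      also have "\<dots> \<le> (\<integral>\<^sup>+t. indicator {0<..} t * (ennreal c * (\<integral>\<^sup>+x. ennreal (k t x) * ennreal (norm (G x) powr p) \<partial>lborel)) \<partial>lborel)"
        using level by (intro nn_integral_mono) (auto simp: indicator_def)
      also have "\<dots> = ennreal c * (\<integral>\<^sup>+t. (\<integral>\<^sup>+x. indicator {0<..} t * (ennreal (k t x) * ennreal (norm (G x) powr p)) \<partial>lborel) \<partial>lborel)"
      proof -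
        let ?H = "\<lambda>t. \<integral>\<^sup>+x. ennreal (k t x) * ennreal (norm (G x) powr p) \<partial>lborel"
        have "(\<integral>\<^sup>+x. indicator {0<..} t * (ennreal (k t x) * ennreal (norm (G x) powr p)) \<partial>lborel) = indicator {0<..} t * ?H t" for t
          by (rule nn_integral_cmult) (unfold k_def, measurable)
        moreover have "(\<integral>\<^sup>+t. ennreal c * (indicator {0<..} t * ?H t) \<partial>lborel) = ennreal c * (\<integral>\<^sup>+t. indicator {0<..} t * ?H t \<partial>lborel)"
          by (rule nn_integral_cmult) (unfold k_def, measurable)
        ultimately show ?thesis by (simp add: mult.left_commute[of _ "ennreal c"])
      qed
      also have "(\<integral>\<^sup>+t. (\<integral>\<^sup>+x. indicator {0<..} t * (ennreal (k t x) * ennreal (norm (G x) powr p)) \<partial>lborel) \<partial>lborel)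
          = (\<integral>\<^sup>+x. (\<integral>\<^sup>+t. indicator {0<..} t * (ennreal (k t x) * ennreal (norm (G x) powr p)) \<partial>lborel) \<partial>lborel)"
        by (rule lborel_pair.Fubini') measurable
      also have "\<dots> \<le> (\<integral>\<^sup>+x. ennreal pi * ennreal (norm (G x) powr p) \<partial>lborel)"
      proof (rule nn_integral_mono)
        fix x
        have "(\<integral>\<^sup>+t. indicator {0<..} t * ennreal (k t x) \<partial>lborel) \<le> ennreal pi"
          using nn_integral_poisson_kernel[of "\<bar>f x\<bar>"] by (cases "f x = 0") (auto simp: k_def)
        then have "(\<integral>\<^sup>+t. indicator {0<..} t * ennreal (k t x) \<partial>lborel) * ennreal (norm (G x) powr p) \<le> ennreal pi * ennreal (norm (G x) powr p)"
          by (rule mult_right_mono) simp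
        then show "(\<integral>\<^sup>+t. indicator {0<..} t * (ennreal (k t x) * ennreal (norm (G x) powr p)) \<partial>lborel) \<le> ennreal pi * ennreal (norm (G x) powr p)"
          by (simp add: nn_integral_multc mult.assoc[symmetric])
      qed
      also have "\<dots> = ennreal (pi * A)"
        using A0 by (simp add: nn_integral_cmult nA ennreal_mult)
      finally have "ennreal (I / q) \<le> ennreal (c * (pi * A))"
        using c A0 by (simp add: ennreal_mult mult_left_mono)
      then have "I / q \<le> c * (pi * A)" using c A0 by (subst (asm) ennreal_le_iff) auto
      then have "I \<le> q * K0 * pi * A * I powr (p / n)" using q1 by (simp add: c_def field_simps)
      \<comment> \<open>Absorbing the power of \<open>I\<close> on the right is legitimate because
        \<open>I\<close> is finite, by compact support, and positive.\<close>
      then have "I / I powr (p / n) \<le> q * K0 * pi * A" using I by (simp add: divide_le_eq)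
      moreover have "I / I powr (p / n) = I powr (p / q)" using I by (simp add: pq powr_diff)
      ultimately have "(I powr (p / q)) powr (q / p) \<le> (q * K0 * pi * A) powr (q / p)"
        using p q1 by (intro powr_mono2) auto
      then show ?thesis using I p q1 K0 A0 by (simp add: powr_powr powr_mult)
    qed
  qed simp
qed

subsection \<open>Test functions and weak gradients\<close>

definition grad :: "(real^'n \<Rightarrow> real) \<Rightarrow> real^'n \<Rightarrow> real^'n" where
  "grad f x = (\<chi> i. frechet_derivative f (at x) (axis i 1))"

lemma linear_eq_inner_axis:
  fixes L :: "real^'n \<Rightarrow> real"
  assumes "linear L"
  shows "L h = (\<chi> i. L (axis i 1)) \<bullet> h"
proof -
  have "h = (\<Sum>i\<in>UNIV. (h $ i) *\<^sub>R axis i 1)"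
    by (simp add: vec_eq_iff axis_def if_distrib cong: if_cong)
  then have "L h = L (\<Sum>i\<in>UNIV. (h $ i) *\<^sub>R axis i 1)" by (rule arg_cong)
  also have "\<dots> = (\<Sum>i\<in>UNIV. h $ i * L (axis i 1))"
    using assms by (simp add: linear_sum linear_cmul)
  finally show ?thesis by (simp add: inner_vec_def mult.commute)
qed

lemma grad_eqI:
  assumes "(f has_derivative (\<lambda>h. g \<bullet> h)) (at x)"
  shows "grad f x = g"
proof -
  have "frechet_derivative f (at x) = (\<lambda>h. g \<bullet> h)"
    using frechet_derivative_at[OF assms] by simp
  then show ?thesis by (simp add: grad_def vec_eq_iff inner_axis)
qed

lemma smooth_has_gradient:
  assumes "smooth_on UNIV f"
  shows "(f has_derivative (\<lambda>h. grad f x \<bullet> h)) (at x)"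
proof -
  have "Ck_on (Suc 0) UNIV f" using assms by (simp add: smooth_on_def del: Ck_on.simps)
  note d = Ck_on_frechet(1)[OF this]
  have "frechet_derivative f (at x) = (\<lambda>h. grad f x \<bullet> h)"
    unfolding grad_def using linear_eq_inner_axis[OF has_derivative_linear[OF d]] by blast
  with d show ?thesis by metis
qed

lemma smooth_continuous_gradient:
  assumes "smooth_on UNIV f"
  shows "continuous_on UNIV (grad f)"
proof -
  have "Ck_on (Suc 0) UNIV f" using assms by (simp add: smooth_on_def del: Ck_on.simps)
  then show ?thesis unfolding grad_def by (intro continuous_on_vec_lambda) simp
qed

lemma smooth_on_continuous: "smooth_on UNIV f \<Longrightarrow> continuous_on UNIV f"
  unfolding smooth_on_def by (metis Ck_on.simps(1))

lemma test_functionsI: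
  assumes "smooth_on UNIV f" "compact K" "K \<subseteq> \<Omega>" "\<And>x. x \<notin> K \<Longrightarrow> f x = 0"
  shows "f \<in> test_functions \<Omega>"
proof -
  have "closure {x. f x \<noteq> 0} \<subseteq> K"
    using assms by (intro closure_minimal compact_imp_closed) auto
  then show ?thesis using assms
    by (auto simp: test_functions_def intro: compact_closure[THEN iffD2] bounded_subset[OF compact_imp_bounded] order_trans[OF closure_subset])
qed

lemma test_functionsE:
  assumes "f \<in> test_functions \<Omega>"
  obtains K where "smooth_on UNIV f" "compact K" "K \<subseteq> \<Omega>" "\<And>x. x \<notin> K \<Longrightarrow> f x = 0" 
    "\<And>x. x \<notin> K \<Longrightarrow> grad f x = 0"
proof (rule that[of "closure {x. f x \<noteq> 0}"])
  have 0: "x \<notin> closure {x. f x \<noteq> 0} \<Longrightarrow> f x = 0" for x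
    using closure_subset[of "{x. f x \<noteq> 0}"] by auto
  then show "x \<notin> closure {x. f x \<noteq> 0} \<Longrightarrow> f x = 0" for x .
  have "smooth_on UNIV f" using assms by (simp add: test_functions_def)
  from derivative_zero_outside_support[OF smooth_has_gradient[OF this] closed_closure 0]
  show "x \<notin> closure {x. f x \<noteq> 0} \<Longrightarrow> grad f x = 0" for x .
qed (use assms in \<open>auto simp: test_functions_def\<close>)

lemma test_functions_smooth: "f \<in> test_functions \<Omega> \<Longrightarrow> smooth_on UNIV f"
  by (simp add: test_functions_def)

lemma test_functions_has_gradient:
  "f \<in> test_functions \<Omega> \<Longrightarrow> (f has_derivative (\<lambda>h. grad f x \<bullet> h)) (at x)"
  by (intro smooth_has_gradient test_functions_smooth)

lemma test_functions_measurable [measurable_dest]: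
  assumes "f \<in> test_functions \<Omega>"
  shows "f \<in> borel_measurable borel" "grad f \<in> borel_measurable borel"
  using assms smooth_on_continuous smooth_continuous_gradient test_functions_smooth
  by (blast intro: borel_measurable_continuous_onI)+

text \<open>The single combination \<open>f + c * g\<close> covers sums, differences and multiples.
  The same pattern is kept for weak gradients, Lebesgue spaces and Sobolev spaces, and differences
  there carry the explicit factor \<open>-1\<close> so that it applies.\<close>

lemma test_functions_add_cmult:
  assumes f: "f \<in> test_functions \<Omega>" and g: "g \<in> test_functions \<Omega>"
  shows "(\<lambda>x. f x + c * g x) \<in> test_functions \<Omega>"
    and "grad (\<lambda>x. f x + c * g x) x = grad f x + c *\<^sub>R grad g x"
proof -
  obtain K where K: "smooth_on UNIV f" "compact K" "K \<subseteq> \<Omega>" "\<And>x. x \<notin> K \<Longrightarrow> f x = 0"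
    using f by (rule test_functionsE) blast
  obtain L where L: "smooth_on UNIV g" "compact L" "L \<subseteq> \<Omega>" "\<And>x. x \<notin> L \<Longrightarrow> g x = 0"
    using g by (rule test_functionsE) blast
  show "(\<lambda>x. f x + c * g x) \<in> test_functions \<Omega>"
  proof (rule test_functionsI[where K = "K \<union> L"])
    show "smooth_on UNIV (\<lambda>x. f x + c * g x)"
      using K(1) L(1) unfolding smooth_on_def by (intro allI Ck_on_add Ck_on_mult Ck_on_const) auto
  qed (use K L in auto)
  show "grad (\<lambda>x. f x + c * g x) x = grad f x + c *\<^sub>R grad g x"
    using test_functions_has_gradient[OF f, of x] test_functions_has_gradient[OF g, of x]
    by (intro grad_eqI) (auto intro!: derivative_eq_intros simp: inner_add_left)
qed

lemma test_functions_zero: "(\<lambda>x. 0) \<in> test_functions \<Omega>"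
  by (rule test_functionsI[where K = "{}"]) (auto simp: smooth_on_def Ck_on_const)

text \<open>The condition \<open>F 0 = 0\<close> keeps the support compact; the derivative
  \<open>F'\<close> is passed explicitly so that the gradient comes out as a formula.\<close>

lemma test_functions_compose:
  assumes f: "f \<in> test_functions \<Omega>" and F: "smooth_on UNIV F" "F 0 = (0::real)"
    and F': "\<And>s. (F has_real_derivative F' s) (at s)"
  shows "(\<lambda>x. F (f x)) \<in> test_functions \<Omega>"
    and "grad (\<lambda>x. F (f x)) x = F' (f x) *\<^sub>R grad f x"
proof -
  obtain K where K: "smooth_on UNIV f" "compact K" "K \<subseteq> \<Omega>" "\<And>x. x \<notin> K \<Longrightarrow> f x = 0"
    using f by (rule test_functionsE) blast
  show "(\<lambda>x. F (f x)) \<in> test_functions \<Omega>"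
    using K F by (intro test_functionsI[where K = K]) (auto simp: smooth_on_def intro: Ck_on_compose)
  show "grad (\<lambda>x. F (f x)) x = F' (f x) *\<^sub>R grad f x"
    using has_derivative_compose[OF test_functions_has_gradient[OF f] F'[unfolded has_field_derivative_def]]
    by (intro grad_eqI) simp
qed

text \<open>The Sobolev spaces live on \<open>lebesgue_on \<Omega>\<close>, whereas Tonelli and
  translation invariance are applied over \<open>lborel\<close>. For Borel functions vanishing
  outside the set the two integrals agree.\<close>

lemma integral_lebesgue_on_eq_lborel:
  fixes f :: "'a::euclidean_space \<Rightarrow> 'b::euclidean_space"
  assumes f: "f \<in> borel_measurable borel" and S: "S \<in> sets lebesgue" and 0: "\<And>x. x \<notin> S \<Longrightarrow> f x = 0"
  shows "integrable (lebesgue_on S) f \<longleftrightarrow> integrable lborel f"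
    and "integral\<^sup>L (lebesgue_on S) f = integral\<^sup>L lborel f"
proof -
  have *: "(\<lambda>x. if x \<in> S then f x else 0) = f" using 0 by auto
  show "integrable (lebesgue_on S) f \<longleftrightarrow> integrable lborel f"
    using Lebesgue_Measure.integrable_restrict_UNIV[OF S, of f] f by (simp add: * integrable_completion)
  show "integral\<^sup>L (lebesgue_on S) f = integral\<^sup>L lborel f"
    using Lebesgue_Measure.integral_restrict_UNIV[OF S, of f] f by (simp add: * integral_completion)
qed

lemma borel_imp_lebesgue_on_measurable:
  "f \<in> borel_measurable borel \<Longrightarrow> f \<in> borel_measurable (lebesgue_on S)"
  by (intro measurable_restrict_space1 measurable_completion) simp

lemma integrable_mult_continuous_compact_support:
  fixes f :: "'a::euclidean_space \<Rightarrow> real"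
  assumes f: "integrable (lebesgue_on K) f" and K: "compact K" "K \<subseteq> S" and S: "S \<in> sets lebesgue"
    and g: "continuous_on UNIV g" and 0: "\<And>x. x \<notin> K \<Longrightarrow> g x = (0::real)"
  shows "integrable (lebesgue_on S) (\<lambda>x. f x * g x)"
proof -
  have Ks: "K \<in> sets lebesgue" using K by (simp add: borel_compact)
  have "bounded (range g)"
  proof -
    have "bounded (g ` K)"
      using K g by (intro compact_imp_bounded compact_continuous_image continuous_on_subset[OF g]) auto
    then have "bounded (insert 0 (g ` K))" by simp
    then show ?thesis by (rule bounded_subset) (use 0 in blast)
  qed
  then obtain B where B: "\<And>x. \<bar>g x\<bar> \<le> B" by (auto simp: bounded_iff)
  have [measurable]: "g \<in> borel_measurable (lebesgue_on K)"
    using g by (intro borel_imp_lebesgue_on_measurable borel_measurable_continuous_onI)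
  have [measurable]: "f \<in> borel_measurable (lebesgue_on K)" using f by auto
  have "integrable (lebesgue_on K) (\<lambda>x. f x * g x)"
  proof (rule Bochner_Integration.integrable_bound[OF integrable_mult_right[OF integrable_abs[OF f], of B]])
    have "norm (f x * g x) \<le> norm (B * \<bar>f x\<bar>)" for x
      using mult_right_mono[OF order_trans[OF B[of x] abs_ge_self] abs_ge_zero[of "f x"]]
      by (simp add: abs_mult mult.commute)
    then show "AE x in lebesgue_on K. norm (f x * g x) \<le> norm (B * \<bar>f x\<bar>)" by simp
  qed measurable
  then have "integrable lebesgue (\<lambda>x. if x \<in> K then f x * g x else 0)"
    by (rule iffD2[OF Lebesgue_Measure.integrable_restrict_UNIV[OF Ks]])
  also have "(\<lambda>x. if x \<in> K then f x * g x else 0) = (\<lambda>x. if x \<in> S then f x * g x else 0)"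
    using 0 K(2) by (auto simp: fun_eq_iff)
  finally show ?thesis by (rule iffD1[OF Lebesgue_Measure.integrable_restrict_UNIV[OF S]])
qed

lemma locally_integrable_mult_test:
  fixes u :: "real^'n \<Rightarrow> real"
  assumes u: "locally_integrable \<Omega> u" and \<Omega>: "open \<Omega>" and g: "continuous_on UNIV g"
    and K: "compact K" "K \<subseteq> \<Omega>" "\<And>x. x \<notin> K \<Longrightarrow> g x = (0::real)"
  shows "integrable (lebesgue_on \<Omega>) (\<lambda>x. u x * g x)"
  using u K by (intro integrable_mult_continuous_compact_support[OF _ K(1,2) _ g K(3)])
    (auto simp: locally_integrable_def \<Omega> intro: borel_open)

text \<open>Translation invariance makes every difference quotient of \<open>f\<close> in direction
  \<open>h\<close> integrate to 0. The quotients obey a common Lipschitz bound and live in a fixed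
  compact set, so dominated convergence carries this over to the derivative.\<close>

lemma integral_gradient_eq_0:
  fixes f :: "'a::euclidean_space \<Rightarrow> real" and G :: "'a \<Rightarrow> 'a"
  assumes d: "\<And>x. (f has_derivative (\<lambda>h. G x \<bullet> h)) (at x)" and G: "continuous_on UNIV G"
    and K: "compact K" "\<And>x. x \<notin> K \<Longrightarrow> f x = 0"
  shows "(LINT x|lborel. G x \<bullet> h) = 0"
proof -
  have G0: "G x = 0" if "x \<notin> K" for x
    using derivative_zero_outside_support[OF d compact_imp_closed[OF K(1)] K(2) that] .
  have cf: "continuous_on UNIV f"
    using d by (metis continuous_at_imp_continuous_on has_derivative_continuous)
  have [measurable]: "f \<in> borel_measurable borel" "G \<in> borel_measurable borel"
    using G cf by (auto intro: borel_measurable_continuous_onI)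
  have "bounded (insert 0 (G ` K))"
    using K G by (simp add: compact_imp_bounded compact_continuous_image continuous_on_subset[OF G])
  then have "bounded (range G)" by (rule bounded_subset) (use G0 in blast)
  then obtain B where B: "\<And>x. norm (G x) \<le> B" by (auto simp: bounded_iff)
  have lip: "\<bar>f (x + k) - f x\<bar> \<le> B * norm k" for x k
  proof -
    have "norm (f (x + k) - f x) \<le> B * norm (x + k - x)"
    proof (rule differentiable_bound[of UNIV f "\<lambda>x h. G x \<bullet> h"])
      show "onorm (\<lambda>h. G x \<bullet> h) \<le> B" for x
        using B[of x] by (intro onorm_le) (metis Cauchy_Schwarz_ineq2 mult_right_mono norm_ge_zero order_trans real_norm_def)
    qed (use d in auto)
    then show ?thesis by simp
  qed
  have fint: "integrable lborel f"
    using integrable_continuous_compact_support[OF cf K] .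
  \<comment> \<open>The set \<open>K\<close> fattened by \<open>norm h\<close>: all difference
    quotients vanish outside it, as the steps \<open>h / (n + 1)\<close> are never longer than
    \<open>h\<close>.\<close>
  define L where "L = {x + y |x y. x \<in> K \<and> y \<in> cball 0 (norm h)}"
  have L: "compact L" unfolding L_def using K by (intro compact_sums) auto
  define s where "s n x = real (Suc n) * (f (x + h /\<^sub>R real (Suc n)) - f x)" for n x
  have "(\<lambda>n. \<integral>x. s n x \<partial>lborel) \<longlonglongrightarrow> (LINT x|lborel. G x \<bullet> h)"
  proof (rule integral_dominated_convergence[where w = "\<lambda>x. indicator L x * (B * norm h)"])
    show "integrable lborel (\<lambda>x. indicator L x * (B * norm h))"
      using L by (intro integrable_mult_left integrable_real_indicator emeasure_compact_finite) (auto simp: borel_compact)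
    have "s n \<in> borel_measurable borel" for n unfolding s_def by measurable
    then show "s n \<in> borel_measurable lborel" for n by simp
    show "AE x in lborel. (\<lambda>n. s n x) \<longlonglongrightarrow> G x \<bullet> h"
    proof (rule AE_I2)
      fix x
      have "((\<lambda>t. f (x + t *\<^sub>R h)) has_derivative (\<lambda>v. G (x + 0 *\<^sub>R h) \<bullet> (v *\<^sub>R h))) (at 0)"
        by (rule has_derivative_compose[OF _ d]) (auto intro!: derivative_eq_intros)
      then have "((\<lambda>t. f (x + t *\<^sub>R h)) has_real_derivative (G x \<bullet> h)) (at 0)"
        by (simp add: has_field_derivative_def mult_commute_abs)
      then have "((\<lambda>t. (f (x + t *\<^sub>R h) - f x) / t) \<longlongrightarrow> G x \<bullet> h) (at 0)"
        by (simp add: DERIV_def)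
      moreover have "filterlim (\<lambda>n. inverse (real (Suc n))) (at 0) sequentially"
        using LIMSEQ_inverse_real_of_nat by (auto simp: filterlim_at)
      ultimately have "(\<lambda>n. (f (x + inverse (real (Suc n)) *\<^sub>R h) - f x) / inverse (real (Suc n))) \<longlonglongrightarrow> G x \<bullet> h"
        by (rule filterlim_compose)
      then show "(\<lambda>n. s n x) \<longlonglongrightarrow> G x \<bullet> h"
        by (simp add: s_def divide_inverse mult.commute)
    qed
    show "AE x in lborel. norm (s n x) \<le> indicator L x * (B * norm h)" for n
    proof (rule AE_I2)
      fix x
      let ?k = "h /\<^sub>R real (Suc n)"
      have nk: "norm ?k \<le> norm h" by (simp add: field_simps)
      show "norm (s n x) \<le> indicator L x * (B * norm h)"
      proof (cases "x \<in> L")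
        case True
        have "\<bar>s n x\<bar> \<le> real (Suc n) * (B * norm ?k)"
          unfolding s_def abs_mult using lip[of x ?k] by (intro mult_mono) auto
        also have "\<dots> = B * norm h" by (simp del: of_nat_Suc)
        finally show ?thesis using True by simp
      next
        case False
        have "x + 0 \<in> L" if "x \<in> K" unfolding L_def using that by force
        then have "x \<notin> K" using False by auto
        moreover have "x + ?k \<notin> K"
        proof
          assume "x + ?k \<in> K"
          then have "(x + ?k) + (- ?k) \<in> L" unfolding L_def using nk by (intro CollectI exI[of _ "x + ?k"] exI[of _ "- ?k"]) (simp del: of_nat_Suc)
          with False show False by simp
        qed
        ultimately show ?thesis using False K by (simp add: s_def)
      qed
    qed
  qed simp
  moreover have "(LINT x|lborel. s n x) = 0" for n
  proof -
    let ?k = "h /\<^sub>R real (Suc n)"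
    have "(LINT x|lborel. f x) = (LINT x|distr lborel borel ((+) ?k). f x)"
      by (simp add: lborel_distr_plus)
    also have "\<dots> = (LINT x|lborel. f (x + ?k))"
      by (subst integral_distr) (auto simp: add.commute)
    finally have "(LINT x|lborel. f (x + ?k)) = (LINT x|lborel. f x)" ..
    moreover have "integrable lborel (\<lambda>x. f (x + ?k))"
    proof -
      have "integrable (distr lborel borel ((+) ?k)) f" using fint by (simp add: lborel_distr_plus)
      then show ?thesis by (subst (asm) integrable_distr_eq) (auto simp: add.commute)
    qed
    ultimately show ?thesis unfolding s_def using fint by simp
  qed
  ultimately show ?thesis using LIMSEQ_unique[OF _ tendsto_const] by fastforce
qed

section \<open>Smooth bumps on boxes and the fundamental lemma of the calculus of variations\<close>

definition box_bump :: "real^'n \<Rightarrow> real^'n \<Rightarrow> nat \<Rightarrow> real^'n \<Rightarrow> real" where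
  "box_bump c d k x = (\<Prod>i\<in>UNIV. flat_exp 0 (real (Suc k) * (x $ i - c $ i)) * flat_exp 0 (real (Suc k) * (d $ i - x $ i)))"

lemma flat_exp_0_bounds: "0 \<le> flat_exp 0 x" "flat_exp 0 x \<le> 1"
  by (auto simp: flat_exp_def)

lemma flat_exp_0_tendsto:
  "(\<lambda>k. flat_exp 0 (real (Suc k) * t)) \<longlonglongrightarrow> (if 0 < t then 1 else 0)"
proof (cases "0 < t")
  case True
  have "(\<lambda>k. exp (- (inverse (real (Suc k)) * inverse t))) \<longlonglongrightarrow> exp (- (0 * inverse t))"
    by (intro tendsto_intros LIMSEQ_inverse_real_of_nat)
  then show ?thesis using True by (simp add: flat_exp_def del: of_nat_Suc)
next
  case False
  then have "flat_exp 0 (real (Suc k) * t) = 0" for k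
    by (simp add: flat_exp_def zero_less_mult_iff del: of_nat_Suc)
  then show ?thesis using False by simp
qed

lemma box_bump_bounds: "0 \<le> box_bump c d k x" "box_bump c d k x \<le> 1"
  unfolding box_bump_def by (auto intro!: prod_nonneg prod_le_1 mult_le_one mult_nonneg_nonneg flat_exp_0_bounds)

lemma box_bump_outside:
  assumes "x \<notin> box c d" shows "box_bump c d k x = 0"
proof -
  obtain i where "x $ i \<le> c $ i \<or> d $ i \<le> x $ i"
    using assms by (auto simp: mem_box_cart not_less)
  then have "flat_exp 0 (real (Suc k) * (x $ i - c $ i)) * flat_exp 0 (real (Suc k) * (d $ i - x $ i)) = 0"
    by (auto simp: flat_exp_def zero_less_mult_iff simp del: of_nat_Suc)
  then show ?thesis unfolding box_bump_def by (intro prod_zero) auto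
qed

text \<open>Each factor is \<open>exp (- 1 / ((k + 1) * t))\<close> for \<open>t > 0\<close>, which
  tends to 1, and 0 otherwise. Indicators of open boxes are thus limits of smooth functions between
  0 and 1 that vanish outside the box, which replaces mollification.\<close>

lemma box_bump_tendsto: "(\<lambda>k. box_bump c d k x) \<longlonglongrightarrow> indicator (box c d) x"
proof -
  have "(\<lambda>k. box_bump c d k x) \<longlonglongrightarrow> (\<Prod>i\<in>UNIV. (if 0 < x $ i - c $ i then 1 else 0) * (if 0 < d $ i - x $ i then 1 else 0))"
    unfolding box_bump_def by (intro tendsto_prod tendsto_mult flat_exp_0_tendsto)
  also have "(\<Prod>i\<in>UNIV. (if 0 < x $ i - c $ i then 1 else 0) * (if 0 < d $ i - x $ i then 1 else 0)) = (indicator (box c d) x :: real)"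
    by (auto simp: indicator_def mem_box_cart prod.neutral)
  finally show ?thesis .
qed

lemma Ck_on_box_bump: "Ck_on m UNIV (box_bump c d k)"
proof -
  have 1: "Ck_on m UNIV (\<lambda>x. real (Suc k) * (x $ i - c $ i))" for i
  proof -
    have "Ck_on m UNIV (\<lambda>x. real (Suc k) * (x $ i) + (- real (Suc k) * c $ i))"
      by (intro Ck_on_add Ck_on_mult Ck_on_const Ck_on_linear bounded_linear_vec_nth)
    then show ?thesis by (simp add: algebra_simps)
  qed
  have 2: "Ck_on m UNIV (\<lambda>x. real (Suc k) * (d $ i - x $ i))" for i
  proof -
    have "Ck_on m UNIV (\<lambda>x. (- real (Suc k)) * (x $ i) + real (Suc k) * d $ i)"
      by (intro Ck_on_add Ck_on_mult Ck_on_const Ck_on_linear bounded_linear_vec_nth)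
    then show ?thesis by (simp add: algebra_simps)
  qed
  have "Ck_on m UNIV (\<lambda>x. \<Prod>i\<in>UNIV. flat_exp 0 (real (Suc k) * (x $ i - c $ i)) * flat_exp 0 (real (Suc k) * (d $ i - x $ i)))"
    by (intro Ck_on_prod Ck_on_mult Ck_on_compose[OF Ck_on_flat_exp 1] Ck_on_compose[OF Ck_on_flat_exp 2])
  then show ?thesis by (simp add: box_bump_def[abs_def])
qed

lemma box_bump_test_function:
  assumes "cbox c d \<subseteq> \<Omega>"
  shows "box_bump c d k \<in> test_functions \<Omega>"
  using assms box_subset_cbox[of c d] box_bump_outside[of _ c d k]
  by (intro test_functionsI[OF _ compact_cbox[of c d]]) (auto simp: smooth_on_def Ck_on_box_bump)

text \<open>The sets over which \<open>f\<close> integrates to 0 form a Dynkin system, complements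
  being covered by the vanishing of the full integral. Boxes are stable under intersection and
  generate the Borel sets, so the integrals over \<open>{x. 0 < f x}\<close> and
  \<open>{x. f x < 0}\<close> vanish too.\<close>

lemma AE_eq_0_if_integral_boxes_0:
  fixes f :: "'a::euclidean_space \<Rightarrow> real"
  assumes f: "integrable lborel f" and 0: "integral\<^sup>L lborel f = 0"
    and box: "\<And>c d. (LINT x|lborel. indicator (box c d) x * f x) = 0"
  shows "AE x in lborel. f x = 0"
proof -
  have [measurable]: "f \<in> borel_measurable borel" using f by auto
  have int: "integrable lborel (\<lambda>x. indicator A x * f x)" if "A \<in> sets borel" for A
    using integrable_mult_indicator[of A lborel f] that f by simp
  have *: "(LINT x|lborel. indicator A x * f x) = 0" if "A \<in> sets borel" for A
  proof -
    have "Int_stable (range (\<lambda>(a, b). box a b) :: 'a set set)"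
      proof (rule Int_stableI)
      fix X Y :: "'a set" assume "X \<in> range (\<lambda>(a, b). box a b)" "Y \<in> range (\<lambda>(a, b). box a b)"
      then obtain a b a' b' where XY: "X = box a b" "Y = box a' b'" by auto
      show "X \<inter> Y \<in> range (\<lambda>(a, b). box a b)"
        unfolding XY box_Int_box by (rule range_eqI[of _ _ "(_, _)"]) simp
    qed
    moreover have "range (\<lambda>(a, b). box a b) \<subseteq> Pow (UNIV :: 'a set)" by simp
    moreover have "A \<in> sigma_sets UNIV (range (\<lambda>(a, b). box a b))"
      using that by (simp add: borel_eq_box)
    ultimately show ?thesis
    proof (induction rule: sigma_sets_induct_disjoint)
      case (basic A)
      then show ?case using box by auto
    next
      case empty
      then show ?case by simp
    next
      case (compl A)
      then have A: "A \<in> sets borel" by (simp add: borel_eq_box)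
      have "(LINT x|lborel. indicator (UNIV - A) x * f x) = (LINT x|lborel. f x - indicator A x * f x)"
        by (intro Bochner_Integration.integral_cong) (auto simp: indicator_def)
      then show ?case using compl int[OF A] f 0 by simp
    next
      case (union A)
      then have A: "A i \<in> sets borel" for i by (auto simp: borel_eq_box)
      then have U: "(\<Union>i. A i) \<in> sets borel" by blast
      have "(LINT x:(\<Union>i. A i)|lborel. f x) = (\<Sum>i. (LINT x:A i|lborel. f x))"
        using A int[OF U] union
        by (intro lebesgue_integral_countable_add) (auto simp: set_integrable_def disjoint_family_on_def)
      then show ?case using union by (simp add: set_lebesgue_integral_def)
    qed
  qed
  have "AE x in lborel. max 0 (f x) = 0"
  proof -
    have "(LINT x|lborel. max 0 (f x)) = (LINT x|lborel. indicator {x. 0 < f x} x * f x)"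
      by (intro Bochner_Integration.integral_cong) (auto simp: indicator_def)
    also have "\<dots> = 0" by (rule *) measurable
    finally show ?thesis using f
      by (subst integral_nonneg_eq_0_iff_AE[symmetric]) auto
  qed
  moreover have "AE x in lborel. max 0 (- f x) = 0"
  proof -
    have "(LINT x|lborel. max 0 (- f x)) = (LINT x|lborel. - (indicator {x. f x < 0} x * f x))"
      by (intro Bochner_Integration.integral_cong) (auto simp: indicator_def)
    also have "\<dots> = - (LINT x|lborel. indicator {x. f x < 0} x * f x)" by simp
    also have "(LINT x|lborel. indicator {x. f x < 0} x * f x) = 0" by (rule *) measurable
    finally show ?thesis using f
      by (subst integral_nonneg_eq_0_iff_AE[symmetric]) auto
  qed
  ultimately show ?thesis by eventually_elim auto
qed

text \<open>On a closed box contained in \<open>\<Omega>\<close> the function is integrable, and box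
  bumps turn vanishing against test functions into vanishing over all smaller boxes. Countably many
  closed boxes exhaust \<open>\<Omega>\<close>.\<close>

lemma AE_eq_0_if_integral_test_functions_0:
  fixes G :: "real^'n \<Rightarrow> real"
  assumes G: "locally_integrable \<Omega> G" and \<Omega>: "open \<Omega>"
    and 0: "\<And>\<phi>. \<phi> \<in> test_functions \<Omega> \<Longrightarrow> (LINT x|lebesgue_on \<Omega>. G x * \<phi> x) = 0"
  shows "AE x in lebesgue_on \<Omega>. G x = 0"
proof -
  have \<Omega>s: "\<Omega> \<in> sets lebesgue" using \<Omega> by auto
  have box: "(LINT x|lebesgue. (if x \<in> cbox a b then indicator (box c d) x * G x else 0)) = 0"
    if ab: "cbox a b \<subseteq> \<Omega>" and cd: "cbox c d \<subseteq> cbox a b" for a b c d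
  proof -
    let ?G = "\<lambda>x. if x \<in> cbox a b then G x else 0"
    have Gi: "integrable lebesgue ?G"
      using G ab by (intro iffD2[OF Lebesgue_Measure.integrable_restrict_UNIV]) (auto simp: locally_integrable_def)
    have "(\<lambda>k. \<integral>x. ?G x * box_bump c d k x \<partial>lebesgue) \<longlonglongrightarrow> (LINT x|lebesgue. ?G x * indicator (box c d) x)"
    proof (rule integral_dominated_convergence[where w = "\<lambda>x. \<bar>?G x\<bar>"])
      have "box_bump c d k \<in> borel_measurable lebesgue" for k
        using test_functions_measurable(1)[OF box_bump_test_function[OF order_refl, of c d k]]
        by (intro measurable_completion) simp
      then show "(\<lambda>x. ?G x * box_bump c d k x) \<in> borel_measurable lebesgue" for k
        using Gi by (intro borel_measurable_times) auto
      show "(\<lambda>x. ?G x * indicator (box c d) x) \<in> borel_measurable lebesgue"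
        using Gi by (intro borel_measurable_times borel_measurable_indicator) auto
      show "AE x in lebesgue. (\<lambda>k. ?G x * box_bump c d k x) \<longlonglongrightarrow> ?G x * indicator (box c d) x"
        by (intro AE_I2 tendsto_mult tendsto_const box_bump_tendsto)
      show "AE x in lebesgue. norm (?G x * box_bump c d k x) \<le> \<bar>?G x\<bar>" for k
        using box_bump_bounds[of c d k] by (intro AE_I2) (auto simp: abs_mult intro: mult_left_le)
    qed (use Gi in auto)
    moreover have "(LINT x|lebesgue. ?G x * box_bump c d k x) = 0" for k
    proof -
      have "(LINT x|lebesgue. ?G x * box_bump c d k x) = (LINT x|lebesgue. (if x \<in> \<Omega> then G x * box_bump c d k x else 0))"
        using ab cd box_subset_cbox[of c d] box_bump_outside[of _ c d k]
        by (intro Bochner_Integration.integral_cong) auto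
      also have "\<dots> = (LINT x|lebesgue_on \<Omega>. G x * box_bump c d k x)"
        by (rule Lebesgue_Measure.integral_restrict_UNIV[OF \<Omega>s])
      also have "\<dots> = 0" using ab cd by (intro 0 box_bump_test_function) auto
      finally show ?thesis .
    qed
    ultimately have "(LINT x|lebesgue. ?G x * indicator (box c d) x) = 0"
      using LIMSEQ_unique[OF _ tendsto_const] by fastforce
    also have "(\<lambda>x. ?G x * indicator (box c d) x) = (\<lambda>x. if x \<in> cbox a b then indicator (box c d) x * G x else 0)"
      by auto
    finally show ?thesis .
  qed
  have cb: "AE x in lebesgue. x \<in> cbox a b \<longrightarrow> G x = 0" if ab: "cbox a b \<subseteq> \<Omega>" for a b
  proof -
    let ?G = "\<lambda>x. if x \<in> cbox a b then G x * indicator (box a b) x else 0"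
    have "integrable lebesgue (\<lambda>x. if x \<in> cbox a b then G x else 0)"
      using G ab by (intro iffD2[OF Lebesgue_Measure.integrable_restrict_UNIV]) (auto simp: locally_integrable_def)
    from integrable_mult_indicator[OF _ this, of "box a b"] have Gi: "integrable lebesgue ?G"
      by (rule back_subst[where P = "integrable lebesgue"]) (auto simp: indicator_def)
    \<comment> \<open>\<open>G\<close> is only Lebesgue measurable, so the argument with generators
      is run on a Borel version \<open>H\<close>. Cutting at the open box makes the integral of
      \<open>H\<close> over any box equal to that of \<open>G\<close> over a box inside
      \<open>cbox a b\<close>.\<close>
    then obtain H where H: "H \<in> borel_measurable lborel" "AE x in lborel. ?G x = H x"
      using completion_ex_borel_measurable_real[of ?G lborel] by auto
    then have H2: "AE x in lebesgue. ?G x = H x" by (simp add: AE_completion_iff)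
    have [measurable]: "H \<in> borel_measurable borel" "H \<in> borel_measurable lebesgue"
      using H by (auto intro: measurable_completion)
    have [measurable]: "?G \<in> borel_measurable lebesgue" using Gi by auto
    have Hi: "integrable lborel H"
    proof -
      have "integrable lebesgue H" using Gi H2
        by (subst integrable_cong_AE[of H lebesgue ?G]) (auto elim: eventually_mono)
      then show ?thesis using H by (simp add: integrable_completion)
    qed
    have Hb: "(LINT x|lborel. indicator (box c d) x * H x) = 0" for c d
    proof -
      define c' :: "real^'n" where "c' = (\<Sum>i\<in>Basis. max (a \<bullet> i) (c \<bullet> i) *\<^sub>R i)"
      define d' :: "real^'n" where "d' = (\<Sum>i\<in>Basis. min (b \<bullet> i) (d \<bullet> i) *\<^sub>R i)"
      have I: "box a b \<inter> box c d = box c' d'" unfolding c'_def d'_def by (rule box_Int_box)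
      have cd': "cbox c' d' \<subseteq> cbox a b" by (auto simp: c'_def d'_def mem_box)
      have "(LINT x|lborel. indicator (box c d) x * H x) = (LINT x|lebesgue. indicator (box c d) x * H x)"
        by (rule integral_completion[symmetric]) measurable
      also have "\<dots> = (LINT x|lebesgue. indicator (box c d) x * ?G x)"
        using H2 Gi by (intro integral_cong_AE borel_measurable_times borel_measurable_indicator) (auto elim: eventually_mono)
      also have "(\<lambda>x. indicator (box c d) x * ?G x) = (\<lambda>x. if x \<in> cbox a b then indicator (box c' d') x * G x else 0)"
        unfolding I[symmetric] by (auto simp: fun_eq_iff indicator_def)
      finally show ?thesis using box[OF ab cd'] by simp
    qed
    have "integral\<^sup>L lborel H = integral\<^sup>L lborel (\<lambda>x. indicator (box a b) x * H x)"
    proof (rule integral_cong_AE)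
      show "AE x in lborel. H x = indicator (box a b) x * H x"
        using H(2) by eventually_elim (auto simp: indicator_def split: if_splits)
    qed measurable
    then have "AE x in lborel. H x = 0" by (intro AE_eq_0_if_integral_boxes_0 Hi Hb) (simp add: Hb)
    then have "AE x in lebesgue. H x = 0" by (simp add: AE_completion_iff)
    \<comment> \<open>The cut to the open box lost the faces of the closed box, a null set.\<close>
    moreover have "AE x in lebesgue. x \<notin> cbox a b - box a b"
      using negligible_frontier_interval[of a b] by (intro AE_not_in) (simp add: negligible_iff_null_sets)
    ultimately show ?thesis using H2 by eventually_elim (auto split: if_splits)
  qed
  obtain \<D> where D: "countable \<D>" "\<D> \<subseteq> Pow \<Omega>" "\<And>X. X \<in> \<D> \<Longrightarrow> \<exists>a b. X = cbox a b" "\<Union>\<D> = \<Omega>"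
    using open_countable_Union_open_cbox[OF \<Omega>] by metis
  have "AE x in lebesgue. \<forall>X\<in>\<D>. x \<in> X \<longrightarrow> G x = 0"
    using D cb by (subst AE_ball_countable) (auto, metis Pow_iff subsetD)
  then have "AE x in lebesgue. x \<in> \<Omega> \<longrightarrow> G x = 0"
    by eventually_elim (use D in blast)
  then show ?thesis using \<Omega>s by (simp add: AE_restrict_space_iff)
qed

section \<open>Uniqueness and linearity of the weak gradient\<close>

lemma locally_integrable_nth:
  "locally_integrable \<Omega> G \<Longrightarrow> locally_integrable \<Omega> (\<lambda>x. G x $ i)"
  unfolding locally_integrable_def
  using integrable_bounded_linear[OF bounded_linear_vec_nth] by blast

lemma locally_integrable_add_scaleR:
  "locally_integrable \<Omega> f \<Longrightarrow> locally_integrable \<Omega> g \<Longrightarrow> locally_integrable \<Omega> (\<lambda>x. f x + c *\<^sub>R g x)"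
  unfolding locally_integrable_def by auto

lemma locally_integrable_continuous:
  fixes f :: "real^'n \<Rightarrow> 'b::euclidean_space"
  assumes "continuous_on UNIV f"
  shows "locally_integrable \<Omega> f"
  unfolding locally_integrable_def
proof safe
  fix K :: "(real^'n) set" assume K: "compact K"
  have "integrable lborel (\<lambda>x. indicator K x *\<^sub>R f x)"
    using K assms continuous_on_subset by (intro borel_integrable_compact) blast+
  then have "integrable lebesgue (\<lambda>x. indicator K x *\<^sub>R f x)"
    by (subst integrable_completion) auto
  also have "(\<lambda>x. indicator K x *\<^sub>R f x) = (\<lambda>x. if x \<in> K then f x else 0)" by (auto simp: indicator_def)
  finally show "integrable (lebesgue_on K) f"
    using K by (intro iffD1[OF Lebesgue_Measure.integrable_restrict_UNIV]) (auto simp: borel_compact)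
qed

lemma frechet_derivative_axis: "frechet_derivative f (at x) (axis i 1) = grad f x $ i"
  by (simp add: grad_def)

lemma integrable_mult_test_function:
  fixes u :: "real^'n \<Rightarrow> real"
  assumes u: "locally_integrable \<Omega> u" and \<Omega>: "open \<Omega>" and \<phi>: "\<phi> \<in> test_functions \<Omega>"
  shows "integrable (lebesgue_on \<Omega>) (\<lambda>x. u x * \<phi> x)"
    and "integrable (lebesgue_on \<Omega>) (\<lambda>x. u x * grad \<phi> x $ i)"
proof -
  obtain K where K: "smooth_on UNIV \<phi>" "compact K" "K \<subseteq> \<Omega>" "\<And>x. x \<notin> K \<Longrightarrow> \<phi> x = 0"
     "\<And>x. x \<notin> K \<Longrightarrow> grad \<phi> x = 0"
    using \<phi> by (rule test_functionsE) blast
  show "integrable (lebesgue_on \<Omega>) (\<lambda>x. u x * \<phi> x)"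
    using K by (intro locally_integrable_mult_test[OF u \<Omega> smooth_on_continuous K(2)]) auto
  have "continuous_on UNIV (\<lambda>x. grad \<phi> x $ i)"
    by (intro bounded_linear.continuous_on[OF bounded_linear_vec_nth] smooth_continuous_gradient K)
  from locally_integrable_mult_test[OF u \<Omega> this K(2,3)]
  show "integrable (lebesgue_on \<Omega>) (\<lambda>x. u x * grad \<phi> x $ i)" using K(5) by simp
qed

lemma has_weak_gradient_unique:
  assumes \<Omega>: "open \<Omega>" and G: "has_weak_gradient \<Omega> u G" and H: "has_weak_gradient \<Omega> u H"
  shows "AE x in lebesgue_on \<Omega>. G x = H x"
proof -
  have "AE x in lebesgue_on \<Omega>. G x $ i - H x $ i = 0" for i
  proof (rule AE_eq_0_if_integral_test_functions_0[OF _ \<Omega>])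
    have G': "locally_integrable \<Omega> (\<lambda>x. G x $ i)" and H': "locally_integrable \<Omega> (\<lambda>x. H x $ i)"
      using G H by (auto simp: has_weak_gradient_def intro: locally_integrable_nth)
    then show "locally_integrable \<Omega> (\<lambda>x. G x $ i - H x $ i)"
      using locally_integrable_add_scaleR[of \<Omega> "\<lambda>x. G x $ i" "\<lambda>x. H x $ i" "-1"] by simp
    fix \<phi> assume \<phi>: "\<phi> \<in> test_functions \<Omega>"
    have "(LINT x|lebesgue_on \<Omega>. (G x $ i - H x $ i) * \<phi> x) = (LINT x|lebesgue_on \<Omega>. G x $ i * \<phi> x) - (LINT x|lebesgue_on \<Omega>. H x $ i * \<phi> x)"
      unfolding left_diff_distrib
      by (intro Bochner_Integration.integral_diff integrable_mult_test_function \<Omega> \<phi> G' H')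
    also have "\<dots> = 0" using G H \<phi> by (fastforce simp: has_weak_gradient_def)
    finally show "(LINT x|lebesgue_on \<Omega>. (G x $ i - H x $ i) * \<phi> x) = 0" .
  qed
  then have "AE x in lebesgue_on \<Omega>. \<forall>i. G x $ i - H x $ i = 0"
    by (subst AE_all_countable) auto
  then show ?thesis by eventually_elim (simp add: vec_eq_iff)
qed

lemma has_weak_gradient_add_cmult:
  assumes \<Omega>: "open \<Omega>" and u: "has_weak_gradient \<Omega> u G" and v: "has_weak_gradient \<Omega> v H"
  shows "has_weak_gradient \<Omega> (\<lambda>x. u x + c * v x) (\<lambda>x. G x + c *\<^sub>R H x)"
  unfolding has_weak_gradient_def
proof (intro conjI ballI allI)
  have l: "locally_integrable \<Omega> u" "locally_integrable \<Omega> v" "locally_integrable \<Omega> G" "locally_integrable \<Omega> H"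
    using u v by (auto simp: has_weak_gradient_def)
  show "locally_integrable \<Omega> (\<lambda>x. u x + c * v x)" "locally_integrable \<Omega> (\<lambda>x. G x + c *\<^sub>R H x)"
    using locally_integrable_add_scaleR[OF l(1,2), of c] locally_integrable_add_scaleR[OF l(3,4)] by simp_all
  fix \<phi> i assume \<phi>: "\<phi> \<in> test_functions \<Omega>"
  note i = integrable_mult_test_function[OF l(1) \<Omega> \<phi>] integrable_mult_test_function[OF l(2) \<Omega> \<phi>]
    integrable_mult_test_function[OF locally_integrable_nth[OF l(3)] \<Omega> \<phi>]
    integrable_mult_test_function[OF locally_integrable_nth[OF l(4)] \<Omega> \<phi>]
  have 1: "(LINT x|lebesgue_on \<Omega>. u x * grad \<phi> x $ i) = - (LINT x|lebesgue_on \<Omega>. G x $ i * \<phi> x)"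
    using u \<phi> by (simp add: has_weak_gradient_def frechet_derivative_axis)
  have 2: "(LINT x|lebesgue_on \<Omega>. v x * grad \<phi> x $ i) = - (LINT x|lebesgue_on \<Omega>. H x $ i * \<phi> x)"
    using v \<phi> by (simp add: has_weak_gradient_def frechet_derivative_axis)
  have "(LINT x|lebesgue_on \<Omega>. (u x + c * v x) * grad \<phi> x $ i)
     = (LINT x|lebesgue_on \<Omega>. u x * grad \<phi> x $ i + c * (v x * grad \<phi> x $ i))"
    by (simp add: distrib_right mult.assoc)
  also have "\<dots> = (LINT x|lebesgue_on \<Omega>. u x * grad \<phi> x $ i) + c * (LINT x|lebesgue_on \<Omega>. v x * grad \<phi> x $ i)"
    using i by simp
  also have "\<dots> = - ((LINT x|lebesgue_on \<Omega>. G x $ i * \<phi> x) + c * (LINT x|lebesgue_on \<Omega>. H x $ i * \<phi> x))"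
    unfolding 1 2 by simp
  also have "(LINT x|lebesgue_on \<Omega>. G x $ i * \<phi> x) + c * (LINT x|lebesgue_on \<Omega>. H x $ i * \<phi> x)
     = (LINT x|lebesgue_on \<Omega>. G x $ i * \<phi> x + c * (H x $ i * \<phi> x))"
    using i by simp
  also have "\<dots> = (LINT x|lebesgue_on \<Omega>. (G x + c *\<^sub>R H x) $ i * \<phi> x)"
    by (simp add: distrib_right mult.assoc)
  finally show "(LINT x|lebesgue_on \<Omega>. (u x + c * v x) * frechet_derivative \<phi> (at x) (axis i 1))
    = - (LINT x|lebesgue_on \<Omega>. (G x + c *\<^sub>R H x) $ i * \<phi> x)"
    by (simp add: frechet_derivative_axis)
qed

text \<open>Integration by parts: the product of the two test functions has compact support, so its
  classical gradient integrates to 0 in every direction, and the product rule separates the two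
  terms.\<close>

lemma test_function_has_weak_gradient:
  assumes \<Omega>: "open \<Omega>" and f: "f \<in> test_functions \<Omega>"
  shows "has_weak_gradient \<Omega> f (grad f)"
  unfolding has_weak_gradient_def
proof (intro conjI ballI allI)
  have sf: "smooth_on UNIV f" using f by (rule test_functions_smooth)
  show l: "locally_integrable \<Omega> f" "locally_integrable \<Omega> (grad f)"
    using sf by (auto intro: locally_integrable_continuous smooth_on_continuous smooth_continuous_gradient)
  fix \<phi> i assume \<phi>: "\<phi> \<in> test_functions \<Omega>"
  obtain K where K: "smooth_on UNIV \<phi>" "compact K" "K \<subseteq> \<Omega>" "\<And>x. x \<notin> K \<Longrightarrow> \<phi> x = 0"
     "\<And>x. x \<notin> K \<Longrightarrow> grad \<phi> x = 0"
    using \<phi> by (rule test_functionsE) blast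
  let ?G = "\<lambda>x. f x *\<^sub>R grad \<phi> x + \<phi> x *\<^sub>R grad f x"
  have "(LINT x|lborel. ?G x \<bullet> axis i 1) = 0"
  proof (rule integral_gradient_eq_0[where f = "\<lambda>x. f x * \<phi> x" and K = K])
    show "((\<lambda>x. f x * \<phi> x) has_derivative (\<lambda>h. ?G x \<bullet> h)) (at x)" for x
      using has_derivative_mult[OF test_functions_has_gradient[OF f, of x] test_functions_has_gradient[OF \<phi>, of x]]
      by (simp add: inner_add_left mult.commute)
    show "continuous_on UNIV ?G"
      by (intro continuous_intros smooth_on_continuous smooth_continuous_gradient sf K)
  qed (use K in auto)
  moreover have "(LINT x|lebesgue_on \<Omega>. ?G x \<bullet> axis i 1) = (LINT x|lborel. ?G x \<bullet> axis i 1)"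
  proof (rule integral_lebesgue_on_eq_lborel)
    note [measurable] = test_functions_measurable[OF f] test_functions_measurable[OF \<phi>]
    show "(\<lambda>x. ?G x \<bullet> axis i 1) \<in> borel_measurable borel" by measurable
    show "?G x \<bullet> axis i 1 = 0" if "x \<notin> \<Omega>" for x
    proof -
      have "x \<notin> K" using K(3) that by blast
      then show ?thesis using K(4,5) by simp
    qed
  qed (use \<Omega> in auto)
  moreover have "(LINT x|lebesgue_on \<Omega>. ?G x \<bullet> axis i 1)
    = (LINT x|lebesgue_on \<Omega>. f x * grad \<phi> x $ i) + (LINT x|lebesgue_on \<Omega>. grad f x $ i * \<phi> x)"
    using integrable_mult_test_function[OF l(1) \<Omega> \<phi>] integrable_mult_test_function[OF locally_integrable_nth[OF l(2)] \<Omega> \<phi>]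
    by (simp add: inner_add_left inner_axis mult.commute)
  ultimately show "(LINT x|lebesgue_on \<Omega>. f x * frechet_derivative \<phi> (at x) (axis i 1))
    = - (LINT x|lebesgue_on \<Omega>. grad f x $ i * \<phi> x)"
    by (simp add: frechet_derivative_axis)
qed

subsection \<open>Lebesgue and Sobolev spaces\<close>

lemma critical_exponent_gt:
  assumes "1 < p" "p < real N"
  shows "p < critical_exponent N p" "1 < critical_exponent N p"
proof -
  have "(real N - p) * p < p * real N"
    using assms by (simp add: algebra_simps add_pos_pos)
  then show "p < critical_exponent N p"
    using assms unfolding critical_exponent_def by (subst less_divide_eq) (simp add: mult.commute)
  then show "1 < critical_exponent N p" using assms by simp
qed

lemma Lp_norm_nonneg: "0 \<le> Lp_norm q \<Omega> f"
  by (simp add: Lp_norm_def)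

lemma Lp_norm_powr:
  "0 < q \<Longrightarrow> Lp_norm q \<Omega> f powr q = (LINT x|lebesgue_on \<Omega>. norm (f x) powr q)"
  by (simp add: Lp_norm_def powr_powr)

lemma Lp_spaceD:
  assumes "f \<in> Lp_space q \<Omega>"
  shows "f \<in> borel_measurable (lebesgue_on \<Omega>)" "integrable (lebesgue_on \<Omega>) (\<lambda>x. norm (f x) powr q)"
  using assms by (auto simp: Lp_space_def)

lemma Lp_space_scaleR:
  assumes "f \<in> Lp_space q \<Omega>"
  shows "(\<lambda>x. c *\<^sub>R f x) \<in> Lp_space q \<Omega>"
  using Lp_spaceD[OF assms] by (auto simp: Lp_space_def powr_mult)

lemma Lp_norm_scaleR:
  assumes "0 < q"
  shows "Lp_norm q \<Omega> (\<lambda>x. c *\<^sub>R f x) = \<bar>c\<bar> * Lp_norm q \<Omega> f"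
  using assms by (simp add: Lp_norm_def powr_mult powr_powr)

lemma Lp_space_add_scaleR:
  assumes "0 < q" "f \<in> Lp_space q \<Omega>" "g \<in> Lp_space q \<Omega>"
  shows "(\<lambda>x. f x + c *\<^sub>R g x) \<in> Lp_space q \<Omega>"
proof -
  note f = Lp_spaceD[OF assms(2)] and g = Lp_spaceD[OF Lp_space_scaleR[OF assms(3), of c]]
  show ?thesis
    unfolding Lp_space_def using integrable_powr_add[OF assms(1) f(1) g(1) f(2) g(2)] f(1) g(1)
    by (auto intro: borel_measurable_add)
qed

lemma Lp_norm_add_scaleR_le:
  assumes "1 < q" "f \<in> Lp_space q \<Omega>" "g \<in> Lp_space q \<Omega>"
  shows "Lp_norm q \<Omega> (\<lambda>x. f x + c *\<^sub>R g x) \<le> Lp_norm q \<Omega> f + \<bar>c\<bar> * Lp_norm q \<Omega> g"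
proof -
  note f = Lp_spaceD[OF assms(2)] and g = Lp_spaceD[OF Lp_space_scaleR[OF assms(3), of c]]
  have "Lp_norm q \<Omega> (\<lambda>x. f x + c *\<^sub>R g x) \<le> Lp_norm q \<Omega> f + Lp_norm q \<Omega> (\<lambda>x. c *\<^sub>R g x)"
    unfolding Lp_norm_def by (rule Minkowski_inequality[OF assms(1) f(1) g(1) f(2) g(2)])
  then show ?thesis using assms by (simp only: Lp_norm_scaleR)
qed

text \<open>Weak gradients are chosen by \<open>SOME\<close> and hence known only up to null sets.
  Lebesgue measure is complete, so even measurability passes from one representative to
  another.\<close>

lemma Lp_cong_AE:
  fixes f g :: "real^'n \<Rightarrow> 'b::euclidean_space"
  assumes f: "f \<in> Lp_space q \<Omega>" and \<Omega>: "open \<Omega>" and eq: "AE x in lebesgue_on \<Omega>. f x = g x"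
  shows "g \<in> Lp_space q \<Omega>" "Lp_norm q \<Omega> g = Lp_norm q \<Omega> f"
proof -
  have \<Omega>s: "\<Omega> \<in> sets lebesgue" using \<Omega> by auto
  have "AE x in lebesgue. (if x \<in> \<Omega> then f x else 0) = (if x \<in> \<Omega> then g x else 0)"
    using eq \<Omega>s by (simp add: AE_restrict_space_iff)
  moreover have "(\<lambda>x. if x \<in> \<Omega> then f x else 0) \<in> borel_measurable lebesgue"
    by (rule iffD2[OF borel_measurable_if[OF \<Omega>s] Lp_spaceD(1)[OF f]])
  ultimately have "(\<lambda>x. if x \<in> \<Omega> then g x else 0) \<in> borel_measurable lebesgue"
    by (rule borel_measurable_AE[rotated])
  then have g: "g \<in> borel_measurable (lebesgue_on \<Omega>)"
    by (rule iffD1[OF borel_measurable_if[OF \<Omega>s]])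
  have eq': "AE x in lebesgue_on \<Omega>. norm (g x) powr q = norm (f x) powr q"
    using eq by eventually_elim simp
  have m: "(\<lambda>x. norm (f x) powr q) \<in> borel_measurable (lebesgue_on \<Omega>)" "(\<lambda>x. norm (g x) powr q) \<in> borel_measurable (lebesgue_on \<Omega>)"
    using g Lp_spaceD(1)[OF f] by measurable
  show "g \<in> Lp_space q \<Omega>"
    using Lp_spaceD(2)[OF f] g integrable_cong_AE[OF m(2,1) eq'] by (simp add: Lp_space_def)
  show "Lp_norm q \<Omega> g = Lp_norm q \<Omega> f"
    unfolding Lp_norm_def integral_cong_AE[OF m(2,1) eq'] ..
qed

lemma Lp_norm_tendsto:
  assumes q: "1 < q" and f: "\<And>k::nat. f k \<in> Lp_space q \<Omega>" and g: "g \<in> Lp_space q \<Omega>"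
    and lim: "(\<lambda>k. Lp_norm q \<Omega> (\<lambda>x. g x + (-1) *\<^sub>R f k x)) \<longlonglongrightarrow> 0"
  shows "(\<lambda>k. Lp_norm q \<Omega> (f k)) \<longlonglongrightarrow> Lp_norm q \<Omega> g"
proof -
  let ?d = "\<lambda>k. Lp_norm q \<Omega> (\<lambda>x. g x + (-1) *\<^sub>R f k x)"
  have d: "(\<lambda>x. g x + (-1) *\<^sub>R f k x) \<in> Lp_space q \<Omega>" for k
    using q f g by (intro Lp_space_add_scaleR) auto
  have 1: "Lp_norm q \<Omega> g \<le> Lp_norm q \<Omega> (f k) + ?d k" for k
    using Lp_norm_add_scaleR_le[OF q f[of k] d[of k], of 1] by simp
  have 2: "Lp_norm q \<Omega> (f k) \<le> Lp_norm q \<Omega> g + ?d k" for k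
    using Lp_norm_add_scaleR_le[OF q g d[of k], of "-1"] by simp
  have "\<bar>Lp_norm q \<Omega> (f k) - Lp_norm q \<Omega> g\<bar> \<le> ?d k" for k
    using 1[of k] 2[of k] by linarith
  then have "(\<lambda>k. Lp_norm q \<Omega> (f k) - Lp_norm q \<Omega> g) \<longlonglongrightarrow> 0"
    by (intro Lim_null_comparison[OF _ lim]) (auto intro: always_eventually)
  then show ?thesis by (simp add: LIM_zero_iff)
qed

lemma Lp_convergence_AE_subseq:
  fixes f :: "nat \<Rightarrow> real^'n \<Rightarrow> 'b::euclidean_space"
  assumes q: "0 < q" and f: "\<And>k. f k \<in> Lp_space q \<Omega>"
    and lim: "(\<lambda>k. Lp_norm q \<Omega> (f k)) \<longlonglongrightarrow> 0"
  obtains r :: "nat \<Rightarrow> nat" where "strict_mono r" "AE x in lebesgue_on \<Omega>. (\<lambda>k. f (r k) x) \<longlonglongrightarrow> 0"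
proof -
  have "(\<lambda>k. Lp_norm q \<Omega> (f k) powr q) \<longlonglongrightarrow> 0 powr q"
    using q lim by (intro tendsto_powr') (auto simp: Lp_norm_nonneg)
  then have "(\<lambda>k. \<integral>x. norm (norm (f k x) powr q) \<partial>lebesgue_on \<Omega>) \<longlonglongrightarrow> 0"
    using q by (simp add: Lp_norm_powr)
  from tendsto_L1_AE_subseq[OF Lp_spaceD(2)[OF f] this]
  obtain r where r: "strict_mono r" "AE x in lebesgue_on \<Omega>. (\<lambda>k. norm (f (r k) x) powr q) \<longlonglongrightarrow> 0"
    by blast
  from r(2) have "AE x in lebesgue_on \<Omega>. (\<lambda>k. f (r k) x) \<longlonglongrightarrow> 0"
  proof eventually_elim
    case (elim x)
    have "(\<lambda>k. (norm (f (r k) x) powr q) powr (1 / q)) \<longlonglongrightarrow> 0 powr (1 / q)"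
      using q elim by (intro tendsto_powr') auto
    then have "(\<lambda>k. norm (f (r k) x)) \<longlonglongrightarrow> 0" using q by (simp add: powr_powr)
    then show ?case by (rule tendsto_norm_zero_cancel)
  qed
  with r(1) show ?thesis by (rule that)
qed

lemma continuous_compact_support_Lp:
  fixes f :: "real^'n \<Rightarrow> 'b::euclidean_space"
  assumes f: "continuous_on UNIV f" and K: "compact K" "K \<subseteq> \<Omega>" "\<And>x. x \<notin> K \<Longrightarrow> f x = 0"
    and \<Omega>: "open \<Omega>" and q: "0 < q"
  shows "f \<in> Lp_space q \<Omega>"
    and "(LINT x|lebesgue_on \<Omega>. norm (f x) powr q) = (LINT x|lborel. norm (f x) powr q)"
proof -
  have c: "continuous_on UNIV (\<lambda>x. norm (f x) powr q)"
    using q by (intro continuous_on_powr' continuous_intros f) auto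
  have b: "(\<lambda>x. norm (f x) powr q) \<in> borel_measurable borel"
    by (rule borel_measurable_continuous_onI[OF c])
  have i: "integrable lborel (\<lambda>x. norm (f x) powr q)"
    using K by (intro integrable_continuous_compact_support[OF c K(1)]) auto
  have 0: "norm (f x) powr q = 0" if "x \<notin> \<Omega>" for x
  proof -
    have "x \<notin> K" using that K(2) by blast
    then show ?thesis using K(3) by simp
  qed
  have \<Omega>s: "\<Omega> \<in> sets lebesgue" using \<Omega> by auto
  note * = integral_lebesgue_on_eq_lborel[OF b \<Omega>s 0]
  show "f \<in> Lp_space q \<Omega>"
    unfolding Lp_space_def using i * f by (auto intro: borel_imp_lebesgue_on_measurable borel_measurable_continuous_onI)
  show "(LINT x|lebesgue_on \<Omega>. norm (f x) powr q) = (LINT x|lborel. norm (f x) powr q)"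
    by (rule *(2))
qed

lemma test_function_Lp:
  assumes \<phi>: "\<phi> \<in> test_functions \<Omega>" and \<Omega>: "open \<Omega>" and q: "0 < q"
  shows "\<phi> \<in> Lp_space q \<Omega>" "grad \<phi> \<in> Lp_space q \<Omega>"
    "(LINT x|lebesgue_on \<Omega>. norm (\<phi> x) powr q) = (LINT x|lborel. norm (\<phi> x) powr q)"
    "(LINT x|lebesgue_on \<Omega>. norm (grad \<phi> x) powr q) = (LINT x|lborel. norm (grad \<phi> x) powr q)"
proof -
  obtain K where K: "smooth_on UNIV \<phi>" "compact K" "K \<subseteq> \<Omega>" "\<And>x. x \<notin> K \<Longrightarrow> \<phi> x = 0"
     "\<And>x. x \<notin> K \<Longrightarrow> grad \<phi> x = 0"
    using \<phi> by (rule test_functionsE) blast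
  note 1 = continuous_compact_support_Lp[OF smooth_on_continuous[OF K(1)] K(2-4) \<Omega> q]
  note 2 = continuous_compact_support_Lp[OF smooth_continuous_gradient[OF K(1)] K(2,3,5) \<Omega> q]
  show "\<phi> \<in> Lp_space q \<Omega>" by (rule 1(1))
  show "grad \<phi> \<in> Lp_space q \<Omega>" by (rule 2(1))
  show "(LINT x|lebesgue_on \<Omega>. norm (\<phi> x) powr q) = (LINT x|lborel. norm (\<phi> x) powr q)" by (rule 1(2))
  show "(LINT x|lebesgue_on \<Omega>. norm (grad \<phi> x) powr q) = (LINT x|lborel. norm (grad \<phi> x) powr q)" by (rule 2(2))
qed

section \<open>First-order Sobolev spaces\<close>

lemma weak_gradient_eqI:
  assumes \<Omega>: "open \<Omega>" and G: "has_weak_gradient \<Omega> u G"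
  shows "AE x in lebesgue_on \<Omega>. G x = weak_gradient \<Omega> u x"
    and "has_weak_gradient \<Omega> u (weak_gradient \<Omega> u)"
proof -
  show h: "has_weak_gradient \<Omega> u (weak_gradient \<Omega> u)"
    unfolding weak_gradient_def by (rule someI[of "has_weak_gradient \<Omega> u", OF G])
  show "AE x in lebesgue_on \<Omega>. G x = weak_gradient \<Omega> u x"
    by (rule has_weak_gradient_unique[OF \<Omega> G h])
qed

lemma W1pD:
  assumes \<Omega>: "open \<Omega>" and u: "u \<in> W1p p \<Omega>"
  shows "u \<in> Lp_space p \<Omega>" "has_weak_gradient \<Omega> u (weak_gradient \<Omega> u)" "weak_gradient \<Omega> u \<in> Lp_space p \<Omega>"
proof -
  obtain G where G: "G \<in> Lp_space p \<Omega>" "has_weak_gradient \<Omega> u G" using u by (auto simp: W1p_def)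
  show "u \<in> Lp_space p \<Omega>" using u by (simp add: W1p_def)
  show "has_weak_gradient \<Omega> u (weak_gradient \<Omega> u)" by (rule weak_gradient_eqI(2)[OF \<Omega> G(2)])
  show "weak_gradient \<Omega> u \<in> Lp_space p \<Omega>"
    by (rule Lp_cong_AE(1)[OF G(1) \<Omega> weak_gradient_eqI(1)[OF \<Omega> G(2)]])
qed

lemma W1p_add_cmult:
  assumes \<Omega>: "open \<Omega>" and p: "0 < p" and u: "u \<in> W1p p \<Omega>" and v: "v \<in> W1p p \<Omega>"
  shows "(\<lambda>x. u x + c * v x) \<in> W1p p \<Omega>"
    and "AE x in lebesgue_on \<Omega>. weak_gradient \<Omega> u x + c *\<^sub>R weak_gradient \<Omega> v x = weak_gradient \<Omega> (\<lambda>x. u x + c * v x) x"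
proof -
  note u = W1pD[OF \<Omega> u] and v = W1pD[OF \<Omega> v]
  note h = has_weak_gradient_add_cmult[OF \<Omega> u(2) v(2), of c]
  show "(\<lambda>x. u x + c * v x) \<in> W1p p \<Omega>"
    unfolding W1p_def using Lp_space_add_scaleR[OF p u(1) v(1), of c] Lp_space_add_scaleR[OF p u(3) v(3), of c] h by auto
  show "AE x in lebesgue_on \<Omega>. weak_gradient \<Omega> u x + c *\<^sub>R weak_gradient \<Omega> v x = weak_gradient \<Omega> (\<lambda>x. u x + c * v x) x"
    by (rule weak_gradient_eqI(1)[OF \<Omega> h])
qed

lemma W1p0_norm_add_cmult_eq:
  assumes \<Omega>: "open \<Omega>" and p: "0 < p" and u: "u \<in> W1p p \<Omega>" and v: "v \<in> W1p p \<Omega>"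
  shows "W1p0_norm p \<Omega> (\<lambda>x. u x + c * v x) = Lp_norm p \<Omega> (\<lambda>x. weak_gradient \<Omega> u x + c *\<^sub>R weak_gradient \<Omega> v x)"
  unfolding W1p0_norm_def
  by (rule Lp_cong_AE(2)[OF Lp_space_add_scaleR[OF p W1pD(3)[OF \<Omega> u] W1pD(3)[OF \<Omega> v]] \<Omega> W1p_add_cmult(2)[OF \<Omega> p u v]])

lemma W1p0_norm_add_cmult_le:
  assumes \<Omega>: "open \<Omega>" and p: "1 < p" and u: "u \<in> W1p p \<Omega>" and v: "v \<in> W1p p \<Omega>"
  shows "W1p0_norm p \<Omega> (\<lambda>x. u x + c * v x) \<le> W1p0_norm p \<Omega> u + \<bar>c\<bar> * W1p0_norm p \<Omega> v"
proof -
  have "0 < p" using p by simp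
  then show ?thesis
    unfolding W1p0_norm_add_cmult_eq[OF \<Omega> \<open>0 < p\<close> u v] unfolding W1p0_norm_def
    by (intro Lp_norm_add_scaleR_le p W1pD(3) \<Omega> u v)
qed

lemma test_function_W1p:
  assumes \<Omega>: "open \<Omega>" and p: "0 < p" and \<phi>: "\<phi> \<in> test_functions \<Omega>"
  shows "\<phi> \<in> W1p p \<Omega>"
    and "AE x in lebesgue_on \<Omega>. grad \<phi> x = weak_gradient \<Omega> \<phi> x"
    and "W1p0_norm p \<Omega> \<phi> = Lp_norm p \<Omega> (grad \<phi>)"
proof -
  note h = test_function_has_weak_gradient[OF \<Omega> \<phi>] and L = test_function_Lp[OF \<phi> \<Omega> p]
  show "\<phi> \<in> W1p p \<Omega>" unfolding W1p_def using h L by auto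
  show *: "AE x in lebesgue_on \<Omega>. grad \<phi> x = weak_gradient \<Omega> \<phi> x"
    by (rule weak_gradient_eqI(1)[OF \<Omega> h])
  show "W1p0_norm p \<Omega> \<phi> = Lp_norm p \<Omega> (grad \<phi>)"
    unfolding W1p0_norm_def by (rule Lp_cong_AE(2)[OF L(2) \<Omega> *])
qed

lemma W1p0_norm_nonneg: "0 \<le> W1p0_norm p \<Omega> u"
  by (simp add: W1p0_norm_def Lp_norm_nonneg)

text \<open>Convergence to 0 in the full Sobolev norm is equivalent to that of its two parts, each
  of which is dominated by the whole. The triangle inequality is then needed only for the
  parts.\<close>

lemma W1p0_iff:
  assumes \<Omega>: "open \<Omega>" and p: "1 < p"
  shows "u \<in> W1p0 p \<Omega> \<longleftrightarrow> u \<in> W1p p \<Omega> \<and> (\<exists>\<phi>. (\<forall>k::nat. \<phi> k \<in> test_functions \<Omega>) \<and>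
    (\<lambda>k. Lp_norm p \<Omega> (\<lambda>x. u x + (-1) * \<phi> k x)) \<longlonglongrightarrow> 0 \<and>
    (\<lambda>k. W1p0_norm p \<Omega> (\<lambda>x. u x + (-1) * \<phi> k x)) \<longlonglongrightarrow> 0)"
proof -
  have "(\<lambda>k. W1p_norm p \<Omega> (\<lambda>x. u x - \<phi> k x)) \<longlonglongrightarrow> 0 \<longleftrightarrow>
    (\<lambda>k. Lp_norm p \<Omega> (\<lambda>x. u x + (-1) * \<phi> k x)) \<longlonglongrightarrow> 0 \<and>
    (\<lambda>k. W1p0_norm p \<Omega> (\<lambda>x. u x + (-1) * \<phi> k x)) \<longlonglongrightarrow> 0" for \<phi> :: "nat \<Rightarrow> _"
  proof -
    define a where "a k = Lp_norm p \<Omega> (\<lambda>x. u x + (-1) * \<phi> k x)" for k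
    define b where "b k = W1p0_norm p \<Omega> (\<lambda>x. u x + (-1) * \<phi> k x)" for k
    have n: "W1p_norm p \<Omega> (\<lambda>x. u x - \<phi> k x) = (a k powr p + b k powr p) powr (1 / p)" for k
      by (simp add: W1p_norm_def a_def b_def W1p0_norm_def)
    have ab: "0 \<le> a k" "0 \<le> b k" for k
      by (simp_all add: a_def b_def W1p0_norm_def Lp_norm_nonneg)
    have le: "a k \<le> (a k powr p + b k powr p) powr (1 / p)" "b k \<le> (a k powr p + b k powr p) powr (1 / p)" for k
    proof -
      have "a k = (a k powr p) powr (1 / p)" "b k = (b k powr p) powr (1 / p)" 
        using ab p by (simp_all add: powr_powr)
      moreover have "(a k powr p) powr (1 / p) \<le> (a k powr p + b k powr p) powr (1 / p)"
        "(b k powr p) powr (1 / p) \<le> (a k powr p + b k powr p) powr (1 / p)"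
        using p by (intro powr_mono2; simp)+
      ultimately show "a k \<le> (a k powr p + b k powr p) powr (1 / p)" "b k \<le> (a k powr p + b k powr p) powr (1 / p)"
        by simp_all
    qed
    have "a \<longlonglongrightarrow> 0 \<and> b \<longlonglongrightarrow> 0" if "(\<lambda>k. (a k powr p + b k powr p) powr (1 / p)) \<longlonglongrightarrow> 0"
      using tendsto_sandwich[OF _ _ tendsto_const that, of a] tendsto_sandwich[OF _ _ tendsto_const that, of b] ab le
      by (auto simp: always_eventually)
    moreover have "(\<lambda>k. (a k powr p + b k powr p) powr (1 / p)) \<longlonglongrightarrow> 0" if "a \<longlonglongrightarrow> 0" "b \<longlonglongrightarrow> 0"
    proof -
      have "(\<lambda>k. (a k powr p + b k powr p) powr (1 / p)) \<longlonglongrightarrow> (0 powr p + 0 powr p) powr (1 / p)"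
        using that ab p by (intro tendsto_powr' tendsto_add tendsto_const) auto
      then show ?thesis by simp
    qed
    ultimately show ?thesis unfolding n a_def[symmetric] b_def[symmetric] by blast
  qed
  then show ?thesis by (auto simp: W1p0_def)
qed

lemma W1p0_imp_W1p: "u \<in> W1p0 p \<Omega> \<Longrightarrow> u \<in> W1p p \<Omega>"
  by (simp add: W1p0_def)

lemma W1p0_approx:
  assumes \<Omega>: "open \<Omega>" and p: "1 < p" and u: "u \<in> W1p0 p \<Omega>"
  obtains \<phi> :: "nat \<Rightarrow> _" where "\<And>k. \<phi> k \<in> test_functions \<Omega>"
    "(\<lambda>k. Lp_norm p \<Omega> (\<lambda>x. u x + (-1) * \<phi> k x)) \<longlonglongrightarrow> 0"
    "(\<lambda>k. W1p0_norm p \<Omega> (\<lambda>x. u x + (-1) * \<phi> k x)) \<longlonglongrightarrow> 0"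
  using u W1p0_iff[OF \<Omega> p, of u] by blast

lemma W1p0_add_cmult:
  assumes \<Omega>: "open \<Omega>" and p: "1 < p" and u: "u \<in> W1p0 p \<Omega>" and v: "v \<in> W1p0 p \<Omega>"
  shows "(\<lambda>x. u x + c * v x) \<in> W1p0 p \<Omega>"
proof -
  have p0: "0 < p" using p by simp
  note W = W1p0_imp_W1p[OF u] W1p0_imp_W1p[OF v]
  obtain \<phi> where \<phi>: "\<And>k::nat. \<phi> k \<in> test_functions \<Omega>"
    "(\<lambda>k. Lp_norm p \<Omega> (\<lambda>x. u x + (-1) * \<phi> k x)) \<longlonglongrightarrow> 0"
    "(\<lambda>k. W1p0_norm p \<Omega> (\<lambda>x. u x + (-1) * \<phi> k x)) \<longlonglongrightarrow> 0"
    using W1p0_approx[OF \<Omega> p u] by blast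
  obtain \<psi> where \<psi>: "\<And>k::nat. \<psi> k \<in> test_functions \<Omega>"
    "(\<lambda>k. Lp_norm p \<Omega> (\<lambda>x. v x + (-1) * \<psi> k x)) \<longlonglongrightarrow> 0"
    "(\<lambda>k. W1p0_norm p \<Omega> (\<lambda>x. v x + (-1) * \<psi> k x)) \<longlonglongrightarrow> 0"
    using W1p0_approx[OF \<Omega> p v] by blast
  have eq: "(\<lambda>x. (u x + c * v x) + (-1) * (\<phi> k x + c * \<psi> k x)) = (\<lambda>x. (u x + (-1) * \<phi> k x) + c * (v x + (-1) * \<psi> k x))" for k
    by (simp add: algebra_simps)
  have d: "(\<lambda>x. u x + (-1) * \<phi> k x) \<in> W1p p \<Omega>" "(\<lambda>x. v x + (-1) * \<psi> k x) \<in> W1p p \<Omega>" for k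
    by (intro W1p_add_cmult \<Omega> p0 W test_function_W1p \<phi> \<psi>)+
  have "(\<lambda>k. Lp_norm p \<Omega> (\<lambda>x. (u x + c * v x) + (-1) * (\<phi> k x + c * \<psi> k x))) \<longlonglongrightarrow> 0"
  proof (rule tendsto_sandwich[OF _ _ tendsto_const])
    show "(\<lambda>k. Lp_norm p \<Omega> (\<lambda>x. u x + (-1) * \<phi> k x) + \<bar>c\<bar> * Lp_norm p \<Omega> (\<lambda>x. v x + (-1) * \<psi> k x)) \<longlonglongrightarrow> 0"
      using tendsto_add[OF \<phi>(2) tendsto_mult[OF tendsto_const \<psi>(2)], of "\<bar>c\<bar>"] by simp
    show "\<forall>\<^sub>F k in sequentially. Lp_norm p \<Omega> (\<lambda>x. (u x + c * v x) + (-1) * (\<phi> k x + c * \<psi> k x)) \<le>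
      Lp_norm p \<Omega> (\<lambda>x. u x + (-1) * \<phi> k x) + \<bar>c\<bar> * Lp_norm p \<Omega> (\<lambda>x. v x + (-1) * \<psi> k x)"
      unfolding eq using Lp_norm_add_scaleR_le[OF p W1pD(1)[OF \<Omega> d(1)] W1pD(1)[OF \<Omega> d(2)], of _ c]
      by (intro always_eventually) simp
  qed (simp add: Lp_norm_nonneg)
  moreover have "(\<lambda>k. W1p0_norm p \<Omega> (\<lambda>x. (u x + c * v x) + (-1) * (\<phi> k x + c * \<psi> k x))) \<longlonglongrightarrow> 0"
  proof (rule tendsto_sandwich[OF _ _ tendsto_const])
    show "(\<lambda>k. W1p0_norm p \<Omega> (\<lambda>x. u x + (-1) * \<phi> k x) + \<bar>c\<bar> * W1p0_norm p \<Omega> (\<lambda>x. v x + (-1) * \<psi> k x)) \<longlonglongrightarrow> 0"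
      using tendsto_add[OF \<phi>(3) tendsto_mult[OF tendsto_const \<psi>(3)], of "\<bar>c\<bar>"] by simp
    show "\<forall>\<^sub>F k in sequentially. W1p0_norm p \<Omega> (\<lambda>x. (u x + c * v x) + (-1) * (\<phi> k x + c * \<psi> k x)) \<le>
      W1p0_norm p \<Omega> (\<lambda>x. u x + (-1) * \<phi> k x) + \<bar>c\<bar> * W1p0_norm p \<Omega> (\<lambda>x. v x + (-1) * \<psi> k x)"
      unfolding eq by (intro always_eventually allI W1p0_norm_add_cmult_le \<Omega> p d)
  qed (simp add: W1p0_norm_nonneg)
  moreover have "(\<lambda>x. \<phi> k x + c * \<psi> k x) \<in> test_functions \<Omega>" for k
    by (intro test_functions_add_cmult \<phi> \<psi>)
  ultimately show ?thesis
    unfolding W1p0_iff[OF \<Omega> p] using W1p_add_cmult(1)[OF \<Omega> p0 W]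
    by (intro conjI exI[of _ "\<lambda>k x. \<phi> k x + c * \<psi> k x"]) auto
qed

lemma W1p0_norm_zero:
  fixes \<Omega> :: "(real^'n) set"
  assumes "open \<Omega>" "0 < p"
  shows "W1p0_norm p \<Omega> (\<lambda>x. 0) = 0"
proof -
  have "grad (\<lambda>x. 0) = (\<lambda>x. 0 :: real^'n)"
    by (intro ext grad_eqI) simp
  then show ?thesis
    using test_function_W1p(3)[OF assms test_functions_zero] assms by (simp add: Lp_norm_def)
qed

lemma test_function_W1p0:
  assumes \<Omega>: "open \<Omega>" and p: "1 < p" and \<phi>: "\<phi> \<in> test_functions \<Omega>"
  shows "\<phi> \<in> W1p0 p \<Omega>"
  unfolding W1p0_iff[OF \<Omega> p]
proof (intro conjI exI[of _ "\<lambda>_. \<phi>"] allI)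
  show "\<phi> \<in> W1p p \<Omega>" using test_function_W1p(1)[OF \<Omega> _ \<phi>] p by simp
  show "(\<lambda>k. Lp_norm p \<Omega> (\<lambda>x. \<phi> x + (-1) * \<phi> x)) \<longlonglongrightarrow> 0"
    using p by (simp add: Lp_norm_def)
  show "(\<lambda>k. W1p0_norm p \<Omega> (\<lambda>x. \<phi> x + (-1) * \<phi> x)) \<longlonglongrightarrow> 0"
    using p W1p0_norm_zero[OF \<Omega>, of p] by simp
qed (fact \<phi>)

lemma W1p0_norm_tendsto:
  assumes \<Omega>: "open \<Omega>" and p: "1 < p" and u: "u \<in> W1p p \<Omega>" and \<phi>: "\<And>k::nat. \<phi> k \<in> W1p p \<Omega>"
    and lim: "(\<lambda>k. W1p0_norm p \<Omega> (\<lambda>x. u x + (-1) * \<phi> k x)) \<longlonglongrightarrow> 0"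
  shows "(\<lambda>k. W1p0_norm p \<Omega> (\<phi> k)) \<longlonglongrightarrow> W1p0_norm p \<Omega> u"
proof -
  have "0 < p" using p by simp
  note lim' = lim[unfolded W1p0_norm_add_cmult_eq[OF \<Omega> this u \<phi>]]
  show ?thesis
    unfolding W1p0_norm_def by (rule Lp_norm_tendsto[OF p W1pD(3)[OF \<Omega> \<phi>] W1pD(3)[OF \<Omega> u] lim'])
qed

text \<open>The inequality for test functions passes to the closure by Fatou's lemma along an almost
  everywhere convergent subsequence. The limit is estimated with nonnegative integrals first,
  because \<open>Lp_norm\<close> is 0 for functions that are not integrable to the given power and
  so says nothing about membership.\<close>

lemma W1p0_Sobolev:
  fixes \<Omega> :: "(real^'n) set"
  assumes \<Omega>: "open \<Omega>" and p: "1 < p" "p < real CARD('n)" and q: "q = critical_exponent CARD('n) p"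
  obtains C where "0 \<le> C" "\<And>u. u \<in> W1p0 p \<Omega> \<Longrightarrow> u \<in> Lp_space q \<Omega> \<and> Lp_norm q \<Omega> u \<le> C * W1p0_norm p \<Omega> u"
proof -
  let ?M = "lebesgue_on \<Omega>"
  have q1: "q > 1" using critical_exponent_gt(2)[OF p] q by simp
  have q0: "0 < q" and p0: "0 < p" using q1 p by auto
  obtain C :: real where C: "0 \<le> C"
    "\<And>(f :: real^'n \<Rightarrow> real) G K. \<lbrakk>\<And>x. (f has_derivative (\<lambda>h. G x \<bullet> h)) (at x); continuous_on UNIV G;
       compact K; \<And>x. x \<notin> K \<Longrightarrow> f x = 0\<rbrakk>
       \<Longrightarrow> (LINT x|lborel. \<bar>f x\<bar> powr q) \<le> C * (LINT x|lborel. norm (G x) powr p) powr (q / p)"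
    using Sobolev_inequality[where 'a = "real^'n", of p q] p q by (auto simp: critical_exponent_def)
  define D where "D = C powr (1 / q)"
  have D0: "0 \<le> D" by (simp add: D_def)
  have test: "Lp_norm q \<Omega> \<phi> \<le> D * W1p0_norm p \<Omega> \<phi>" if \<phi>: "\<phi> \<in> test_functions \<Omega>" for \<phi>
  proof -
    obtain K where K: "smooth_on UNIV \<phi>" "compact K" "K \<subseteq> \<Omega>" "\<And>x. x \<notin> K \<Longrightarrow> \<phi> x = 0"
      using \<phi> by (rule test_functionsE) blast
    have "(LINT x|lborel. \<bar>\<phi> x\<bar> powr q) \<le> C * (LINT x|lborel. norm (grad \<phi> x) powr p) powr (q / p)"
      by (rule C(2)[OF test_functions_has_gradient[OF \<phi>] smooth_continuous_gradient[OF K(1)] K(2,4)])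
    then have "Lp_norm q \<Omega> \<phi> powr q \<le> C * (W1p0_norm p \<Omega> \<phi> powr p) powr (q / p)"
      using q0 p0 by (simp add: Lp_norm_powr test_function_W1p[OF \<Omega> p0 \<phi>] test_function_Lp[OF \<phi> \<Omega>, unfolded real_norm_def])
    then have "(Lp_norm q \<Omega> \<phi> powr q) powr (1 / q) \<le> (C * W1p0_norm p \<Omega> \<phi> powr q) powr (1 / q)"
      using q0 p0 by (intro powr_mono2) (auto simp: powr_powr)
    then show ?thesis
      using q0 C(1) Lp_norm_nonneg[of q \<Omega> \<phi>] W1p0_norm_nonneg[of p \<Omega> \<phi>] by (simp add: powr_powr powr_mult D_def)
  qed
  show ?thesis
  proof (rule that[OF D0])
    fix u assume u: "u \<in> W1p0 p \<Omega>"
    obtain \<phi> where \<phi>: "\<And>k::nat. \<phi> k \<in> test_functions \<Omega>"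
      "(\<lambda>k. Lp_norm p \<Omega> (\<lambda>x. u x + (-1) * \<phi> k x)) \<longlonglongrightarrow> 0"
      "(\<lambda>k. W1p0_norm p \<Omega> (\<lambda>x. u x + (-1) * \<phi> k x)) \<longlonglongrightarrow> 0"
      using W1p0_approx[OF \<Omega> p(1) u] by blast
    have uL: "u \<in> Lp_space p \<Omega>" using W1pD(1)[OF \<Omega> W1p0_imp_W1p[OF u]] .
    have d: "(\<lambda>x. u x + (-1) * \<phi> k x) \<in> Lp_space p \<Omega>" for k
      using Lp_space_add_scaleR[OF p0 uL test_function_Lp(1)[OF \<phi>(1) \<Omega> p0], of "-1"] by simp
    obtain r :: "nat \<Rightarrow> nat" where r: "strict_mono r" "AE x in ?M. (\<lambda>k. u x + (-1) * \<phi> (r k) x) \<longlonglongrightarrow> 0"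
      using Lp_convergence_AE_subseq[OF p0 d \<phi>(2)] by blast
    have lim: "AE x in ?M. (\<lambda>k. \<phi> (r k) x) \<longlonglongrightarrow> u x"
      using r(2)
    proof eventually_elim
      case (elim x)
      show ?case using tendsto_diff[OF tendsto_const elim, of "u x"] by simp
    qed
    have nlim: "(\<lambda>k. W1p0_norm p \<Omega> (\<phi> (r k))) \<longlonglongrightarrow> W1p0_norm p \<Omega> u"
      using LIMSEQ_subseq_LIMSEQ[OF W1p0_norm_tendsto[OF \<Omega> p(1) W1p0_imp_W1p[OF u] test_function_W1p(1)[OF \<Omega> p0 \<phi>(1)] \<phi>(3)] r(1)]
      by (simp add: o_def)
    note um = Lp_spaceD(1)[OF uL]
    note \<phi>m = Lp_spaceD(1)[OF test_function_Lp(1)[OF \<phi>(1) \<Omega> q0]]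
    define N where "N = D * W1p0_norm p \<Omega> u"
    have N0: "0 \<le> N" by (simp add: N_def D0 W1p0_norm_nonneg)
    have "(\<integral>\<^sup>+x. ennreal (\<bar>u x\<bar> powr q) \<partial>?M) = (\<integral>\<^sup>+x. liminf (\<lambda>k. ennreal (\<bar>\<phi> (r k) x\<bar> powr q)) \<partial>?M)"
      using lim
    proof (intro nn_integral_cong_AE, eventually_elim)
      case (elim x)
      have "(\<lambda>k. ennreal (\<bar>\<phi> (r k) x\<bar> powr q)) \<longlonglongrightarrow> ennreal (\<bar>u x\<bar> powr q)"
        using q0 elim by (intro tendsto_ennrealI tendsto_powr' tendsto_rabs tendsto_const) auto
      then show ?case by (rule lim_imp_Liminf[symmetric, OF trivial_limit_sequentially])
    qed
    also have "\<dots> \<le> liminf (\<lambda>k. \<integral>\<^sup>+x. ennreal (\<bar>\<phi> (r k) x\<bar> powr q) \<partial>?M)"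
      using \<phi>m by (intro nn_integral_liminf) measurable
    also have "\<dots> \<le> liminf (\<lambda>k. ennreal ((D * W1p0_norm p \<Omega> (\<phi> (r k))) powr q))"
    proof (intro Liminf_mono always_eventually allI)
      fix k
      have "(\<integral>\<^sup>+x. ennreal (\<bar>\<phi> (r k) x\<bar> powr q) \<partial>?M) = ennreal (Lp_norm q \<Omega> (\<phi> (r k)) powr q)"
        using Lp_spaceD(2)[OF test_function_Lp(1)[OF \<phi>(1) \<Omega> q0], of "r k"] q0
        by (subst nn_integral_eq_integral) (auto simp: Lp_norm_powr)
      also have "\<dots> \<le> ennreal ((D * W1p0_norm p \<Omega> (\<phi> (r k))) powr q)"
        using q0 test[OF \<phi>(1)] by (intro ennreal_leI powr_mono2) (auto simp: Lp_norm_nonneg)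
      finally show "(\<integral>\<^sup>+x. ennreal (\<bar>\<phi> (r k) x\<bar> powr q) \<partial>?M) \<le> ennreal ((D * W1p0_norm p \<Omega> (\<phi> (r k))) powr q)" .
    qed
    also have "\<dots> = ennreal (N powr q)"
    proof (rule lim_imp_Liminf)
      show "(\<lambda>k. ennreal ((D * W1p0_norm p \<Omega> (\<phi> (r k))) powr q)) \<longlonglongrightarrow> ennreal (N powr q)"
        unfolding N_def using q0 nlim D0
        by (intro tendsto_ennrealI tendsto_powr' tendsto_mult tendsto_const) (auto simp: W1p0_norm_nonneg)
    qed simp
    finally have le: "(\<integral>\<^sup>+x. ennreal (\<bar>u x\<bar> powr q) \<partial>?M) \<le> ennreal (N powr q)" .
    have int: "integrable (?M) (\<lambda>x. \<bar>u x\<bar> powr q)"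
    proof (rule integrableI_bounded)
      show "(\<lambda>x. \<bar>u x\<bar> powr q) \<in> borel_measurable (?M)" using um by measurable
      show "(\<integral>\<^sup>+x. ennreal (norm (\<bar>u x\<bar> powr q)) \<partial>?M) < \<infinity>"
        using le by (simp add: le_less_trans[OF _ ennreal_less_top])
    qed
    have "Lp_norm q \<Omega> u powr q \<le> N powr q"
      using le q0 by (subst (asm) nn_integral_eq_integral[OF int]) (auto simp: Lp_norm_powr)
    then have "(Lp_norm q \<Omega> u powr q) powr (1 / q) \<le> (N powr q) powr (1 / q)"
      using q0 by (intro powr_mono2[OF _ _ \<open>Lp_norm q \<Omega> u powr q \<le> N powr q\<close>]) auto
    then have "Lp_norm q \<Omega> u \<le> N"
      using q0 N0 Lp_norm_nonneg[of q \<Omega> u] by (simp add: powr_powr)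
    with int um show "u \<in> Lp_space q \<Omega> \<and> Lp_norm q \<Omega> u \<le> D * W1p0_norm p \<Omega> u"
      by (simp add: Lp_space_def N_def)
  qed
qed

text \<open>If every test function vanished almost everywhere, the constant 1 would integrate to 0
  against all of them and so be 0 almost everywhere on \<open>\<Omega>\<close>, although nonempty
  open sets are not null. A test function with positive norm is what bounds the admissible Sobolev
  constants from above.\<close>

lemma exists_test_function_Lp_norm_pos:
  fixes \<Omega> :: "(real^'n) set"
  assumes \<Omega>: "open \<Omega>" "\<Omega> \<noteq> {}" and q: "0 < q"
  obtains \<phi> where "\<phi> \<in> test_functions \<Omega>" "0 < Lp_norm q \<Omega> \<phi>"
proof (rule ccontr)
  assume "\<not> thesis"
  with that have no: "\<not> 0 < Lp_norm q \<Omega> \<phi>" if "\<phi> \<in> test_functions \<Omega>" for \<phi> using that by blast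
  have \<Omega>s: "\<Omega> \<in> sets lebesgue" using \<Omega> by auto
  have "AE x in lebesgue_on \<Omega>. (1::real) = 0"
  proof (rule AE_eq_0_if_integral_test_functions_0[OF locally_integrable_continuous \<Omega>(1)])
    fix \<phi> :: "real^'n \<Rightarrow> real" assume \<phi>: "\<phi> \<in> test_functions \<Omega>"
    note L = Lp_spaceD[OF test_function_Lp(1)[OF \<phi> \<Omega>(1) q]]
    have "Lp_norm q \<Omega> \<phi> powr q = 0" using no[OF \<phi>] Lp_norm_nonneg[of q \<Omega> \<phi>] by simp
    then have "AE x in lebesgue_on \<Omega>. norm (\<phi> x) powr q = 0"
      using q L by (subst integral_nonneg_eq_0_iff_AE[symmetric]) (auto simp: Lp_norm_powr)
    then have "AE x in lebesgue_on \<Omega>. 1 * \<phi> x = 0" by eventually_elim simp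
    then show "(LINT x|lebesgue_on \<Omega>. 1 * \<phi> x) = 0" by (rule integral_eq_zero_AE)
  qed simp
  then have "AE x in lebesgue. x \<notin> \<Omega>" using \<Omega>s by (simp add: AE_restrict_space_iff)
  then have "\<Omega> \<in> null_sets lebesgue" using \<Omega>s by (simp add: AE_iff_null_sets)
  then show False using open_not_negligible[OF \<Omega>] by (simp add: negligible_iff_null_sets)
qed

text \<open>For \<open>GREATEST\<close> to denote anything, the supremum of the admissible constants
  has to be attained: one constant is admissible by the Sobolev inequality, a nonzero test function
  bounds them all, and the defining inequality, once solved for \<open>S\<close>, survives the
  supremum.\<close>

lemma sobolev_constant_properties:
  fixes \<Omega> :: "(real^'n) set"
  assumes \<Omega>: "open \<Omega>" "\<Omega> \<noteq> {}" and p: "1 < p" "p < real CARD('n)" and q: "q = critical_exponent CARD('n) p"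
  shows "0 < sobolev_constant p \<Omega>"
    and "u \<in> W1p0 p \<Omega> \<Longrightarrow> u \<in> Lp_space q \<Omega>"
    and "u \<in> W1p0 p \<Omega> \<Longrightarrow> Lp_norm q \<Omega> u powr p \<le> inverse (sobolev_constant p \<Omega>) * W1p0_norm p \<Omega> u powr p"
proof -
  define P where "P S \<longleftrightarrow> 0 < S \<and> (\<forall>u\<in>W1p0 p \<Omega>. u \<in> Lp_space q \<Omega> \<and> Lp_norm q \<Omega> u powr p \<le> inverse S * W1p0_norm p \<Omega> u powr p)" for S
  have sc: "sobolev_constant p \<Omega> = (GREATEST S. P S)"
    by (simp add: sobolev_constant_def P_def q Let_def)
  have p0: "0 < p" using p by simp
  have q0: "q > 0" using critical_exponent_gt(2)[OF p] q by simp
  obtain C where C: "0 \<le> C" "\<And>u. u \<in> W1p0 p \<Omega> \<Longrightarrow> u \<in> Lp_space q \<Omega> \<and> Lp_norm q \<Omega> u \<le> C * W1p0_norm p \<Omega> u"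
    using W1p0_Sobolev[OF \<Omega>(1) p q] by blast
  \<comment> \<open>The summand 1 keeps the constant positive should \<open>C\<close> be 0, as
    \<open>inverse 0 = 0\<close>.\<close>
  have P1: "P (inverse (C powr p + 1))"
    unfolding P_def
  proof (intro conjI ballI)
    show "0 < inverse (C powr p + 1)" by (simp add: add_nonneg_pos)
    fix u assume u: "u \<in> W1p0 p \<Omega>"
    show "u \<in> Lp_space q \<Omega>" using C u by blast
    have "Lp_norm q \<Omega> u powr p \<le> (C * W1p0_norm p \<Omega> u) powr p"
      using C u p0 by (intro powr_mono2) (auto simp: Lp_norm_nonneg)
    also have "\<dots> \<le> (C powr p + 1) * W1p0_norm p \<Omega> u powr p"
      by (simp add: powr_mult distrib_right)
    finally show "Lp_norm q \<Omega> u powr p \<le> inverse (inverse (C powr p + 1)) * W1p0_norm p \<Omega> u powr p" by simp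
  qed
  obtain \<phi> where \<phi>: "\<phi> \<in> test_functions \<Omega>" "0 < Lp_norm q \<Omega> \<phi>"
    using exists_test_function_Lp_norm_pos[OF \<Omega> q0] by blast
  have mult: "S * Lp_norm q \<Omega> u powr p \<le> W1p0_norm p \<Omega> u powr p" if "P S" "u \<in> W1p0 p \<Omega>" for S u
    using that by (auto simp: P_def field_simps)
  have bdd: "bdd_above (Collect P)"
  proof (rule bdd_aboveI)
    fix S assume "S \<in> Collect P"
    then have "S * Lp_norm q \<Omega> \<phi> powr p \<le> W1p0_norm p \<Omega> \<phi> powr p"
      using mult test_function_W1p0[OF \<Omega>(1) p(1) \<phi>(1)] by blast
    then show "S \<le> W1p0_norm p \<Omega> \<phi> powr p / Lp_norm q \<Omega> \<phi> powr p" using \<phi>(2) by (simp add: le_divide_eq)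
  qed
  define T where "T = Sup (Collect P)"
  have up: "S \<le> T" if "P S" for S unfolding T_def using that bdd by (intro cSup_upper) auto
  have T0: "0 < T" by (rule less_le_trans[OF conjunct1[OF P1[unfolded P_def]] up[OF P1]])
  have PT: "P T"
    unfolding P_def
  proof (intro conjI ballI T0)
    fix u assume u: "u \<in> W1p0 p \<Omega>"
    show "u \<in> Lp_space q \<Omega>" using C u by blast
    show "Lp_norm q \<Omega> u powr p \<le> inverse T * W1p0_norm p \<Omega> u powr p"
    proof (cases "Lp_norm q \<Omega> u = 0")
      case False
      then have pos: "0 < Lp_norm q \<Omega> u powr p" by simp
      have "T \<le> W1p0_norm p \<Omega> u powr p / Lp_norm q \<Omega> u powr p"
        unfolding T_def using P1 mult u pos by (intro cSup_least) (auto simp: le_divide_eq)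
      then show ?thesis using pos T0 by (simp add: field_simps)
    qed (use T0 in simp)
  qed
  have "sobolev_constant p \<Omega> = T" unfolding sc using PT up by (rule Greatest_equality)
  with PT show "0 < sobolev_constant p \<Omega>" "u \<in> W1p0 p \<Omega> \<Longrightarrow> u \<in> Lp_space q \<Omega>"
    "u \<in> W1p0 p \<Omega> \<Longrightarrow> Lp_norm q \<Omega> u powr p \<le> inverse (sobolev_constant p \<Omega>) * W1p0_norm p \<Omega> u powr p"
    by (auto simp: P_def)
qed

lemma finite_measure_lebesgue_on:
  fixes \<Omega> :: "(real^'n) set"
  assumes "bounded \<Omega>" "open \<Omega>"
  shows "finite_measure (lebesgue_on \<Omega>)"
proof
  have "emeasure (lebesgue_on \<Omega>) \<Omega> = emeasure lebesgue \<Omega>"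
    using assms by (intro emeasure_restrict_space) auto
  also have "\<dots> = emeasure lborel \<Omega>" using assms by simp
  also have "\<dots> < \<infinity>" using assms by (intro emeasure_bounded_finite)
  finally show "emeasure (lebesgue_on \<Omega>) (space (lebesgue_on \<Omega>)) \<noteq> \<infinity>" by simp
qed

lemma Lp_imp_L1:
  fixes \<Omega> :: "(real^'n) set" and f :: "real^'n \<Rightarrow> 'b::euclidean_space"
  assumes \<Omega>: "bounded \<Omega>" "open \<Omega>" and q: "1 < q" and f: "f \<in> Lp_space q \<Omega>"
  shows "integrable (lebesgue_on \<Omega>) f"
    and "(LINT x|lebesgue_on \<Omega>. norm (f x)) \<le> measure (lebesgue_on \<Omega>) \<Omega> powr (1 - 1 / q) * Lp_norm q \<Omega> f"
proof -
  let ?M = "lebesgue_on \<Omega>"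
  interpret finite_measure "?M" by (rule finite_measure_lebesgue_on[OF \<Omega>])
  define q' where "q' = q / (q - 1)"
  have q': "1 < q'" "1 / q' + 1 / q = 1" "1 / q' = 1 - 1 / q" using q by (auto simp: q'_def field_simps)
  note L = Lp_spaceD[OF f]
  have i: "integrable (?M) (\<lambda>x. \<bar>1\<bar> powr q' :: real)" by simp
  have m: "(\<lambda>x. norm (f x)) \<in> borel_measurable (?M)" using L(1) by measurable
  note H = Holder_inequality[OF q'(1) q q'(2), of "\<lambda>_. 1" "?M" "\<lambda>x. norm (f x)"]
  have "integrable (?M) (\<lambda>x. 1 * norm (f x))"
    by (rule H(1)) (use i m L in auto)
  then show "integrable (?M) f" using L(1) by (simp add: integrable_norm_iff)
  have "(LINT x|?M. \<bar>1 * norm (f x)\<bar>) \<le> (LINT x|?M. \<bar>1\<bar> powr q') powr (1 / q') * (LINT x|?M. \<bar>norm (f x)\<bar> powr q) powr (1 / q)"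
    by (rule H(2)) (use i m L in auto)
  then show "(LINT x|?M. norm (f x)) \<le> measure (?M) \<Omega> powr (1 - 1 / q) * Lp_norm q \<Omega> f"
    by (simp add: Lp_norm_def q'(3))
qed

subsection \<open>Weak convergence\<close>

text \<open>The functionals on which weak convergence of gradients is tested,
  \<open>p / (p - 1)\<close> being the conjugate exponent. The Hoelder bounds are stated for an
  arbitrary field \<open>G\<close> because they are also applied to truncated gradients.\<close>

lemma dual_weak_gradient_inner:
  fixes \<Omega> :: "(real^'n) set"
  assumes \<Omega>: "open \<Omega>" and p: "1 < p" and \<Psi>: "\<Psi> \<in> Lp_space (p / (p - 1)) \<Omega>"
  shows "(\<lambda>v. \<integral>x. \<Psi> x \<bullet> weak_gradient \<Omega> v x \<partial>lebesgue_on \<Omega>) \<in> W1p0_dual p \<Omega>"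
    and "G \<in> Lp_space p \<Omega> \<Longrightarrow> integrable (lebesgue_on \<Omega>) (\<lambda>x. \<Psi> x \<bullet> G x)"
    and "G \<in> Lp_space p \<Omega> \<Longrightarrow> \<bar>\<integral>x. \<Psi> x \<bullet> G x \<partial>lebesgue_on \<Omega>\<bar> \<le> Lp_norm (p / (p - 1)) \<Omega> \<Psi> * Lp_norm p \<Omega> G"
proof -
  let ?M = "lebesgue_on \<Omega>"
  define p' where "p' = p / (p - 1)"
  have p': "1 < p'" "1 / p' + 1 / p = 1" and p0: "0 < p" using p by (auto simp: p'_def field_simps)
  note P = Lp_spaceD[OF \<Psi>, folded p'_def]
  have *: "integrable (?M) (\<lambda>x. \<Psi> x \<bullet> G x) \<and> \<bar>\<integral>x. \<Psi> x \<bullet> G x \<partial>?M\<bar> \<le> Lp_norm p' \<Omega> \<Psi> * Lp_norm p \<Omega> G"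
    if G: "G \<in> Lp_space p \<Omega>" for G
  proof -
    note G = Lp_spaceD[OF G]
    have m: "(\<lambda>x. norm (\<Psi> x)) \<in> borel_measurable (?M)" "(\<lambda>x. norm (G x)) \<in> borel_measurable (?M)"
      using P G by measurable
    have m2: "(\<lambda>x. \<Psi> x \<bullet> G x) \<in> borel_measurable (?M)"
      using P(1) G(1) by measurable
    note H = Holder_inequality[OF p'(1) p p'(2) m]
    have i: "integrable (?M) (\<lambda>x. norm (\<Psi> x) * norm (G x))"
      by (rule H(1)) (use P G in auto)
    have le: "norm (\<Psi> x \<bullet> G x) \<le> norm (\<Psi> x) * norm (G x)" for x
      by (simp add: Cauchy_Schwarz_ineq2)
    have i2: "integrable (?M) (\<lambda>x. \<Psi> x \<bullet> G x)"
      using le by (intro Bochner_Integration.integrable_bound[OF i m2] AE_I2) (simp add: abs_mult)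
    have "norm (LINT x|?M. \<Psi> x \<bullet> G x) \<le> (LINT x|?M. norm (\<Psi> x) * norm (G x))"
      using le by (intro Bochner_Integration.integral_norm_bound_integral i i2) auto
    also have "\<dots> = (LINT x|?M. \<bar>norm (\<Psi> x) * norm (G x)\<bar>)" by (simp add: abs_mult)
    also have "\<dots> \<le> (LINT x|?M. \<bar>norm (\<Psi> x)\<bar> powr p') powr (1 / p') * (LINT x|?M. \<bar>norm (G x)\<bar> powr p) powr (1 / p)"
      by (rule H(2)) (use P G in auto)
    finally show ?thesis using i2 by (simp add: Lp_norm_def)
  qed
  then show "G \<in> Lp_space p \<Omega> \<Longrightarrow> integrable (?M) (\<lambda>x. \<Psi> x \<bullet> G x)"
    "G \<in> Lp_space p \<Omega> \<Longrightarrow> \<bar>\<integral>x. \<Psi> x \<bullet> G x \<partial>?M\<bar> \<le> Lp_norm (p / (p - 1)) \<Omega> \<Psi> * Lp_norm p \<Omega> G"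
    by (simp_all add: p'_def)
  let ?l = "\<lambda>v. \<integral>x. \<Psi> x \<bullet> weak_gradient \<Omega> v x \<partial>?M"
  have lin: "?l (\<lambda>x. u x + c * v x) = ?l u + c * ?l v" if "u \<in> W1p0 p \<Omega>" "v \<in> W1p0 p \<Omega>" for u v c
  proof -
    note W = W1p0_imp_W1p[OF that(1)] W1p0_imp_W1p[OF that(2)]
    note D = W1pD(3)[OF \<Omega> W(1)] W1pD(3)[OF \<Omega> W(2)] W1pD(3)[OF \<Omega> W1p_add_cmult(1)[OF \<Omega> p0 W]]
    have "?l (\<lambda>x. u x + c * v x) = (LINT x|?M. \<Psi> x \<bullet> weak_gradient \<Omega> u x + c * (\<Psi> x \<bullet> weak_gradient \<Omega> v x))"
    proof (rule integral_cong_AE)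
      show "(\<lambda>x. \<Psi> x \<bullet> weak_gradient \<Omega> (\<lambda>x. u x + c * v x) x) \<in> borel_measurable (?M)"
        using *[OF D(3)] by auto
      show "(\<lambda>x. \<Psi> x \<bullet> weak_gradient \<Omega> u x + c * (\<Psi> x \<bullet> weak_gradient \<Omega> v x)) \<in> borel_measurable (?M)"
        using *[OF D(1)] *[OF D(2)] by auto
      show "AE x in ?M. \<Psi> x \<bullet> weak_gradient \<Omega> (\<lambda>x. u x + c * v x) x = \<Psi> x \<bullet> weak_gradient \<Omega> u x + c * (\<Psi> x \<bullet> weak_gradient \<Omega> v x)"
        using W1p_add_cmult(2)[OF \<Omega> p0 W, of c]
      proof eventually_elim
        case (elim x)
        show ?case unfolding elim[symmetric] by (simp add: inner_add_right)
      qed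
    qed
    also have "\<dots> = ?l u + c * ?l v" using *[OF D(1)] *[OF D(2)] by simp
    finally show ?thesis .
  qed
  have zero: "(\<lambda>x. 0) \<in> W1p0 p \<Omega>" by (rule test_function_W1p0[OF \<Omega> p test_functions_zero])
  show "?l \<in> W1p0_dual p \<Omega>"
    unfolding W1p0_dual_def
  proof (intro CollectI conjI ballI allI exI)
    show "?l (\<lambda>x. u x + v x) = ?l u + ?l v" if "u \<in> W1p0 p \<Omega>" "v \<in> W1p0 p \<Omega>" for u v
      using lin[OF that, of 1] by simp
    \<comment> \<open>Homogeneity is the combination \<open>0 + c * u\<close>; that the functional
      is 0 at the zero function follows from \<open>0 = 0 + 1 * 0\<close>.\<close>
    show "?l (\<lambda>x. c * u x) = c * ?l u" if "u \<in> W1p0 p \<Omega>" for c u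
      using lin[OF zero that, of c] lin[OF zero zero, of 1] by simp
    show "\<bar>?l u\<bar> \<le> Lp_norm p' \<Omega> \<Psi> * W1p0_norm p \<Omega> u" if "u \<in> W1p0 p \<Omega>" for u
      using *[OF W1pD(3)[OF \<Omega> W1p0_imp_W1p[OF that]]] by (simp add: W1p0_norm_def)
  qed
qed

text \<open>The dual norm only sees the gradient, so boundedness comes from the Sobolev inequality
  on the bounded set \<open>\<Omega>\<close>. With \<open>A\<close> a ball this makes local averages
  converge at every point along weakly convergent sequences.\<close>

lemma dual_set_integral:
  fixes \<Omega> :: "(real^'n) set"
  assumes \<Omega>: "bounded \<Omega>" "open \<Omega>" and p: "1 < p" "p < real CARD('n)" and A: "A \<in> sets borel"
  shows "(\<lambda>v. \<integral>x. indicator A x * v x \<partial>lebesgue_on \<Omega>) \<in> W1p0_dual p \<Omega>"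
proof -
  let ?M = "lebesgue_on \<Omega>"
  define q where "q = critical_exponent CARD('n) p"
  have q1: "q > 1" using critical_exponent_gt(2)[OF p] by (simp add: q_def)
  obtain C where C: "0 \<le> C" "\<And>u. u \<in> W1p0 p \<Omega> \<Longrightarrow> u \<in> Lp_space q \<Omega> \<and> Lp_norm q \<Omega> u \<le> C * W1p0_norm p \<Omega> u"
    using W1p0_Sobolev[OF \<Omega>(2) p q_def] by blast
  have Am: "indicator A \<in> borel_measurable (?M)"
    using A by (intro borel_imp_lebesgue_on_measurable) simp
  have i: "integrable (?M) (\<lambda>x. indicator A x * v x)" 
    and b: "\<bar>\<integral>x. indicator A x * v x \<partial>?M\<bar> \<le> (measure (?M) \<Omega> powr (1 - 1 / q) * C) * W1p0_norm p \<Omega> v" 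
    if v: "v \<in> W1p0 p \<Omega>" for v
  proof -
    have vq: "v \<in> Lp_space q \<Omega>" using C v by blast
    note L = Lp_imp_L1[OF \<Omega> q1 vq]
    show i: "integrable (?M) (\<lambda>x. indicator A x * v x)"
    proof (rule Bochner_Integration.integrable_bound[OF L(1)])
      show "(\<lambda>x. indicator A x * v x) \<in> borel_measurable (?M)"
        by (rule borel_measurable_times[OF Am borel_measurable_integrable[OF L(1)]])
    qed (auto simp: indicator_def)
    have "norm (LINT x|?M. indicator A x * v x) \<le> (LINT x|?M. norm (v x))"
      using L(1) by (intro Bochner_Integration.integral_norm_bound_integral i) (auto simp: indicator_def)
    also have "\<dots> \<le> measure (?M) \<Omega> powr (1 - 1 / q) * (C * W1p0_norm p \<Omega> v)"
      using C(2)[OF v] by (intro order_trans[OF L(2)] mult_left_mono) auto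
    finally show "\<bar>\<integral>x. indicator A x * v x \<partial>?M\<bar> \<le> (measure (?M) \<Omega> powr (1 - 1 / q) * C) * W1p0_norm p \<Omega> v"
      by (simp add: mult.assoc)
  qed
  show ?thesis
    unfolding W1p0_dual_def
  proof (intro CollectI conjI ballI allI exI)
    fix u v :: "real^'n \<Rightarrow> real" and c :: real assume u: "u \<in> W1p0 p \<Omega>"
    show "(LINT x|?M. indicator A x * (c * u x)) = c * (LINT x|?M. indicator A x * u x)"
      by (simp add: mult.left_commute)
    show "\<bar>\<integral>x. indicator A x * u x \<partial>?M\<bar> \<le> (measure (?M) \<Omega> powr (1 - 1 / q) * C) * W1p0_norm p \<Omega> u"
      by (rule b[OF u])
    assume v: "v \<in> W1p0 p \<Omega>"
    show "(LINT x|?M. indicator A x * (u x + v x)) = (LINT x|?M. indicator A x * u x) + (LINT x|?M. indicator A x * v x)"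
      using i[OF u] i[OF v] by (simp add: distrib_left)
  qed
qed

text \<open>A value differs from the average over a ball of radius \<open>r\<close> by at most the
  mean oscillation, and the integrated oscillation is of order \<open>r\<close> times the integral
  of the gradient. Everything is multiplied by the volume of the ball to avoid a quotient.\<close>

lemma nn_integral_abs_le_average:
  fixes f :: "'a::euclidean_space \<Rightarrow> real" and G :: "'a \<Rightarrow> 'a"
  assumes d: "\<And>x. (f has_derivative (\<lambda>h. G x \<bullet> h)) (at x)" and G: "continuous_on UNIV G"
    and r: "0 < r"
  shows "ennreal (measure lborel (cball (0::'a) r)) * (\<integral>\<^sup>+x. ennreal \<bar>f x\<bar> \<partial>lborel)
    \<le> (\<integral>\<^sup>+x. ennreal \<bar>\<integral>h. indicator (cball 0 r) h * f (x + h) \<partial>lborel\<bar> \<partial>lborel)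
      + ennreal (measure lborel (cball (0::'a) r) * (2 * r)) * (\<integral>\<^sup>+x. ennreal (norm (G x)) \<partial>lborel)"
proof -
  let ?N = "(\<integral>\<^sup>+x. ennreal (norm (G x)) \<partial>lborel)"
  have cf: "continuous_on UNIV f"
    using d by (metis continuous_at_imp_continuous_on has_derivative_continuous)
  have [measurable]: "f \<in> borel_measurable borel" "G \<in> borel_measurable borel"
    using G cf by (auto intro: borel_measurable_continuous_onI)
  define B where "B = cball (0::'a) r"
  have [measurable]: "B \<in> sets borel" by (simp add: B_def)
  have cB: "compact B" by (simp add: B_def)
  define V where "V = measure lborel B"
  have eV: "emeasure lborel B = ennreal V"
    using emeasure_compact_finite[OF cB] by (simp add: V_def emeasure_eq_ennreal_measure less_top)
  define D where "D x = (\<integral>\<^sup>+h. indicator B h * ennreal \<bar>f (x + h) - f x\<bar> \<partial>lborel)" for x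
  have [measurable]: "D \<in> borel_measurable borel" unfolding D_def by measurable
  have pt: "ennreal (V * \<bar>f x\<bar>) \<le> ennreal \<bar>\<integral>h. indicator B h * f (x + h) \<partial>lborel\<bar> + D x" for x
  proof -
    have i1: "integrable lborel (\<lambda>h. indicator B h * f (x + h))"
      using borel_integrable_compact[OF cB, of "\<lambda>h. f (x + h)"]
      by (simp add: continuous_on_compose2[OF cf] continuous_intros)
    have i2: "integrable lborel (\<lambda>h. indicator B h * (f (x + h) - f x))"
      using borel_integrable_compact[OF cB, of "\<lambda>h. f (x + h) - f x"]
      by (simp add: continuous_on_compose2[OF cf] continuous_intros)
    have "V * f x = (LINT h|lborel. indicator B h * f x)"
      using eV by (simp add: V_def)
    also have "\<dots> = (LINT h|lborel. indicator B h * f (x + h) - indicator B h * (f (x + h) - f x))"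
      by (intro Bochner_Integration.integral_cong) (auto simp: indicator_def)
    also have "\<dots> = (LINT h|lborel. indicator B h * f (x + h)) - (LINT h|lborel. indicator B h * (f (x + h) - f x))"
      by (intro Bochner_Integration.integral_diff i1 i2)
    finally have "V * \<bar>f x\<bar> \<le> \<bar>\<integral>h. indicator B h * f (x + h) \<partial>lborel\<bar> + \<bar>\<integral>h. indicator B h * (f (x + h) - f x) \<partial>lborel\<bar>"
      using abs_mult[of V "f x"] by (simp add: V_def)
    also have "\<bar>\<integral>h. indicator B h * (f (x + h) - f x) \<partial>lborel\<bar> \<le> (LINT h|lborel. \<bar>indicator B h * (f (x + h) - f x)\<bar>)"
      by (rule integral_abs_bound)
    finally have "ennreal (V * \<bar>f x\<bar>) \<le> ennreal \<bar>\<integral>h. indicator B h * f (x + h) \<partial>lborel\<bar> + ennreal (LINT h|lborel. \<bar>indicator B h * (f (x + h) - f x)\<bar>)"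
      by (simp add: ennreal_plus[symmetric] ennreal_leI del: ennreal_plus)
    also have "ennreal (LINT h|lborel. \<bar>indicator B h * (f (x + h) - f x)\<bar>) = (\<integral>\<^sup>+h. ennreal \<bar>indicator B h * (f (x + h) - f x)\<bar> \<partial>lborel)"
      using i2 by (intro nn_integral_eq_integral[symmetric]) auto
    also have "\<dots> = D x"
      unfolding D_def by (intro nn_integral_cong) (auto simp: indicator_def)
    finally show ?thesis .
  qed
  have "(\<integral>\<^sup>+x. D x \<partial>lborel) = (\<integral>\<^sup>+h. (\<integral>\<^sup>+x. indicator B h * ennreal \<bar>f (x + h) - f x\<bar> \<partial>lborel) \<partial>lborel)"
    unfolding D_def by (rule lborel_pair.Fubini'[symmetric]) measurable
  also have "\<dots> \<le> (\<integral>\<^sup>+h. indicator B h * (ennreal (2 * r) * ?N) \<partial>lborel)"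
  proof (intro nn_integral_mono)
    fix h :: 'a
    have "(\<integral>\<^sup>+x. ennreal \<bar>f (x + h) - f x\<bar> \<partial>lborel) \<le> ennreal (2 * r) * ?N" if "h \<in> B"
    proof -
      have "2 * norm h \<le> 2 * r" using that by (simp add: B_def)
      then have "ennreal (2 * norm h) * ?N \<le> ennreal (2 * r) * ?N"
        by (intro mult_right_mono ennreal_leI) auto
      then show ?thesis
        using nn_integral_diff_powr_le[OF d G order_refl, of h] by simp
    qed
    then show "(\<integral>\<^sup>+x. indicator B h * ennreal \<bar>f (x + h) - f x\<bar> \<partial>lborel) \<le> indicator B h * (ennreal (2 * r) * ?N)"
      by (cases "h \<in> B") auto
  qed
  also have "\<dots> = ennreal V * (ennreal (2 * r) * ?N)"
    by (simp add: nn_integral_multc eV)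
  also have "\<dots> = ennreal (V * (2 * r)) * ?N"
    using r by (simp add: ennreal_mult V_def mult.assoc)
  finally have iD: "(\<integral>\<^sup>+x. D x \<partial>lborel) \<le> ennreal (V * (2 * r)) * ?N" .
  have "ennreal V * (\<integral>\<^sup>+x. ennreal \<bar>f x\<bar> \<partial>lborel) = (\<integral>\<^sup>+x. ennreal (V * \<bar>f x\<bar>) \<partial>lborel)"
    by (simp add: nn_integral_cmult ennreal_mult V_def)
  also have "\<dots> \<le> (\<integral>\<^sup>+x. ennreal \<bar>\<integral>h. indicator B h * f (x + h) \<partial>lborel\<bar> + D x \<partial>lborel)"
    by (intro nn_integral_mono pt)
  also have "\<dots> = (\<integral>\<^sup>+x. ennreal \<bar>\<integral>h. indicator B h * f (x + h) \<partial>lborel\<bar> \<partial>lborel) + (\<integral>\<^sup>+x. D x \<partial>lborel)"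
    by (rule nn_integral_add) measurable
  also have "\<dots> \<le> (\<integral>\<^sup>+x. ennreal \<bar>\<integral>h. indicator B h * f (x + h) \<partial>lborel\<bar> \<partial>lborel) + ennreal (V * (2 * r)) * ?N"
    by (intro add_left_mono iD)
  finally show ?thesis unfolding V_def B_def .
qed

text \<open>A substitute for the Rellich compactness theorem. At fixed radius the averages of
  \<open>\<psi> n\<close> tend to 0 pointwise, as bounded functionals, and are dominated; the error
  of replacing \<open>\<psi> n\<close> by its averages is at most \<open>2 * r * C1\<close> for all
  \<open>n\<close> at once. The radius is chosen last.\<close>

lemma weakly_null_imp_L1_null:
  fixes \<Omega> :: "(real^'n) set" and \<psi> :: "nat \<Rightarrow> real^'n \<Rightarrow> real"
  assumes \<Omega>: "bounded \<Omega>" "open \<Omega>" and p: "1 < p" "p < real CARD('n)"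
    and \<psi>: "\<And>n. \<psi> n \<in> test_functions \<Omega>" and C: "\<And>n. W1p0_norm p \<Omega> (\<psi> n) \<le> C"
    and weak: "\<And>l. l \<in> W1p0_dual p \<Omega> \<Longrightarrow> (\<lambda>n. l (\<psi> n)) \<longlonglongrightarrow> 0"
  shows "(\<lambda>n. \<integral>x. norm (\<psi> n x) \<partial>lebesgue_on \<Omega>) \<longlonglongrightarrow> 0"
proof -
  let ?M = "lebesgue_on \<Omega>"
  have p0: "0 < p" using p by simp
  define m where "m n = (LINT x|?M. norm (\<psi> n x))" for n
  define g where "g n = (LINT x|?M. norm (grad (\<psi> n) x))" for n
  have m0: "0 \<le> m n" "0 \<le> g n" for n by (simp_all add: m_def g_def)
  have powr1: "norm x powr 1 = norm x" for x :: "'b::real_normed_vector" by simp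
  have nn: "(\<integral>\<^sup>+x. ennreal \<bar>\<psi> n x\<bar> \<partial>lborel) = ennreal (m n)"
    "(\<integral>\<^sup>+x. ennreal (norm (grad (\<psi> n) x)) \<partial>lborel) = ennreal (g n)" 
    "integrable lborel (\<lambda>x. \<bar>\<psi> n x\<bar>)" for n
  proof -
    obtain K where K: "smooth_on UNIV (\<psi> n)" "compact K" "K \<subseteq> \<Omega>" "\<And>x. x \<notin> K \<Longrightarrow> \<psi> n x = 0"
     "\<And>x. x \<notin> K \<Longrightarrow> grad (\<psi> n) x = 0"
      using \<psi>[of n] by (rule test_functionsE) blast
    show i: "integrable lborel (\<lambda>x. \<bar>\<psi> n x\<bar>)"
      using K by (intro integrable_continuous_compact_support[OF _ K(2)] continuous_intros smooth_on_continuous) auto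
    have i2: "integrable lborel (\<lambda>x. norm (grad (\<psi> n) x))"
      using K by (intro integrable_continuous_compact_support[OF _ K(2)] continuous_intros smooth_continuous_gradient) auto
    show "(\<integral>\<^sup>+x. ennreal \<bar>\<psi> n x\<bar> \<partial>lborel) = ennreal (m n)"
      using test_function_Lp(3)[OF \<psi> \<Omega>(2), of 1 n] i by (subst nn_integral_eq_integral) (auto simp: m_def)
    show "(\<integral>\<^sup>+x. ennreal (norm (grad (\<psi> n) x)) \<partial>lborel) = ennreal (g n)"
      using test_function_Lp(4)[OF \<psi> \<Omega>(2), of 1 n] i2 by (subst nn_integral_eq_integral) (auto simp: g_def powr1)
  qed
  define C1 where "C1 = measure (?M) \<Omega> powr (1 - 1 / p) * C"
  have "0 \<le> C" using C[of 0] W1p0_norm_nonneg[of p \<Omega> "\<psi> 0"] by linarith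
  then have C1: "0 \<le> C1" by (simp add: C1_def)
  have gC: "g n \<le> C1" for n
  proof -
    have "g n \<le> measure (?M) \<Omega> powr (1 - 1 / p) * Lp_norm p \<Omega> (grad (\<psi> n))"
      unfolding g_def by (rule Lp_imp_L1(2)[OF \<Omega> p(1) test_function_Lp(2)[OF \<psi> \<Omega>(2) p0]])
    also have "\<dots> \<le> C1"
      unfolding C1_def using C[of n] test_function_W1p(3)[OF \<Omega>(2) p0 \<psi>] by (intro mult_left_mono) auto
    finally show ?thesis .
  qed
  obtain R where R: "\<Omega> \<subseteq> cball 0 R" using bounded_subset_ballD[OF \<Omega>(1), of 0] ball_subset_cball order_trans by metis
  define q where "q = critical_exponent CARD('n) p"
  obtain C2 where C2: "\<And>n. m n \<le> C2"
  proof -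
    have q1: "q > 1" using critical_exponent_gt(2)[OF p] by (simp add: q_def)
    obtain D where D: "0 \<le> D" "\<And>u. u \<in> W1p0 p \<Omega> \<Longrightarrow> u \<in> Lp_space q \<Omega> \<and> Lp_norm q \<Omega> u \<le> D * W1p0_norm p \<Omega> u"
      using W1p0_Sobolev[OF \<Omega>(2) p q_def] by blast
    have "m n \<le> measure (?M) \<Omega> powr (1 - 1 / q) * (D * C)" for n
    proof -
      note W = D(2)[OF test_function_W1p0[OF \<Omega>(2) p(1) \<psi>[of n]]]
      have "m n \<le> measure (?M) \<Omega> powr (1 - 1 / q) * Lp_norm q \<Omega> (\<psi> n)"
        unfolding m_def by (rule Lp_imp_L1(2)[OF \<Omega> q1 conjunct1[OF W]])
      also have "\<dots> \<le> measure (?M) \<Omega> powr (1 - 1 / q) * (D * C)"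
        using order_trans[OF conjunct2[OF W] mult_left_mono[OF C D(1)]] by (rule mult_left_mono) simp
      finally show ?thesis .
    qed
    then show ?thesis by (rule that)
  qed
  have main: "\<forall>\<^sub>F n in sequentially. m n < 2 * r * C1 + r" if r: "0 < r" for r
  proof -
    define B where "B = cball (0::real^'n) r"
    have [measurable]: "B \<in> sets borel" by (simp add: B_def)
    define V where "V = measure lborel B"
    have V: "V > 0" using r by (simp add: V_def B_def content_cball_pos)
    define A where "A n x = (LINT h|lborel. indicator B h * \<psi> n (x + h))" for n x
    have Am [measurable]: "A n \<in> borel_measurable borel" for n
    proof -
      note [measurable] = test_functions_measurable(1)[OF \<psi>[of n]]
      show ?thesis unfolding A_def by measurable
    qed
    \<comment> \<open>Moves the ball from the origin to \<open>x\<close>, so that the average is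
      visibly a functional of \<open>\<psi> n\<close> on \<open>\<Omega>\<close>.\<close>
    have A_eq: "A n x = (LINT y|?M. indicator (cball x r) y * \<psi> n y)" for n x
    proof -
      note [measurable] = test_functions_measurable(1)[OF \<psi>[of n]]
      have *: "\<psi> n y = 0" if "y \<notin> \<Omega>" for y
        using \<psi>[of n] that by (auto elim!: test_functionsE)
      have [measurable]: "cball x r \<in> sets borel" by simp
      have "(\<lambda>y. indicator (cball x r) y * \<psi> n y) \<in> borel_measurable borel" by measurable
      then have "(LINT y|?M. indicator (cball x r) y * \<psi> n y) = (LINT y|lborel. indicator (cball x r) y * \<psi> n y)"
        using \<Omega>(2) * by (intro integral_lebesgue_on_eq_lborel(2)) auto
      also have "\<dots> = (LINT y|distr lborel borel ((+) x). indicator (cball x r) y * \<psi> n y)"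
        by (simp add: lborel_distr_plus)
      also have "\<dots> = (LINT h|lborel. indicator (cball x r) (x + h) * \<psi> n (x + h))"
        by (subst integral_distr) auto
      also have "\<dots> = A n x"
        unfolding A_def B_def by (intro Bochner_Integration.integral_cong) (auto simp: indicator_def dist_norm)
      finally show ?thesis ..
    qed
    \<comment> \<open>Averaging spreads the support by \<open>r\<close>, whence the ball of radius
      \<open>R + r\<close>; the integral over any ball is at most the full one.\<close>
    have A_bound: "\<bar>A n x\<bar> \<le> indicator (cball 0 (R + r)) x * C2" for n x
    proof (cases "x \<in> cball 0 (R + r)")
      case True
      have "\<bar>A n x\<bar> \<le> m n"
      proof -
        have i: "integrable (?M) (\<lambda>y. norm (\<psi> n y))"
          using Lp_imp_L1(1)[OF \<Omega> p(1) test_function_Lp(1)[OF \<psi> \<Omega>(2) p0]] by (rule integrable_norm)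
        have ip: "(\<lambda>y. indicator (cball x r) y * \<psi> n y) \<in> borel_measurable (?M)"
        proof -
          note [measurable] = test_functions_measurable(1)[OF \<psi>[of n]]
          have [measurable]: "cball x r \<in> sets borel" by simp
          show ?thesis by (rule borel_imp_lebesgue_on_measurable) measurable
        qed
        have le: "norm (indicator (cball x r) y * \<psi> n y) \<le> norm (\<psi> n y)" for y
          by (simp add: indicator_def)
        have "norm (A n x) \<le> (LINT y|?M. norm (\<psi> n y))"
          unfolding A_eq using le i
          by (intro Bochner_Integration.integral_norm_bound_integral Bochner_Integration.integrable_bound[OF i ip]) auto
        then show ?thesis by (simp add: m_def)
      qed
      then show ?thesis using True C2[of n] by simp
    next
      case False
      have "indicator (cball x r) y * \<psi> n y = 0" for y
      proof (cases "y \<in> \<Omega>")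
        case True
        then have "norm y \<le> R" using R by auto
        moreover have "norm x \<le> norm y + dist x y" by (metis dist_norm norm_triangle_sub)
        ultimately show ?thesis using False by (auto simp: indicator_def)
      next
        case False
        then show ?thesis using \<psi>[of n] by (auto elim!: test_functionsE)
      qed
      then have "A n x = 0" unfolding A_eq by (simp only: Bochner_Integration.integral_zero)
      then show ?thesis using False by simp
    qed
    have "(\<lambda>n. \<integral>x. \<bar>A n x\<bar> \<partial>lborel) \<longlonglongrightarrow> (LINT x|(lborel :: (real^'n) measure). 0)"
    proof (rule integral_dominated_convergence[where w = "\<lambda>x. indicator (cball 0 (R + r)) x * C2"])
      show "integrable lborel (\<lambda>x. indicator (cball (0::real^'n) (R + r)) x * C2)"
        by (intro integrable_mult_left integrable_real_indicator emeasure_compact_finite) auto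
      show "AE x in lborel. (\<lambda>n. \<bar>A n x\<bar>) \<longlonglongrightarrow> 0"
      proof (rule AE_I2)
        fix x
        have "(\<lambda>n. A n x) \<longlonglongrightarrow> 0"
          unfolding A_eq by (rule weak[OF dual_set_integral[OF \<Omega> p]]) simp
        then show "(\<lambda>n. \<bar>A n x\<bar>) \<longlonglongrightarrow> 0" by (rule tendsto_rabs_zero)
      qed
    qed (use A_bound in auto)
    then have "(\<lambda>n. \<integral>x. \<bar>A n x\<bar> \<partial>lborel) \<longlonglongrightarrow> 0" by simp
    then have "\<forall>\<^sub>F n in sequentially. (LINT x|lborel. \<bar>A n x\<bar>) < V * r"
      using V r by (intro order_tendstoD) auto
    then show ?thesis
    proof eventually_elim
      case (elim n)
      have iA: "integrable lborel (\<lambda>x. \<bar>A n x\<bar>)"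
      proof (rule Bochner_Integration.integrable_bound)
        show "integrable lborel (\<lambda>x. indicator (cball (0::real^'n) (R + r)) x * C2)"
          by (intro integrable_mult_left integrable_real_indicator emeasure_compact_finite) auto
      qed (use A_bound in \<open>auto intro!: AE_I2 order_trans[OF A_bound abs_ge_self]\<close>)
      have sm: "smooth_on UNIV (\<psi> n)" using test_functions_smooth \<psi> by blast
      have "ennreal V * ennreal (m n) \<le> (\<integral>\<^sup>+x. ennreal \<bar>A n x\<bar> \<partial>lborel) + ennreal (V * (2 * r)) * ennreal (g n)"
        using nn_integral_abs_le_average[OF test_functions_has_gradient[OF \<psi>] smooth_continuous_gradient[OF sm] r]
        unfolding nn A_def V_def B_def .
      also have "(\<integral>\<^sup>+x. ennreal \<bar>A n x\<bar> \<partial>lborel) = ennreal (LINT x|lborel. \<bar>A n x\<bar>)"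
        using iA by (intro nn_integral_eq_integral) auto
      finally have "ennreal (V * m n) \<le> ennreal ((LINT x|lborel. \<bar>A n x\<bar>) + V * (2 * r) * g n)"
        using V r m0 by (simp add: ennreal_mult[symmetric])
      then have "V * m n \<le> (LINT x|lborel. \<bar>A n x\<bar>) + V * (2 * r) * g n"
        using V r m0 by (subst (asm) ennreal_le_iff) auto
      also have "\<dots> < V * r + V * (2 * r) * C1"
        using elim gC[of n] V r by (intro add_less_le_mono mult_left_mono) auto
      also have "\<dots> = V * (2 * r * C1 + r)" by (simp add: algebra_simps)
      finally show ?case using V by simp
    qed
  qed
  have "m \<longlonglongrightarrow> 0"
  proof (rule order_tendstoI)
    fix a :: real assume "a < 0"
    then show "\<forall>\<^sub>F n in sequentially. a < m n" using m0 by (auto intro!: always_eventually intro: less_le_trans)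
  next
    fix a :: real assume a: "0 < a"
    \<comment> \<open>Makes \<open>2 * r * C1 + r\<close> equal to \<open>a\<close>: the first term
      stems from the oscillation, the second bounds the averages.\<close>
    define r where "r = a / (2 * C1 + 1)"
    have r: "0 < r" using a C1 by (simp add: r_def)
    have "2 * r * C1 + r = r * (2 * C1 + 1)" by (simp add: algebra_simps)
    also have "\<dots> = a" using C1 by (simp add: r_def)
    finally show "\<forall>\<^sub>F n in sequentially. m n < a" using main[OF r] by simp
  qed
  then show ?thesis by (simp add: m_def[abs_def])
qed

subsection \<open>Truncation\<close>

text \<open>Smooth with value 0 at 0, so test functions are mapped to test functions and the
  classical chain rule applies; a cut-off with corners would not have this property. For positive
  \<open>k\<close> the slope is 1 at the origin and falls to 0 at infinity on the scale
  \<open>k\<close>.\<close>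

definition trunc :: "real \<Rightarrow> real \<Rightarrow> real" where
  "trunc k s = k * arctan (s / k)"

definition trunc' :: "real \<Rightarrow> real \<Rightarrow> real" where
  "trunc' k s = inverse (1 + (s / k)\<^sup>2)"

lemma trunc'_bounds: "0 \<le> trunc' k s" "trunc' k s \<le> 1"
  by (auto simp: trunc'_def add_nonneg_nonneg intro!: inverse_le_1_iff[THEN iffD2])

lemma continuous_trunc': "continuous_on UNIV (trunc' k)"
proof -
  have "1 + (s / k)\<^sup>2 \<noteq> 0" for s by (smt (verit) zero_le_power2)
  then show ?thesis unfolding trunc'_def by (cases "k = 0") (auto intro!: continuous_intros)
qed

lemma trunc'_tendsto: "(\<lambda>m. trunc' (real (Suc m)) s) \<longlonglongrightarrow> 1"
proof -
  have "(\<lambda>m. inverse (1 + (s * inverse (real (Suc m)))\<^sup>2)) \<longlonglongrightarrow> inverse (1 + (s * 0)\<^sup>2)"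
    by (intro tendsto_intros LIMSEQ_inverse_real_of_nat) simp
  then show ?thesis by (simp add: trunc'_def divide_inverse)
qed

lemma trunc_has_derivative:
  assumes "0 < k"
  shows "(trunc k has_real_derivative trunc' k s) (at s)"
  unfolding trunc_def[abs_def] trunc'_def using assms by (auto intro!: derivative_eq_intros)

lemma smooth_trunc: "smooth_on UNIV (trunc k)"
  unfolding smooth_on_def trunc_def[abs_def] divide_inverse
  by (intro allI Ck_on_mult Ck_on_const Ck_on_compose[OF Ck_on_arctan] Ck_on_linear bounded_linear_ident)

lemma trunc_0 [simp]: "trunc k 0 = 0"
  by (simp add: trunc_def)

lemma abs_trunc_le: "0 < k \<Longrightarrow> \<bar>trunc k s\<bar> \<le> 2 * k"
  using arctan_bounded[of "s / k"] pi_less_4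
  by (auto simp: trunc_def abs_mult intro!: mult_left_mono)

lemma test_functions_trunc:
  assumes \<phi>: "\<phi> \<in> test_functions \<Omega>" and k: "0 < k"
  shows "(\<lambda>x. trunc k (\<phi> x)) \<in> test_functions \<Omega>"
    and "grad (\<lambda>x. trunc k (\<phi> x)) x = trunc' k (\<phi> x) *\<^sub>R grad \<phi> x"
    and "(\<lambda>x. \<phi> x - trunc k (\<phi> x)) \<in> test_functions \<Omega>"
    and "grad (\<lambda>x. \<phi> x - trunc k (\<phi> x)) x = (1 - trunc' k (\<phi> x)) *\<^sub>R grad \<phi> x"
proof -
  note T = test_functions_compose[OF \<phi> smooth_trunc trunc_0 trunc_has_derivative[OF k]]
  show "(\<lambda>x. trunc k (\<phi> x)) \<in> test_functions \<Omega>" by (rule T(1))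
  show g: "grad (\<lambda>x. trunc k (\<phi> x)) x = trunc' k (\<phi> x) *\<^sub>R grad \<phi> x" by (rule T(2))
  note R = test_functions_add_cmult[OF \<phi> T(1), of "-1"]
  show "(\<lambda>x. \<phi> x - trunc k (\<phi> x)) \<in> test_functions \<Omega>" using R(1) by simp
  show "grad (\<lambda>x. \<phi> x - trunc k (\<phi> x)) x = (1 - trunc' k (\<phi> x)) *\<^sub>R grad \<phi> x"
    using R(2)[of x] g by (simp add: scaleR_left_diff_distrib)
qed

text \<open>On the unit interval a power \<open>p \<ge> 1\<close> does not exceed its base, and the
  two bases add up to 1. With \<open>a = trunc' k (\<phi> x)\<close> this is the pointwise splitting
  of the gradient energy.\<close>

lemma powr_add_powr_le_1:
  fixes a p :: real
  assumes "0 \<le> a" "a \<le> 1" "1 \<le> p"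
  shows "a powr p + (1 - a) powr p \<le> 1"
proof -
  have "b powr p \<le> b" if "0 \<le> b" "b \<le> 1" for b :: real
    using that assms(3) by (cases "b = 0") (auto intro: powr_le_one_le)
  from this[of a] this[of "1 - a"] assms show ?thesis by simp
qed

text \<open>Beyond \<open>L * k\<close> the bounded function \<open>trunc k\<close> takes away so
  small a fraction of \<open>s\<close> that the remainder is at least
  \<open>\<bar>s\<bar> / A powr (1 / q)\<close> in modulus; this is where the surplus
  \<open>1 < A\<close> enters. As \<open>L\<close> depends on \<open>A\<close> and \<open>q\<close>
  alone, it serves all levels \<open>k\<close>.\<close>

lemma abs_powr_le_trunc_remainder:
  assumes A: "1 < A" and q: "0 < q"
  obtains L :: real where "0 < L"
    "\<And>k s. 0 < k \<Longrightarrow> \<bar>s\<bar> powr q \<le> (min \<bar>s\<bar> (L * k)) powr q + A * \<bar>s - trunc k s\<bar> powr q"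
proof -
  define B where "B = A powr (1 / q)"
  have B: "1 < B" using A q by (simp add: B_def)
  have Bq: "B powr q = A" using A q by (simp add: B_def powr_powr)
  define e where "e = 1 - 1 / B"
  have e: "0 < e" using B by (simp add: e_def)
  \<comment> \<open>Solves \<open>L * (1 - 1 / B) = 2\<close>, the 2 coming from the bound
    \<open>\<bar>trunc k s\<bar> \<le> 2 * k\<close>.\<close>
  define L where "L = 2 / e"
  have L: "0 < L" "L * (1 - 1 / B) = 2" using e unfolding e_def[symmetric] by (simp_all add: L_def)
  show ?thesis
  proof (rule that[OF L(1)])
    fix k s :: real assume k: "0 < k"
    show "\<bar>s\<bar> powr q \<le> (min \<bar>s\<bar> (L * k)) powr q + A * \<bar>s - trunc k s\<bar> powr q"
    proof (cases "\<bar>s\<bar> \<le> L * k")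
      case True
      then show ?thesis using A by (simp add: min_def)
    next
      case False
      have "2 * k = L * k * (1 - 1 / B)" using L(2) by (metis mult.assoc mult.commute)
      also have "\<dots> \<le> \<bar>s\<bar> * (1 - 1 / B)" using False B by (intro mult_right_mono) auto
      finally have "\<bar>s\<bar> / B \<le> \<bar>s\<bar> - 2 * k" by (simp add: right_diff_distrib)
      also have "\<dots> \<le> \<bar>s - trunc k s\<bar>" using abs_trunc_le[OF k, of s] by linarith
      finally have "(\<bar>s\<bar> / B) powr q \<le> \<bar>s - trunc k s\<bar> powr q"
        using q B by (intro powr_mono2) auto
      then have "\<bar>s\<bar> powr q \<le> A * \<bar>s - trunc k s\<bar> powr q"
        using A by (simp add: powr_divide Bq divide_le_eq mult.commute)
      then show ?thesis by (simp add: add_increasing)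
    qed
  qed
qed

text \<open>Only \<open>\<Psi> = |Du|\<^bsup>p-2\<^esup> Du\<close> is needed as a test field: the tangent inequality of the convex
  function \<open>|\<cdot>|\<^bsup>p\<^esup>\<close> at \<open>Du\<close> replaces weak convergence of the truncated functions.\<close>

lemma truncated_gradient_liminf:
  fixes \<Omega> :: "(real^'n) set" and \<phi> :: "nat \<Rightarrow> real^'n \<Rightarrow> real"
  assumes \<Omega>: "open \<Omega>" and p: "1 < p" and u: "u \<in> W1p0 p \<Omega>" and \<phi>: "\<And>j. \<phi> j \<in> test_functions \<Omega>"
    and weak: "\<And>l. l \<in> W1p0_dual p \<Omega> \<Longrightarrow> (\<lambda>j. l (\<phi> j)) \<longlonglongrightarrow> l u"
    and ae: "AE x in lebesgue_on \<Omega>. (\<lambda>j. \<phi> j x) \<longlonglongrightarrow> u x"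
    and C: "\<And>j. W1p0_norm p \<Omega> (\<phi> j) \<le> C"
    and T: "continuous_on UNIV T" "\<And>s. 0 \<le> T s" "\<And>s. T s \<le> (1::real)"
  obtains b where "b \<longlonglongrightarrow> (LINT x|lebesgue_on \<Omega>. norm (weak_gradient \<Omega> u x) powr p)
       - p * (LINT x|lebesgue_on \<Omega>. norm (weak_gradient \<Omega> u x) powr p * (1 - T (u x)))"
    "\<And>j. b j \<le> Lp_norm p \<Omega> (\<lambda>x. T (\<phi> j x) *\<^sub>R weak_gradient \<Omega> (\<phi> j) x) powr p"
proof -
  let ?M = "lebesgue_on \<Omega>"
  have p0: "0 < p" using p by simp
  define p' where "p' = p / (p - 1)"
  have p': "1 < p'" "(p - 1) * p' = p" using p by (auto simp: p'_def field_simps)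
  define D where "D = weak_gradient \<Omega> u"
  define \<Psi> where "\<Psi> x = norm (D x) powr (p - 2) *\<^sub>R D x" for x
  define Dj where "Dj j = weak_gradient \<Omega> (\<phi> j)" for j
  have DL: "D \<in> Lp_space p \<Omega>" unfolding D_def by (rule W1pD(3)[OF \<Omega> W1p0_imp_W1p[OF u]])
  have DjL: "Dj j \<in> Lp_space p \<Omega>" for j unfolding Dj_def by (rule W1pD(3)[OF \<Omega> test_function_W1p(1)[OF \<Omega> p0 \<phi>]])
  note [measurable] = Lp_spaceD(1)[OF DL] Lp_spaceD(1)[OF DjL]
  have [measurable]: "T \<in> borel_measurable borel" using T(1) by (rule borel_measurable_continuous_onI)
  have [measurable]: "u \<in> borel_measurable (?M)"
    by (rule Lp_spaceD(1)[OF W1pD(1)[OF \<Omega> W1p0_imp_W1p[OF u]]])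
  have [measurable]: "\<phi> j \<in> borel_measurable (?M)" for j
    by (rule Lp_spaceD(1)[OF test_function_Lp(1)[OF \<phi> \<Omega> p0]])
  have [measurable]: "\<Psi> \<in> borel_measurable (?M)" unfolding \<Psi>_def by measurable
  have norm\<Psi>: "norm (\<Psi> x) powr p' = norm (D x) powr p" for x
  proof (cases "D x = 0")
    case False
    have "norm (\<Psi> x) = norm (D x) powr (p - 1)"
      using False by (simp add: \<Psi>_def powr_diff power2_eq_square)
    then show ?thesis by (simp add: powr_powr p')
  qed (use p0 in \<open>simp add: \<Psi>_def\<close>)
  have \<Psi>D: "\<Psi> x \<bullet> D x = norm (D x) powr p" for x
  proof (cases "D x = 0")
    case False
    then show ?thesis by (simp add: \<Psi>_def powr_diff power2_norm_eq_inner[symmetric])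
  qed (use p0 in \<open>simp add: \<Psi>_def\<close>)
  have scaled: "(\<lambda>x. g x *\<^sub>R H x) \<in> Lp_space r \<Omega>"
    if "g \<in> borel_measurable (?M)" "\<And>x. \<bar>g x\<bar> \<le> 1" "H \<in> Lp_space r \<Omega>" "0 < r"
    for g :: "real^'n \<Rightarrow> real" and H :: "real^'n \<Rightarrow> real^'n" and r
  proof -
    note H = Lp_spaceD[OF that(3)]
    have m: "(\<lambda>x. g x *\<^sub>R H x) \<in> borel_measurable (?M)" using that(1) H(1) by measurable
    have le: "norm (g x *\<^sub>R H x) powr r \<le> norm (H x) powr r" for x
      using that(2)[of x] that(4) by (intro powr_mono2) (auto intro: mult_left_le_one_le)
    have "integrable (?M) (\<lambda>x. norm (g x *\<^sub>R H x) powr r)"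
    proof (rule Bochner_Integration.integrable_bound[OF H(2)])
      show "(\<lambda>x. norm (g x *\<^sub>R H x) powr r) \<in> borel_measurable (?M)" using m by measurable
    qed (use le in simp)
    with m show ?thesis by (simp add: Lp_space_def)
  qed
  have \<Psi>L: "\<Psi> \<in> Lp_space p' \<Omega>"
    unfolding Lp_space_def using Lp_spaceD(2)[OF DL] by (auto simp: norm\<Psi>)
  have absT: "\<bar>T s\<bar> \<le> 1" "\<bar>T s - T t\<bar> \<le> 1" for s t
    using T(2)[of s] T(3)[of s] T(2)[of t] T(3)[of t] by auto
  have T\<Psi>L: "(\<lambda>x. T (u x) *\<^sub>R \<Psi> x) \<in> Lp_space p' \<Omega>"
    using p' by (intro scaled \<Psi>L absT) auto
  have d\<Psi>L: "(\<lambda>x. (T (\<phi> j x) - T (u x)) *\<^sub>R \<Psi> x) \<in> Lp_space p' \<Omega>" for j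
    using p' by (intro scaled \<Psi>L absT) auto
  note dual = dual_weak_gradient_inner[OF \<Omega> p, folded p'_def]
  define a where "a j = (LINT x|?M. \<Psi> x \<bullet> (T (\<phi> j x) *\<^sub>R Dj j x))" for j
  have TDj: "(\<lambda>x. T (\<phi> j x) *\<^sub>R Dj j x) \<in> Lp_space p \<Omega>" for j
    using p0 by (intro scaled DjL absT) auto
  \<comment> \<open>The factor \<open>T (\<phi> j x)\<close> is moved from the gradient to the test
    field, where it converges strongly. With the limit factor the test field is fixed and weak
    convergence applies; the difference is a strongly null field against bounded gradients.\<close>
  have "a \<longlonglongrightarrow> (LINT x|?M. T (u x) *\<^sub>R \<Psi> x \<bullet> D x) + 0"
  proof -
    define e where "e j = (LINT x|?M. ((T (\<phi> j x) - T (u x)) *\<^sub>R \<Psi> x) \<bullet> Dj j x)" for j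
    have "a j = (LINT x|?M. (T (u x) *\<^sub>R \<Psi> x) \<bullet> Dj j x) + e j" for j
    proof -
      have "a j = (LINT x|?M. (T (u x) *\<^sub>R \<Psi> x) \<bullet> Dj j x + ((T (\<phi> j x) - T (u x)) *\<^sub>R \<Psi> x) \<bullet> Dj j x)"
        unfolding a_def by (intro Bochner_Integration.integral_cong) (auto simp: algebra_simps)
      also have "\<dots> = (LINT x|?M. (T (u x) *\<^sub>R \<Psi> x) \<bullet> Dj j x) + e j"
        unfolding e_def by (intro Bochner_Integration.integral_add dual(2) T\<Psi>L d\<Psi>L DjL)
      finally show ?thesis .
    qed
    then have a_eq: "a = (\<lambda>j. (LINT x|?M. (T (u x) *\<^sub>R \<Psi> x) \<bullet> Dj j x) + e j)" by blast
    have lim: "(\<lambda>j. \<integral>x. (T (u x) *\<^sub>R \<Psi> x) \<bullet> Dj j x \<partial>?M) \<longlonglongrightarrow> (LINT x|?M. (T (u x) *\<^sub>R \<Psi> x) \<bullet> D x)"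
      using weak[OF dual(1)[OF T\<Psi>L]] unfolding Dj_def D_def .
    have e: "e \<longlonglongrightarrow> 0"
    proof (rule Lim_null_comparison)
      define N where "N j = Lp_norm p' \<Omega> (\<lambda>x. (T (\<phi> j x) - T (u x)) *\<^sub>R \<Psi> x)" for j
      have "norm (e j) \<le> N j * C" for j
      proof -
        have "norm (e j) \<le> N j * Lp_norm p \<Omega> (Dj j)"
          unfolding e_def N_def real_norm_def by (rule dual(3)[OF d\<Psi>L DjL])
        also have "\<dots> \<le> N j * C"
          using C[of j] by (intro mult_left_mono) (auto simp: N_def Dj_def Lp_norm_nonneg W1p0_norm_def)
        finally show ?thesis .
      qed
      then show "\<forall>\<^sub>F j in sequentially. norm (e j) \<le> N j * C" by (intro always_eventually) blast
      have "(\<lambda>j. \<integral>x. norm ((T (\<phi> j x) - T (u x)) *\<^sub>R \<Psi> x) powr p' \<partial>?M) \<longlonglongrightarrow> (LINT x|?M. 0)"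
      proof (rule integral_dominated_convergence[where w = "\<lambda>x. norm (\<Psi> x) powr p'"])
        show "integrable (?M) (\<lambda>x. norm (\<Psi> x) powr p')" by (rule Lp_spaceD(2)[OF \<Psi>L])
        show "AE x in ?M. (\<lambda>j. norm ((T (\<phi> j x) - T (u x)) *\<^sub>R \<Psi> x) powr p') \<longlonglongrightarrow> 0"
          using ae
        proof eventually_elim
          case (elim x)
          have "(\<lambda>j. T (\<phi> j x)) \<longlonglongrightarrow> T (u x)"
            using continuous_on_tendsto_compose[OF T(1) elim] by simp
          then have "(\<lambda>j. norm ((T (\<phi> j x) - T (u x)) *\<^sub>R \<Psi> x) powr p') \<longlonglongrightarrow> norm ((T (u x) - T (u x)) *\<^sub>R \<Psi> x) powr p'"
            using p' by (intro tendsto_powr' tendsto_intros) auto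
          then show ?case by simp
        qed
        show "AE x in ?M. norm (norm ((T (\<phi> j x) - T (u x)) *\<^sub>R \<Psi> x) powr p') \<le> norm (\<Psi> x) powr p'" for j
        proof (rule AE_I2)
          fix x
          have "norm ((T (\<phi> j x) - T (u x)) *\<^sub>R \<Psi> x) \<le> norm (\<Psi> x)"
            using absT(2) by (auto intro: mult_left_le_one_le)
          then show "norm (norm ((T (\<phi> j x) - T (u x)) *\<^sub>R \<Psi> x) powr p') \<le> norm (\<Psi> x) powr p'"
            using p' by (simp add: powr_mono2)
        qed
      qed measurable
      then have "(\<lambda>j. N j powr p') \<longlonglongrightarrow> 0"
        using p' by (simp add: N_def Lp_norm_powr)
      then have "(\<lambda>j. (N j powr p') powr (1 / p')) \<longlonglongrightarrow> 0 powr (1 / p')"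
        using p' by (intro tendsto_powr') auto
      then have "N \<longlonglongrightarrow> 0" using p' by (simp add: powr_powr N_def[abs_def] Lp_norm_nonneg)
      then show "(\<lambda>j. N j * C) \<longlonglongrightarrow> 0" by (rule tendsto_mult_left_zero)
    qed
    show ?thesis unfolding a_eq by (rule tendsto_add[OF lim e])
  qed
  then have a: "a \<longlonglongrightarrow> (LINT x|?M. norm (D x) powr p * T (u x))"
    by (simp add: \<Psi>D mult.commute)
  define I where "I = (LINT x|?M. norm (D x) powr p)"
  have iI: "integrable (?M) (\<lambda>x. norm (D x) powr p)" by (rule Lp_spaceD(2)[OF DL])
  show ?thesis
  \<comment> \<open>The integrated tangent inequality at \<open>D\<close>, whose inner product with
    \<open>\<Psi>\<close> has integral \<open>I\<close>.\<close>
  proof (rule that[of "\<lambda>j. I + p * (a j - I)"])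
    have i2: "integrable (?M) (\<lambda>x. norm (D x) powr p * T (u x))"
      using dual(2)[OF T\<Psi>L DL] by (simp add: \<Psi>D mult.commute)
    have eq: "(LINT x|?M. norm (D x) powr p * (1 - T (u x))) = I - (LINT x|?M. norm (D x) powr p * T (u x))"
      using iI i2 by (simp add: right_diff_distrib I_def)
    have "(\<lambda>j. I + p * (a j - I)) \<longlonglongrightarrow> I + p * ((LINT x|?M. norm (D x) powr p * T (u x)) - I)"
      by (intro tendsto_intros a)
    then show "(\<lambda>j. I + p * (a j - I)) \<longlonglongrightarrow> (LINT x|?M. norm (weak_gradient \<Omega> u x) powr p)
       - p * (LINT x|?M. norm (weak_gradient \<Omega> u x) powr p * (1 - T (u x)))"
      unfolding D_def[symmetric] eq I_def[symmetric] by (simp add: algebra_simps)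
    show "I + p * (a j - I) \<le> Lp_norm p \<Omega> (\<lambda>x. T (\<phi> j x) *\<^sub>R weak_gradient \<Omega> (\<phi> j) x) powr p" for j
    proof -
      let ?b = "\<lambda>x. T (\<phi> j x) *\<^sub>R Dj j x"
      have i3: "integrable (?M) (\<lambda>x. \<Psi> x \<bullet> ?b x)" by (rule dual(2)[OF \<Psi>L TDj])
      have "I + p * (a j - I) = (LINT x|?M. norm (D x) powr p + p * (\<Psi> x \<bullet> ?b x - norm (D x) powr p))"
        using iI i3 by (simp add: I_def a_def)
      also have "\<dots> \<le> (LINT x|?M. norm (?b x) powr p)"
      proof (rule integral_mono)
        show "norm (D x) powr p + p * (\<Psi> x \<bullet> ?b x - norm (D x) powr p) \<le> norm (?b x) powr p" for x
          using norm_powr_tangent[OF p, of "D x" "?b x", folded \<Psi>_def] unfolding inner_diff_right \<Psi>D .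
        show "integrable (?M) (\<lambda>x. norm (?b x) powr p)" by (rule Lp_spaceD(2)[OF TDj])
      qed (use iI i3 in simp)
      finally show ?thesis using p0 by (simp add: Lp_norm_powr Dj_def)
    qed
  qed
qed

subsection \<open>Lower semicontinuity\<close>

lemma primitive0_properties:
  assumes M: "continuous_on {0..} M" "\<forall>t\<ge>0. 0 \<le> M t"
  shows "0 \<le> s \<Longrightarrow> s \<le> t \<Longrightarrow> primitive0 M s \<le> primitive0 M t"
    and "0 \<le> t \<Longrightarrow> 0 \<le> primitive0 M t"
    and "X \<longlonglongrightarrow> t \<Longrightarrow> (\<And>n. 0 \<le> X n) \<Longrightarrow> (\<lambda>n. primitive0 M (X n)) \<longlonglongrightarrow> primitive0 M t"
proof -
  have i: "M integrable_on {0..t}" for t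
    using M(1) by (intro integrable_continuous_real) (auto elim: continuous_on_subset)
  show "0 \<le> s \<Longrightarrow> s \<le> t \<Longrightarrow> primitive0 M s \<le> primitive0 M t"
    unfolding primitive0_def using M(2) by (intro integral_subset_le i) auto
  show "0 \<le> t \<Longrightarrow> 0 \<le> primitive0 M t"
    unfolding primitive0_def using M(2) by (intro Henstock_Kurzweil_Integration.integral_nonneg i) auto
  assume X: "X \<longlonglongrightarrow> t" "\<And>n. 0 \<le> X n"
  have t: "0 \<le> t" using X by (intro LIMSEQ_le_const) auto
  have "continuous_on {0..t + 1} (primitive0 M)"
    unfolding primitive0_def by (rule indefinite_integral_continuous_1[OF i])
  moreover have "\<forall>\<^sub>F n in sequentially. X n < t + 1"
    using order_tendstoD(2)[OF X(1)] by simp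
  then have "\<forall>\<^sub>F n in sequentially. X n \<in> {0..t + 1}"
    by eventually_elim (use X(2) in \<open>auto intro: less_imp_le\<close>)
  ultimately show "(\<lambda>n. primitive0 M (X n)) \<longlonglongrightarrow> primitive0 M t"
    using X(1) t by (intro continuous_on_tendsto_compose[of "{0..t + 1}" "primitive0 M"]) auto
qed

text \<open>An infimum of reals lies below its terms only if these are bounded below, here by 0. The
  inequality is multiplied out so that it extends to \<open>t = 0\<close>, where the quotient
  carries no information.\<close>

lemma primitive0_growth:
  assumes M: "continuous_on {0..} M" "\<forall>t\<ge>0. 0 \<le> M t"
    and growth: "(INF t\<in>{0<..}. primitive0 M t / t powr r) \<ge> c" and t: "0 \<le> t" and r: "0 < r"
  shows "c * t powr r \<le> primitive0 M t"
proof (cases "t = 0")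
  case False
  then have t: "0 < t" using t by simp
  have "bdd_below ((\<lambda>t. primitive0 M t / t powr r) ` {0<..})"
    using primitive0_properties(2)[OF M] by (intro bdd_belowI2[of _ 0]) auto
  then have "(INF t\<in>{0<..}. primitive0 M t / t powr r) \<le> primitive0 M t / t powr r"
    using t by (intro cINF_lower) auto
  with growth have "c \<le> primitive0 M t / t powr r" by simp
  then show ?thesis using t by (simp add: le_divide_eq)
next
  case True
  then show ?thesis using r primitive0_properties(2)[OF M, of 0] by simp
qed

text \<open>\<open>A\<close> is the factor by which \<open>c\<close> exceeds the optimal constant; all that matters is \<open>1 < A\<close>.\<close>

locale kirchhoff =
  fixes p q c A S :: real and \<Omega> :: "(real^'n) set" and M P :: "real \<Rightarrow> real"
  assumes p: "1 < p" "p < real CARD('n)" and q: "q = critical_exponent CARD('n) p"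
    and \<Omega>: "bounded \<Omega>" "open \<Omega>" "\<Omega> \<noteq> {}"
    and P_eq: "P = primitive0 M"
    and P_mono: "\<And>s t. 0 \<le> s \<Longrightarrow> s \<le> t \<Longrightarrow> P s \<le> P t"
    and P_tendsto: "\<And>X t. X \<longlonglongrightarrow> t \<Longrightarrow> (\<And>n::nat. 0 \<le> X n) \<Longrightarrow> (\<lambda>n. P (X n)) \<longlonglongrightarrow> P t"
    and P_add: "\<And>s t. 0 \<le> s \<Longrightarrow> 0 \<le> t \<Longrightarrow> P s + P t \<le> P (s + t)"
    and P_growth: "\<And>t. 0 \<le> t \<Longrightarrow> c * t powr (q / p) \<le> P t"
    and S: "S = sobolev_constant p \<Omega>"
    and A: "1 < A" and c: "c = A * (p / q) * S powr (- (q / p))"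
begin

section \<open>Coercivity and the Sobolev inequality in energy form\<close>

lemma p0: "0 < p" and q1: "1 < q" and q0: "0 < q" and pq: "p < q"
  using p critical_exponent_gt[OF p] q by auto

lemma S_pos: "0 < S"
  using sobolev_constant_properties(1)[OF \<Omega>(2,3) p q] S by simp

lemma W1p0_Lq: "u \<in> W1p0 p \<Omega> \<Longrightarrow> u \<in> Lp_space q \<Omega>"
  using sobolev_constant_properties(2)[OF \<Omega>(2,3) p q] .

lemma Sobolev_powr:
  assumes "u \<in> W1p0 p \<Omega>"
  shows "Lp_norm q \<Omega> u powr q \<le> S powr (- (q / p)) * (W1p0_norm p \<Omega> u powr p) powr (q / p)"
proof -
  have "(Lp_norm q \<Omega> u powr p) powr (q / p) \<le> (inverse S * W1p0_norm p \<Omega> u powr p) powr (q / p)"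
    using sobolev_constant_properties(3)[OF \<Omega>(2,3) p q assms] p0 q0 S by (intro powr_mono2) auto
  also have "\<dots> = S powr (- (q / p)) * (W1p0_norm p \<Omega> u powr p) powr (q / p)"
    using S_pos by (simp add: powr_mult powr_minus inverse_powr)
  finally show ?thesis using p0 by (simp add: powr_powr)
qed

abbreviation E where "E \<equiv> kirchhoff_energy p \<Omega> M"

lemma E_eq: "E u = P (W1p0_norm p \<Omega> u powr p) / p - Lp_norm q \<Omega> u powr q / q"
  by (simp add: kirchhoff_energy_def q Let_def P_eq)

text \<open>This is what the normalisation of \<open>c\<close> is for: \<open>p / q\<close> converts
  the weight \<open>1 / p\<close> of the gradient term into the weight \<open>1 / q\<close> of the
  critical term, the power of \<open>S\<close> matches the Sobolev inequality, and the surplus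
  \<open>A\<close> is left over.\<close>

lemma growth_Sobolev:
  assumes "u \<in> W1p0 p \<Omega>"
  shows "A / q * Lp_norm q \<Omega> u powr q \<le> P (W1p0_norm p \<Omega> u powr p) / p"
proof -
  have "A / q * Lp_norm q \<Omega> u powr q \<le> A / q * (S powr (- (q / p)) * (W1p0_norm p \<Omega> u powr p) powr (q / p))"
    using A q0 by (intro mult_left_mono Sobolev_powr assms) auto
  also have "\<dots> = c * (W1p0_norm p \<Omega> u powr p) powr (q / p) / p"
    using p0 by (simp add: c)
  also have "\<dots> \<le> P (W1p0_norm p \<Omega> u powr p) / p"
    using p0 by (intro divide_right_mono P_growth) auto
  finally show ?thesis .
qed

text \<open>Coercivity: the energy is at least \<open>(A - 1) / q * S powr (- (q / p))\<close> times
  the \<open>q\<close>-th power of the norm, a positive multiple thanks to the surplus in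
  \<open>A\<close>. The absolute value admits negative levels \<open>a\<close>.\<close>

lemma energy_bound_imp_norm_bound:
  obtains C where "\<And>u. u \<in> W1p0 p \<Omega> \<Longrightarrow> E u \<le> a \<Longrightarrow> W1p0_norm p \<Omega> u \<le> C"
proof (rule that[of "((\<bar>a\<bar> / ((A - 1) / q * S powr (- (q / p)))) powr (1 / q))"])
  fix u assume u: "u \<in> W1p0 p \<Omega>" and a: "E u \<le> a"
  define X where "X = W1p0_norm p \<Omega> u"
  have X: "0 \<le> X" by (simp add: X_def W1p0_norm_nonneg)
  have Xq: "(X powr p) powr (q / p) = X powr q" using p0 by (simp add: powr_powr)
  define d where "d = (A - 1) / q * S powr (- (q / p))"
  have d: "0 < d" using A q0 S_pos by (simp add: d_def)
  have "Lp_norm q \<Omega> u powr q / q \<le> S powr (- (q / p)) * X powr q / q"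
    using Sobolev_powr[OF u] q0 Xq by (intro divide_right_mono) (auto simp: X_def)
  moreover have "A / q * S powr (- (q / p)) * X powr q \<le> P (X powr p) / p"
    using P_growth[of "X powr p"] p0 q0 by (simp add: c Xq field_simps)
  moreover have "d * X powr q = A / q * S powr (- (q / p)) * X powr q - S powr (- (q / p)) * X powr q / q"
    by (simp add: d_def diff_divide_distrib left_diff_distrib)
  ultimately have "d * X powr q \<le> \<bar>a\<bar>"
    using a abs_ge_self[of a] unfolding E_eq X_def[symmetric] by linarith
  then have "X powr q \<le> \<bar>a\<bar> / d" using d by (simp add: le_divide_eq mult.commute)
  then have "(X powr q) powr (1 / q) \<le> (\<bar>a\<bar> / d) powr (1 / q)"
    using q0 by (intro powr_mono2[of "1 / q" "X powr q"]) auto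
  then show "W1p0_norm p \<Omega> u \<le> (\<bar>a\<bar> / ((A - 1) / q * S powr (- (q / p)))) powr (1 / q)"
    using X q0 unfolding X_def[symmetric] d_def[symmetric] by (simp add: powr_powr)
qed

lemma energy_truncation_bound:
  assumes \<phi>: "\<phi> \<in> test_functions \<Omega>" and k: "0 < k" and L: "0 < L"
    "\<And>s. \<bar>s\<bar> powr q \<le> (min \<bar>s\<bar> (L * k)) powr q + A * \<bar>s - trunc k s\<bar> powr q"
  shows "P (Lp_norm p \<Omega> (\<lambda>x. trunc' k (\<phi> x) *\<^sub>R weak_gradient \<Omega> \<phi> x) powr p) / p
    - (LINT x|lebesgue_on \<Omega>. (min \<bar>\<phi> x\<bar> (L * k)) powr q) / q \<le> E \<phi>"
proof -
  let ?M = "lebesgue_on \<Omega>"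
  note tf = test_functions_trunc[OF \<phi> k]
  define R where "R = (\<lambda>x. \<phi> x - trunc k (\<phi> x))"
  have R: "R \<in> test_functions \<Omega>" unfolding R_def by (rule tf(3))
  have RW: "R \<in> W1p0 p \<Omega>" by (rule test_function_W1p0[OF \<Omega>(2) p(1) R])
  define g where "g = grad \<phi>"
  have gT: "grad (\<lambda>x. trunc k (\<phi> x)) = (\<lambda>x. trunc' k (\<phi> x) *\<^sub>R g x)"
    using tf(2) by (auto simp: g_def)
  have gR: "grad R = (\<lambda>x. (1 - trunc' k (\<phi> x)) *\<^sub>R g x)"
    using tf(4) by (auto simp: g_def R_def)
  note gTL = test_function_Lp(2)[OF tf(1) \<Omega>(2) p0, unfolded gT]
  note gRL = test_function_Lp(2)[OF R \<Omega>(2) p0, unfolded gR]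
  note gL = test_function_Lp(2)[OF \<phi> \<Omega>(2) p0, folded g_def]
  have ae: "AE x in ?M. trunc' k (\<phi> x) *\<^sub>R g x = trunc' k (\<phi> x) *\<^sub>R weak_gradient \<Omega> \<phi> x"
    using test_function_W1p(2)[OF \<Omega>(2) p0 \<phi>] by eventually_elim (simp add: g_def)
  define t where "t = Lp_norm p \<Omega> (\<lambda>x. trunc' k (\<phi> x) *\<^sub>R weak_gradient \<Omega> \<phi> x) powr p"
  have t: "t = (LINT x|?M. norm (trunc' k (\<phi> x) *\<^sub>R g x) powr p)"
    unfolding t_def Lp_cong_AE(2)[OF gTL \<Omega>(2) ae] by (rule Lp_norm_powr[OF p0])
  define r where "r = W1p0_norm p \<Omega> R powr p"
  have r: "r = (LINT x|?M. norm ((1 - trunc' k (\<phi> x)) *\<^sub>R g x) powr p)"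
    unfolding r_def test_function_W1p(3)[OF \<Omega>(2) p0 R] gR by (rule Lp_norm_powr[OF p0])
  have "t + r = (LINT x|?M. norm (trunc' k (\<phi> x) *\<^sub>R g x) powr p + norm ((1 - trunc' k (\<phi> x)) *\<^sub>R g x) powr p)"
    unfolding t r using Lp_spaceD(2)[OF gTL] Lp_spaceD(2)[OF gRL] by simp
  also have "\<dots> \<le> (LINT x|?M. norm (g x) powr p)"
  proof (rule integral_mono)
    show "norm (trunc' k (\<phi> x) *\<^sub>R g x) powr p + norm ((1 - trunc' k (\<phi> x)) *\<^sub>R g x) powr p \<le> norm (g x) powr p" for x
    proof -
      let ?s = "trunc' k (\<phi> x)"
      have "norm (?s *\<^sub>R g x) powr p + norm ((1 - ?s) *\<^sub>R g x) powr p = (?s powr p + (1 - ?s) powr p) * norm (g x) powr p"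
        using trunc'_bounds[of k "\<phi> x"] by (simp add: powr_mult distrib_right)
      also have "\<dots> \<le> 1 * norm (g x) powr p"
        using powr_add_powr_le_1[OF trunc'_bounds, of p k "\<phi> x"] p(1) by (intro mult_right_mono) auto
      finally show ?thesis by simp
    qed
  qed (use Lp_spaceD(2)[OF gTL] Lp_spaceD(2)[OF gRL] Lp_spaceD(2)[OF gL] in auto)
  also have "\<dots> = W1p0_norm p \<Omega> \<phi> powr p"
    unfolding test_function_W1p(3)[OF \<Omega>(2) p0 \<phi>] g_def by (rule Lp_norm_powr[OF p0, symmetric])
  finally have tr: "t + r \<le> W1p0_norm p \<Omega> \<phi> powr p" .
  have tr0: "0 \<le> t" "0 \<le> r" by (simp_all add: t_def r_def)
  have "P t + P r \<le> P (W1p0_norm p \<Omega> \<phi> powr p)"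
    using P_add[OF tr0] P_mono[OF _ tr] tr0 by simp
  then have "(P t + P r) / p \<le> P (W1p0_norm p \<Omega> \<phi> powr p) / p"
    using p0 by (intro divide_right_mono) auto
  \<comment> \<open>The energy of the remainder \<open>R\<close> is traded for \<open>A / q\<close>
    times its critical term, precisely what the comparison of \<open>\<bar>s\<bar> powr q\<close>
    with its truncation costs below.\<close>
  then have 1: "P t / p + A / q * Lp_norm q \<Omega> R powr q \<le> P (W1p0_norm p \<Omega> \<phi> powr p) / p"
    using growth_Sobolev[OF RW] unfolding r_def[symmetric] add_divide_distrib by linarith
  obtain K where K: "smooth_on UNIV \<phi>" "compact K" "K \<subseteq> \<Omega>" "\<And>x. x \<notin> K \<Longrightarrow> \<phi> x = 0"
    using \<phi> by (rule test_functionsE) blast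
  have mc: "continuous_on UNIV (\<lambda>x. min \<bar>\<phi> x\<bar> (L * k))"
    by (intro continuous_intros smooth_on_continuous K)
  have "min \<bar>\<phi> x\<bar> (L * k) = 0" if "x \<notin> K" for x using K(4)[OF that] L(1) k by simp
  have mn: "norm (min \<bar>s\<bar> (L * k)) = min \<bar>s\<bar> (L * k)" for s using L(1) k by simp
  note mL = Lp_spaceD(2)[OF continuous_compact_support_Lp(1)[OF mc K(2,3) \<open>\<And>x. x \<notin> K \<Longrightarrow> min \<bar>\<phi> x\<bar> (L * k) = 0\<close> \<Omega>(2) q0], unfolded mn]
  note RL = Lp_spaceD(2)[OF test_function_Lp(1)[OF R \<Omega>(2) q0]]
  note \<phi>L = Lp_spaceD(2)[OF test_function_Lp(1)[OF \<phi> \<Omega>(2) q0]]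
  have "Lp_norm q \<Omega> \<phi> powr q \<le> (LINT x|?M. (min \<bar>\<phi> x\<bar> (L * k)) powr q + A * norm (R x) powr q)"
    unfolding Lp_norm_powr[OF q0] using \<phi>L mL RL L(2)
    by (intro integral_mono) (auto simp: R_def)
  also have "\<dots> = (LINT x|?M. (min \<bar>\<phi> x\<bar> (L * k)) powr q) + A * Lp_norm q \<Omega> R powr q"
    unfolding Lp_norm_powr[OF q0] using mL RL by simp
  finally have "Lp_norm q \<Omega> \<phi> powr q / q \<le> ((LINT x|?M. (min \<bar>\<phi> x\<bar> (L * k)) powr q) + A * Lp_norm q \<Omega> R powr q) / q"
    using q0 by (intro divide_right_mono) auto
  then show ?thesis
    using 1 unfolding E_eq t_def[symmetric] by (simp add: add_divide_distrib)
qed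

text \<open>The energy is continuous along the approximating test functions, by the Sobolev
  inequality and continuity of the primitive. Passing to test functions gives the truncations
  classical gradients.\<close>

lemma test_function_approx:
  assumes w: "w \<in> W1p0 p \<Omega>" and a: "E w < a" and e: "0 < e"
  obtains \<phi> where "\<phi> \<in> test_functions \<Omega>" "E \<phi> < a" "W1p0_norm p \<Omega> (\<lambda>x. w x + (-1) * \<phi> x) < e"
proof -
  obtain \<phi> where \<phi>: "\<And>k::nat. \<phi> k \<in> test_functions \<Omega>"
    "(\<lambda>k. Lp_norm p \<Omega> (\<lambda>x. w x + (-1) * \<phi> k x)) \<longlonglongrightarrow> 0"
    "(\<lambda>k. W1p0_norm p \<Omega> (\<lambda>x. w x + (-1) * \<phi> k x)) \<longlonglongrightarrow> 0"
    using W1p0_approx[OF \<Omega>(2) p(1) w] by blast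
  note \<phi>W = test_function_W1p0[OF \<Omega>(2) p(1) \<phi>(1)]
  have n: "(\<lambda>k. W1p0_norm p \<Omega> (\<phi> k)) \<longlonglongrightarrow> W1p0_norm p \<Omega> w"
    by (rule W1p0_norm_tendsto[OF \<Omega>(2) p(1) W1p0_imp_W1p[OF w] W1p0_imp_W1p[OF \<phi>W] \<phi>(3)])
  obtain C where C: "0 \<le> C" "\<And>u. u \<in> W1p0 p \<Omega> \<Longrightarrow> u \<in> Lp_space q \<Omega> \<and> Lp_norm q \<Omega> u \<le> C * W1p0_norm p \<Omega> u"
    using W1p0_Sobolev[OF \<Omega>(2) p q] by blast
  have d: "(\<lambda>x. w x + (-1) * \<phi> k x) \<in> W1p0 p \<Omega>" for k
    by (rule W1p0_add_cmult[OF \<Omega>(2) p(1) w \<phi>W])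
  have lim: "(\<lambda>k. Lp_norm q \<Omega> (\<lambda>x. w x + (-1) * \<phi> k x)) \<longlonglongrightarrow> 0"
  proof (rule Lim_null_comparison)
    show "\<forall>\<^sub>F k in sequentially. norm (Lp_norm q \<Omega> (\<lambda>x. w x + (-1) * \<phi> k x)) \<le> C * W1p0_norm p \<Omega> (\<lambda>x. w x + (-1) * \<phi> k x)"
    proof (intro always_eventually allI)
      fix k
      show "norm (Lp_norm q \<Omega> (\<lambda>x. w x + (-1) * \<phi> k x)) \<le> C * W1p0_norm p \<Omega> (\<lambda>x. w x + (-1) * \<phi> k x)"
        unfolding real_norm_def abs_of_nonneg[OF Lp_norm_nonneg] using C(2)[OF d[of k]] by blast
    qed
    show "(\<lambda>k. C * W1p0_norm p \<Omega> (\<lambda>x. w x + (-1) * \<phi> k x)) \<longlonglongrightarrow> 0"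
      by (rule tendsto_mult_right_zero[OF \<phi>(3)])
  qed
  have m: "(\<lambda>k. Lp_norm q \<Omega> (\<phi> k)) \<longlonglongrightarrow> Lp_norm q \<Omega> w"
    using lim by (intro Lp_norm_tendsto[OF q1 W1p0_Lq[OF \<phi>W] W1p0_Lq[OF w]]) simp
  have "(\<lambda>k. E (\<phi> k)) \<longlonglongrightarrow> E w"
    unfolding E_eq using p0 q0
    by (intro tendsto_diff tendsto_divide P_tendsto tendsto_powr' n m tendsto_const) (auto simp: Lp_norm_nonneg W1p0_norm_nonneg)
  then have "\<forall>\<^sub>F k in sequentially. E (\<phi> k) < a" using a by (rule order_tendstoD)
  moreover have "\<forall>\<^sub>F k in sequentially. W1p0_norm p \<Omega> (\<lambda>x. w x + (-1) * \<phi> k x) < e"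
    using \<phi>(3) e by (rule order_tendstoD)
  ultimately have "\<forall>\<^sub>F k in sequentially. E (\<phi> k) < a \<and> W1p0_norm p \<Omega> (\<lambda>x. w x + (-1) * \<phi> k x) < e"
    by eventually_elim simp
  then obtain k where "E (\<phi> k) < a" "W1p0_norm p \<Omega> (\<lambda>x. w x + (-1) * \<phi> k x) < e"
    by (auto simp: eventually_sequentially)
  then show ?thesis using that[OF \<phi>(1)] by blast
qed

lemma dual_diff:
  assumes l: "l \<in> W1p0_dual p \<Omega>" and u: "u \<in> W1p0 p \<Omega>" and v: "v \<in> W1p0 p \<Omega>"
  shows "l (\<lambda>x. u x + (-1) * v x) = l u - l v"
proof -
  have add: "\<forall>u\<in>W1p0 p \<Omega>. \<forall>v\<in>W1p0 p \<Omega>. l (\<lambda>x. u x + v x) = l u + l v"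
    and mult: "\<forall>c. \<forall>u\<in>W1p0 p \<Omega>. l (\<lambda>x. c * u x) = c * l u"
    using l by (simp_all add: W1p0_dual_def)
  have "(\<lambda>x. (-1) * v x) \<in> W1p0 p \<Omega>"
    using W1p0_add_cmult[OF \<Omega>(2) p(1) test_function_W1p0[OF \<Omega>(2) p(1) test_functions_zero] v, of "-1"] by simp
  then have "l (\<lambda>x. u x + (-1) * v x) = l u + l (\<lambda>x. (-1) * v x)"
    by (rule bspec[OF bspec[OF add u]])
  also have "l (\<lambda>x. (-1) * v x) = (-1) * l v"
    by (rule bspec[OF spec[OF mult] v])
  finally show ?thesis by simp
qed

text \<open>The compactness argument needs test functions with weak limit 0, but \<open>u\<close>
  need not be a test function. Subtracting test functions \<open>\<eta> j\<close> that converge to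
  \<open>u\<close> in norm leaves a bounded, weakly null sequence of test functions and an error
  that tends to 0 in \<open>L\<^sup>1\<close>.\<close>

lemma weakly_convergent_test_functions_AE_subseq:
  assumes u: "u \<in> W1p0 p \<Omega>" and \<phi>: "\<And>j. \<phi> j \<in> test_functions \<Omega>" and C: "\<And>j::nat. W1p0_norm p \<Omega> (\<phi> j) \<le> C"
    and weak: "\<And>l. l \<in> W1p0_dual p \<Omega> \<Longrightarrow> (\<lambda>j. l (\<phi> j)) \<longlonglongrightarrow> l u"
  obtains r :: "nat \<Rightarrow> nat" where "strict_mono r" "AE x in lebesgue_on \<Omega>. (\<lambda>j. \<phi> (r j) x) \<longlonglongrightarrow> u x"
proof -
  let ?M = "lebesgue_on \<Omega>"
  obtain \<eta> where \<eta>: "\<And>k::nat. \<eta> k \<in> test_functions \<Omega>"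
    "(\<lambda>k. Lp_norm p \<Omega> (\<lambda>x. u x + (-1) * \<eta> k x)) \<longlonglongrightarrow> 0"
    "(\<lambda>k. W1p0_norm p \<Omega> (\<lambda>x. u x + (-1) * \<eta> k x)) \<longlonglongrightarrow> 0"
    using W1p0_approx[OF \<Omega>(2) p(1) u] by blast
  note \<phi>W = test_function_W1p0[OF \<Omega>(2) p(1) \<phi>] and \<eta>W = test_function_W1p0[OF \<Omega>(2) p(1) \<eta>(1)]
  define \<psi> where "\<psi> j x = \<phi> j x + (-1) * \<eta> j x" for j x
  have \<psi>: "\<psi> j \<in> test_functions \<Omega>" for j
    unfolding \<psi>_def[abs_def] by (rule test_functions_add_cmult(1)[OF \<phi> \<eta>(1)])
  have "convergent (\<lambda>k. W1p0_norm p \<Omega> (\<eta> k))"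
    using W1p0_norm_tendsto[OF \<Omega>(2) p(1) W1p0_imp_W1p[OF u] W1p0_imp_W1p[OF \<eta>W] \<eta>(3)] by (rule convergentI)
  then obtain C' where C': "\<And>k. norm (W1p0_norm p \<Omega> (\<eta> k)) \<le> C'"
    by (elim BseqE[OF convergent_imp_Bseq]) blast
  have "(\<lambda>n. \<integral>x. norm (\<psi> n x) \<partial>?M) \<longlonglongrightarrow> 0"
  proof (rule weakly_null_imp_L1_null[OF \<Omega>(1,2) p \<psi>, where C = "C + C'"])
    show "W1p0_norm p \<Omega> (\<psi> n) \<le> C + C'" for n
      using W1p0_norm_add_cmult_le[OF \<Omega>(2) p(1) W1p0_imp_W1p[OF \<phi>W] W1p0_imp_W1p[OF \<eta>W], of n "-1" n] C[of n] C'[of n]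
      unfolding \<psi>_def[abs_def] by simp
    fix l assume l: "l \<in> W1p0_dual p \<Omega>"
    obtain D where D: "\<And>v. v \<in> W1p0 p \<Omega> \<Longrightarrow> \<bar>l v\<bar> \<le> D * W1p0_norm p \<Omega> v"
      using l unfolding W1p0_dual_def by blast
    have d: "(\<lambda>x. u x + (-1) * \<eta> k x) \<in> W1p0 p \<Omega>" for k
      by (rule W1p0_add_cmult[OF \<Omega>(2) p(1) u \<eta>W])
    have "(\<lambda>k. l (\<lambda>x. u x + (-1) * \<eta> k x)) \<longlonglongrightarrow> 0"
      using D[OF d] by (intro Lim_null_comparison[OF _ tendsto_mult_right_zero[OF \<eta>(3), of D]] always_eventually) simp
    then have "(\<lambda>k. (l (\<phi> k) - l u) + l (\<lambda>x. u x + (-1) * \<eta> k x)) \<longlonglongrightarrow> (l u - l u) + 0"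
      by (intro tendsto_add tendsto_diff weak[OF l] tendsto_const)
    moreover have "(l (\<phi> k) - l u) + l (\<lambda>x. u x + (-1) * \<eta> k x) = l (\<psi> k)" for k
      unfolding \<psi>_def[abs_def] dual_diff[OF l u \<eta>W] dual_diff[OF l \<phi>W \<eta>W] by simp
    ultimately show "(\<lambda>n. l (\<psi> n)) \<longlonglongrightarrow> 0" by simp
  qed
  moreover have "(\<lambda>n. \<integral>x. norm (u x + (-1) * \<eta> n x) \<partial>?M) \<longlonglongrightarrow> 0"
  proof (rule Lim_null_comparison)
    have dL: "(\<lambda>x. u x + (-1) * \<eta> k x) \<in> Lp_space p \<Omega>" for k
      by (rule W1pD(1)[OF \<Omega>(2) W1p0_imp_W1p[OF W1p0_add_cmult[OF \<Omega>(2) p(1) u \<eta>W]]])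
    show "\<forall>\<^sub>F n in sequentially. norm (LINT x|?M. norm (u x + (-1) * \<eta> n x))
        \<le> measure (?M) \<Omega> powr (1 - 1 / p) * Lp_norm p \<Omega> (\<lambda>x. u x + (-1) * \<eta> n x)"
      using Lp_imp_L1(2)[OF \<Omega>(1,2) p(1) dL] by (intro always_eventually allI) (simp add: abs_of_nonneg)
    show "(\<lambda>n. measure (?M) \<Omega> powr (1 - 1 / p) * Lp_norm p \<Omega> (\<lambda>x. u x + (-1) * \<eta> n x)) \<longlonglongrightarrow> 0"
      by (rule tendsto_mult_right_zero[OF \<eta>(2)])
  qed
  ultimately have lim: "(\<lambda>n. (LINT x|?M. norm (\<psi> n x)) + (LINT x|?M. norm (u x + (-1) * \<eta> n x))) \<longlonglongrightarrow> 0"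
    using tendsto_add by fastforce
  have i1: "integrable (?M) (\<psi> n)" for n
    by (rule Lp_imp_L1(1)[OF \<Omega>(1,2) p(1) test_function_Lp(1)[OF \<psi> \<Omega>(2) p0]])
  have i2: "integrable (?M) (\<lambda>x. u x + (-1) * \<eta> n x)" for n
    by (rule Lp_imp_L1(1)[OF \<Omega>(1,2) p(1) W1pD(1)[OF \<Omega>(2) W1p0_imp_W1p[OF W1p0_add_cmult[OF \<Omega>(2) p(1) u \<eta>W]]]])
  have eq: "\<phi> n x - u x = \<psi> n x - (u x + (-1) * \<eta> n x)" for n x by (simp add: \<psi>_def)
  have i3: "integrable (?M) (\<lambda>x. \<phi> n x - u x)" for n
    unfolding eq by (intro Bochner_Integration.integrable_diff i1 i2)
  have "(\<lambda>n. \<integral>x. norm (\<phi> n x - u x) \<partial>?M) \<longlonglongrightarrow> 0"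
  proof (rule Lim_null_comparison[OF _ lim])
    have "(LINT x|?M. norm (\<phi> n x - u x))
      \<le> (LINT x|?M. norm (\<psi> n x)) + (LINT x|?M. norm (u x + (-1) * \<eta> n x))" for n
    proof -
      note i = integrable_norm[OF i1[of n]] integrable_norm[OF i2[of n]]
      have "(LINT x|?M. norm (\<phi> n x - u x)) \<le> (LINT x|?M. norm (\<psi> n x) + norm (u x + (-1) * \<eta> n x))"
        by (rule integral_mono[OF integrable_norm[OF i3] Bochner_Integration.integrable_add[OF i]])
          (unfold eq, rule norm_triangle_ineq4)
      also have "\<dots> = (LINT x|?M. norm (\<psi> n x)) + (LINT x|?M. norm (u x + (-1) * \<eta> n x))"
        by (rule Bochner_Integration.integral_add[OF i])
      finally show ?thesis .
    qed
    then show "\<forall>\<^sub>F n in sequentially. norm (LINT x|?M. norm (\<phi> n x - u x))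
      \<le> (LINT x|?M. norm (\<psi> n x)) + (LINT x|?M. norm (u x + (-1) * \<eta> n x))"
      by (intro always_eventually allI) (simp add: abs_of_nonneg)
  qed
  from tendsto_L1_AE_subseq[OF i3 this]
  obtain r :: "nat \<Rightarrow> nat" where r: "strict_mono r" "AE x in ?M. (\<lambda>n. \<phi> (r n) x - u x) \<longlonglongrightarrow> 0"
    by blast
  from r(2) have "AE x in ?M. (\<lambda>n. \<phi> (r n) x) \<longlonglongrightarrow> u x"
    by eventually_elim (simp add: LIM_zero_iff)
  with r(1) show ?thesis by (rule that)
qed

text \<open>The limit \<open>j \<rightarrow> \<infinity>\<close> at a fixed level \<open>k\<close>.
  The lower bounds \<open>b j\<close> and their limit may be negative, where nothing is known about
  \<open>P\<close>; hence \<open>max 0\<close>.\<close>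

lemma truncated_energy_le:
  assumes u: "u \<in> W1p0 p \<Omega>" and \<phi>: "\<And>j::nat. \<phi> j \<in> test_functions \<Omega>"
    and C: "\<And>j. W1p0_norm p \<Omega> (\<phi> j) \<le> C"
    and weak: "\<And>l. l \<in> W1p0_dual p \<Omega> \<Longrightarrow> (\<lambda>j. l (\<phi> j)) \<longlonglongrightarrow> l u"
    and ae: "AE x in lebesgue_on \<Omega>. (\<lambda>j. \<phi> j x) \<longlonglongrightarrow> u x"
    and E: "\<And>j. E (\<phi> j) \<le> a" and k: "0 < k"
  shows "P (max 0 ((LINT x|lebesgue_on \<Omega>. norm (weak_gradient \<Omega> u x) powr p)
       - p * (LINT x|lebesgue_on \<Omega>. norm (weak_gradient \<Omega> u x) powr p * (1 - trunc' k (u x))))) / p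
     - Lp_norm q \<Omega> u powr q / q \<le> a"
proof -
  let ?M = "lebesgue_on \<Omega>"
  interpret fm: finite_measure "?M" by (rule finite_measure_lebesgue_on[OF \<Omega>(1,2)])
  obtain L :: real where L: "0 < L"
    "\<And>k s. 0 < k \<Longrightarrow> \<bar>s\<bar> powr q \<le> (min \<bar>s\<bar> (L * k)) powr q + A * \<bar>s - trunc k s\<bar> powr q"
    using abs_powr_le_trunc_remainder[OF A q0] by blast
  define \<tau> where "\<tau> = (LINT x|?M. norm (weak_gradient \<Omega> u x) powr p)
       - p * (LINT x|?M. norm (weak_gradient \<Omega> u x) powr p * (1 - trunc' k (u x)))"
  obtain b where b: "b \<longlonglongrightarrow> \<tau>"
    "\<And>j. b j \<le> Lp_norm p \<Omega> (\<lambda>x. trunc' k (\<phi> j x) *\<^sub>R weak_gradient \<Omega> (\<phi> j) x) powr p"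
  proof -
    show thesis
    proof (rule truncated_gradient_liminf[OF \<Omega>(2) p(1) u \<phi> weak ae C continuous_trunc'[of k] trunc'_bounds[of k]])
      fix b
      assume "b \<longlonglongrightarrow> (LINT x|?M. norm (weak_gradient \<Omega> u x) powr p)
       - p * (LINT x|?M. norm (weak_gradient \<Omega> u x) powr p * (1 - trunc' k (u x)))"
        and "\<And>j. b j \<le> Lp_norm p \<Omega> (\<lambda>x. trunc' k (\<phi> j x) *\<^sub>R weak_gradient \<Omega> (\<phi> j) x) powr p"
      then show thesis by (intro that[of b]) (simp_all only: \<tau>_def)
    qed
  qed
  let ?I = "\<lambda>v. \<integral>x. (min \<bar>v x\<bar> (L * k)) powr q \<partial>?M"
  note uL = Lp_spaceD[OF W1p0_Lq[OF u]]
  have [measurable]: "u \<in> borel_measurable (?M)" by (rule uL(1))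
  have [measurable]: "\<phi> j \<in> borel_measurable (?M)" for j
    by (rule Lp_spaceD(1)[OF test_function_Lp(1)[OF \<phi> \<Omega>(2) p0]])
  have Lk: "0 < L * k" using L(1) k by simp
  have "(\<lambda>j. ?I (\<phi> j)) \<longlonglongrightarrow> ?I u"
  proof (rule integral_dominated_convergence[where w = "\<lambda>_. (L * k) powr q"])
    show "AE x in ?M. (\<lambda>j. (min \<bar>\<phi> j x\<bar> (L * k)) powr q) \<longlonglongrightarrow> (min \<bar>u x\<bar> (L * k)) powr q"
      using ae
    proof eventually_elim
      case (elim x)
      then show ?case
        using q0 Lk by (intro tendsto_powr' tendsto_min tendsto_rabs tendsto_const) auto
    qed
    show "AE x in ?M. norm ((min \<bar>\<phi> j x\<bar> (L * k)) powr q) \<le> (L * k) powr q" for j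
      using q0 Lk by (intro AE_I2) (auto intro!: powr_mono2)
  qed auto
  moreover have "(\<lambda>j. P (max 0 (b j))) \<longlonglongrightarrow> P (max 0 \<tau>)"
    by (intro P_tendsto tendsto_max tendsto_const b(1)) auto
  ultimately have lim: "(\<lambda>j. P (max 0 (b j)) / p - ?I (\<phi> j) / q) \<longlonglongrightarrow> P (max 0 \<tau>) / p - ?I u / q"
    using p0 q0 by (intro tendsto_diff tendsto_divide tendsto_const) auto
  have "P (max 0 (b j)) / p - ?I (\<phi> j) / q \<le> a" for j
  proof -
    have "P (max 0 (b j)) \<le> P (Lp_norm p \<Omega> (\<lambda>x. trunc' k (\<phi> j x) *\<^sub>R weak_gradient \<Omega> (\<phi> j) x) powr p)"
      using b(2)[of j] by (intro P_mono) auto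
    then have "P (max 0 (b j)) / p \<le> P (Lp_norm p \<Omega> (\<lambda>x. trunc' k (\<phi> j x) *\<^sub>R weak_gradient \<Omega> (\<phi> j) x) powr p) / p"
      using p0 by (intro divide_right_mono) auto
    with energy_truncation_bound[OF \<phi>[of j] k L(1) L(2)[OF k]] E[of j] show ?thesis by linarith
  qed
  then have 1: "P (max 0 \<tau>) / p - ?I u / q \<le> a"
    by (intro LIMSEQ_le_const2[OF lim]) auto
  \<comment> \<open>After the limit the cut in the critical term may be removed, since enlarging
    this term only lowers the left-hand side.\<close>
  have "?I u \<le> Lp_norm q \<Omega> u powr q"
    unfolding Lp_norm_powr[OF q0]
  proof (rule integral_mono)
    show "integrable (?M) (\<lambda>x. (min \<bar>u x\<bar> (L * k)) powr q)"
      using q0 Lk by (intro fm.integrable_const_bound[where B = "(L * k) powr q"] AE_I2) (auto intro!: powr_mono2)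
    show "(min \<bar>u x\<bar> (L * k)) powr q \<le> norm (u x) powr q" for x
      using q0 Lk by (intro powr_mono2) auto
  qed (rule uL(2))
  then have "?I u / q \<le> Lp_norm q \<Omega> u powr q / q" using q0 by (intro divide_right_mono) auto
  with 1 show ?thesis unfolding \<tau>_def by linarith
qed

lemma energy_le_of_weak_limit:
  assumes u: "u \<in> W1p0 p \<Omega>" and v: "\<And>n::nat. v n \<in> W1p0 p \<Omega>" and E: "\<And>n. E (v n) < a"
    and weak: "\<And>l. l \<in> W1p0_dual p \<Omega> \<Longrightarrow> (\<lambda>n. l (v n)) \<longlonglongrightarrow> l u"
  shows "E u \<le> a"
proof -
  let ?M = "lebesgue_on \<Omega>"
  \<comment> \<open>Errors tending to 0 in norm do not change the weak limit, and the strict bound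
    on the energy leaves room for the replacement.\<close>
  have "\<exists>\<phi>. \<phi> \<in> test_functions \<Omega> \<and> E \<phi> < a \<and> W1p0_norm p \<Omega> (\<lambda>x. v n x + (-1) * \<phi> x) < inverse (real (Suc n))" for n
    using test_function_approx[OF v[of n] E[of n], of "inverse (real (Suc n))"] by (metis inverse_positive_iff_positive of_nat_0_less_iff zero_less_Suc)
  then obtain \<phi> where \<phi>: "\<And>n. \<phi> n \<in> test_functions \<Omega>" "\<And>n. E (\<phi> n) < a"
    "\<And>n. W1p0_norm p \<Omega> (\<lambda>x. v n x + (-1) * \<phi> n x) < inverse (real (Suc n))" by metis
  note \<phi>W = test_function_W1p0[OF \<Omega>(2) p(1) \<phi>(1)]
  obtain C where C: "\<And>u. u \<in> W1p0 p \<Omega> \<Longrightarrow> E u \<le> a \<Longrightarrow> W1p0_norm p \<Omega> u \<le> C"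
    using energy_bound_imp_norm_bound[of a] by blast
  have \<phi>C: "W1p0_norm p \<Omega> (\<phi> n) \<le> C" for n
    using C[OF \<phi>W] \<phi>(2)[of n] by simp
  have weak\<phi>: "(\<lambda>n. l (\<phi> n)) \<longlonglongrightarrow> l u" if l: "l \<in> W1p0_dual p \<Omega>" for l
  proof -
    obtain D where D: "\<And>v. v \<in> W1p0 p \<Omega> \<Longrightarrow> \<bar>l v\<bar> \<le> D * W1p0_norm p \<Omega> v"
      using l unfolding W1p0_dual_def by blast
    have "(\<lambda>n. l (v n) - l (\<phi> n)) \<longlonglongrightarrow> 0"
    proof (rule Lim_null_comparison)
      show "\<forall>\<^sub>F n in sequentially. norm (l (v n) - l (\<phi> n)) \<le> \<bar>D\<bar> * inverse (real (Suc n))"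
      proof (intro always_eventually allI)
        fix n
        have "norm (l (v n) - l (\<phi> n)) \<le> D * W1p0_norm p \<Omega> (\<lambda>x. v n x + (-1) * \<phi> n x)"
          using D[OF W1p0_add_cmult[OF \<Omega>(2) p(1) v \<phi>W]] unfolding dual_diff[OF l v \<phi>W, symmetric] real_norm_def .
        also have "\<dots> \<le> \<bar>D\<bar> * inverse (real (Suc n))"
          using \<phi>(3)[of n] by (intro mult_mono) (auto simp: W1p0_norm_nonneg)
        finally show "norm (l (v n) - l (\<phi> n)) \<le> \<bar>D\<bar> * inverse (real (Suc n))" .
      qed
      show "(\<lambda>n. \<bar>D\<bar> * inverse (real (Suc n))) \<longlonglongrightarrow> 0"
        by (rule tendsto_mult_right_zero[OF LIMSEQ_inverse_real_of_nat])
    qed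
    from tendsto_diff[OF weak[OF l] this] show ?thesis by simp
  qed
  obtain r :: "nat \<Rightarrow> nat" where r: "strict_mono r" "AE x in ?M. (\<lambda>j. \<phi> (r j) x) \<longlonglongrightarrow> u x"
    using weakly_convergent_test_functions_AE_subseq[OF u \<phi>(1) \<phi>C weak\<phi>] by blast
  have weakr: "(\<lambda>j. l (\<phi> (r j))) \<longlonglongrightarrow> l u" if "l \<in> W1p0_dual p \<Omega>" for l
    using LIMSEQ_subseq_LIMSEQ[OF weak\<phi>[OF that] r(1)] by (simp add: o_def)
  define I where "I = (LINT x|?M. norm (weak_gradient \<Omega> u x) powr p)"
  \<comment> \<open>The gradient lost by truncation at level \<open>m + 1\<close>; it vanishes in
    the limit because the slope tends to 1 at every point, and \<open>I \<ge> 0\<close> then makes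
    \<open>max 0\<close> disappear.\<close>
  define J where "J m = (LINT x|?M. norm (weak_gradient \<Omega> u x) powr p * (1 - trunc' (real (Suc m)) (u x)))" for m
  have le: "P (max 0 (I - p * J m)) / p - Lp_norm q \<Omega> u powr q / q \<le> a" for m
    unfolding I_def J_def
    using \<phi>(2) by (intro truncated_energy_le[OF u \<phi>(1) \<phi>C weakr r(2)]) (auto intro: less_imp_le)
  note DL = Lp_spaceD[OF W1pD(3)[OF \<Omega>(2) W1p0_imp_W1p[OF u]]]
  have "J \<longlonglongrightarrow> (LINT x|?M. 0)"
    unfolding J_def
  proof (rule integral_dominated_convergence[where w = "\<lambda>x. norm (weak_gradient \<Omega> u x) powr p"])
    have [measurable]: "trunc' k \<in> borel_measurable borel" for k
      by (rule borel_measurable_continuous_onI[OF continuous_trunc'])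
    have [measurable]: "u \<in> borel_measurable (?M)" by (rule Lp_spaceD(1)[OF W1p0_Lq[OF u]])
    note [measurable] = DL(1)
    show "(\<lambda>x. norm (weak_gradient \<Omega> u x) powr p * (1 - trunc' (real (Suc m)) (u x))) \<in> borel_measurable (?M)" for m
      by measurable
    show "AE x in ?M. (\<lambda>m. norm (weak_gradient \<Omega> u x) powr p * (1 - trunc' (real (Suc m)) (u x))) \<longlonglongrightarrow> 0"
    proof (rule AE_I2)
      fix x
      have "(\<lambda>m. norm (weak_gradient \<Omega> u x) powr p * (1 - trunc' (real (Suc m)) (u x))) \<longlonglongrightarrow> norm (weak_gradient \<Omega> u x) powr p * (1 - 1)"
        by (intro tendsto_intros trunc'_tendsto)
      then show "(\<lambda>m. norm (weak_gradient \<Omega> u x) powr p * (1 - trunc' (real (Suc m)) (u x))) \<longlonglongrightarrow> 0" by simp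
    qed
    show "AE x in ?M. norm (norm (weak_gradient \<Omega> u x) powr p * (1 - trunc' (real (Suc m)) (u x))) \<le> norm (weak_gradient \<Omega> u x) powr p" for m
      using trunc'_bounds by (intro AE_I2) (auto simp: abs_mult intro!: mult_left_le)
  qed (use DL in auto)
  then have "(\<lambda>m. P (max 0 (I - p * J m)) / p - Lp_norm q \<Omega> u powr q / q) \<longlonglongrightarrow> P (max 0 (I - p * 0)) / p - Lp_norm q \<Omega> u powr q / q"
    using p0 by (intro tendsto_diff tendsto_divide tendsto_const P_tendsto tendsto_max tendsto_mult) auto
  from LIMSEQ_le_const2[OF this] le
  have "P (max 0 (I - p * 0)) / p - Lp_norm q \<Omega> u powr q / q \<le> a" by blast
  moreover have "max 0 (I - p * 0) = W1p0_norm p \<Omega> u powr p"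
    using p0 by (simp add: W1p0_norm_def Lp_norm_powr I_def max_def)
  ultimately show ?thesis unfolding E_eq by simp
qed

lemma energy_seq_weakly_lsc: "seq_weakly_lsc_W1p0 p \<Omega> E"
  unfolding seq_weakly_lsc_W1p0_def
proof (intro allI impI, elim conjE)
  fix v :: "nat \<Rightarrow> real^'n \<Rightarrow> real" and u
  assume v: "\<forall>n. v n \<in> W1p0 p \<Omega>" and u: "u \<in> W1p0 p \<Omega>" and weak: "W1p0_weakly_converges p \<Omega> v u"
  show "ereal (E u) \<le> liminf (\<lambda>n. ereal (E (v n)))"
  proof (rule ccontr)
    assume "\<not> ?thesis"
    then have "liminf (\<lambda>n. ereal (E (v n))) < ereal (E u)" by (simp only: not_le)
    from ereal_dense2[OF this]
    obtain a where a: "liminf (\<lambda>n. ereal (E (v n))) < ereal a" "ereal a < ereal (E u)" by blast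
    \<comment> \<open>A value \<open>a\<close> strictly between the lower limit and
      \<open>E u\<close> is undercut infinitely often, which gives the subsequence with a strict
      energy bound.\<close>
    have "\<exists>n>m. E (v n) < a" for m
    proof (rule ccontr)
      assume no: "\<not> ?thesis"
      have "a \<le> E (v n)" if "m < n" for n using no that by (metis not_le)
      then have "\<forall>\<^sub>F n in sequentially. ereal a \<le> ereal (E (v n))"
        by (intro eventually_mono[OF eventually_gt_at_top[of m]]) simp
      then have "ereal a \<le> liminf (\<lambda>n. ereal (E (v n)))" by (rule Liminf_bounded)
      with a(1) show False by simp
    qed
    then have "infinite {n. E (v n) < a}" by (auto simp: infinite_nat_iff_unbounded)
    from infinite_enumerate[OF this]
    obtain r :: "nat \<Rightarrow> nat" where r: "strict_mono r" "\<And>j. E (v (r j)) < a" by auto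
    have "(\<lambda>j. l (v (r j))) \<longlonglongrightarrow> l u" if "l \<in> W1p0_dual p \<Omega>" for l
      using LIMSEQ_subseq_LIMSEQ[OF _ r(1), of "\<lambda>n. l (v n)" "l u"] weak that
      by (simp add: W1p0_weakly_converges_def o_def)
    then have "E u \<le> a"
      using v r(2) by (intro energy_le_of_weak_limit[OF u, of "\<lambda>j. v (r j)"]) auto
    with a(2) show False by simp
  qed
qed

end

theorem theorem1p2:
  fixes p ps c :: real and \<Omega> :: "(real^'n) set" and M :: "real \<Rightarrow> real"
  assumes p: "1 < p" "p < 2" "p < real CARD('n)"
    and ps: "ps = critical_exponent CARD('n) p"
    and \<Omega>: "bounded \<Omega>" "open \<Omega>" "connected \<Omega>" "smooth_boundary \<Omega>"
    and M: "continuous_on {0..} M" "\<forall>t\<ge>0. 0 \<le> M t"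
    and superadditive: "\<forall>t\<ge>0. \<forall>s\<ge>0. primitive0 M (t + s) \<ge> primitive0 M t + primitive0 M s"
    and c: "c = 2 powr (2 * ps - 1 - ps / p) * (p / ps) * sobolev_constant p \<Omega> powr (- (ps / p))"
    and growth: "(INF t\<in>{0<..}. primitive0 M t / t powr (ps / p)) \<ge> c"
  shows "seq_weakly_lsc_W1p0 p \<Omega> (kirchhoff_energy p \<Omega> M)"
proof (cases "\<Omega> = {}")
  \<comment> \<open>On the empty set every positive number is an admissible Sobolev constant and
    \<open>GREATEST\<close> is undetermined, so this case is settled directly: all norms are 0 and
    the energy is constant.\<close>
  case True
  have Lp: "Lp_norm r {} f = 0" for r and f :: "real^'n \<Rightarrow> 'b::euclidean_space"
    by (simp add: Lp_norm_def)
  have const: "kirchhoff_energy p \<Omega> M v = kirchhoff_energy p \<Omega> M u" for u v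
    unfolding True kirchhoff_energy_def W1p0_norm_def Lp by (rule refl)
  have "ereal (kirchhoff_energy p \<Omega> M u) \<le> liminf (\<lambda>n. ereal (kirchhoff_energy p \<Omega> M (v n)))" for u v
    unfolding const[of "v _" u] by (simp add: Liminf_const)
  then show ?thesis unfolding seq_weakly_lsc_W1p0_def by blast
next
  case False
  have q: "p < ps" "1 < ps" using critical_exponent_gt[OF p(1,3)] by (simp_all add: ps)
  \<comment> \<open>The power of two in the constant. Its exponent is
    \<open>(ps - 1) + (ps - ps / p)\<close>, a sum of two positive terms, so \<open>A\<close>
    exceeds 1.\<close>
  define A where "A = 2 powr (2 * ps - 1 - ps / p)"
  have "ps / p < ps * 1" using p q by (simp add: divide_less_eq)
  then have "0 < 2 * ps - 1 - ps / p" using q by linarith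
  then have A: "1 < A" by (simp add: A_def)
  note prim = primitive0_properties[OF M]
  interpret kirchhoff p ps c A "sobolev_constant p \<Omega>" \<Omega> M "primitive0 M"
  proof
    show "0 \<le> t \<Longrightarrow> c * t powr (ps / p) \<le> primitive0 M t" for t
      using primitive0_growth[OF M growth] p q by simp
    show "X \<longlonglongrightarrow> t \<Longrightarrow> (\<And>n. 0 \<le> X n) \<Longrightarrow> (\<lambda>n. primitive0 M (X n)) \<longlonglongrightarrow> primitive0 M t" for X t
      by (rule prim(3))
  qed (use p ps \<Omega> False prim(1) superadditive A c in \<open>auto simp: A_def\<close>)
  show ?thesis by (rule energy_seq_weakly_lsc)
qed

end
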